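(* Assume that $b:[0,T]\times\mathbb{R}^d\to\mathbb{R}^d$ is measurable and bounded by $B<+\infty$. Then there exists $C<+\infty$ such that for all $h\in(0,T]$ and all integers $k$ with $0\le k\le\lfloor T/h\rfloor$, $$\left\|\mu_{kh}-\mu^h_{kh}\right\|_{\rm TV}\le C\sqrt{h}.$$
   Context: Let $d\ge 1$ be an integer, $T\in(0,+\infty)$, $m$ a probability measure on $\mathbb{R}^d$, $(W_t)_{t\ge0}$ a $d$-dimensional Brownian motion and $X_0$ an $\mathbb{R}^d$-valued random vector with law $m$, independent of $(W_t)_{t\ge 0}$. That $b=(b_i)_{1\le i\le d}$ is bounded by $B$ means $|b_i(t,x)|\le B$ for all $i$ and all $(t,x)\in[0,T]\times\mathbb{R}^d$. The process $(X_t)_{t\in[0,T]}$ is the solution of $X_t=X_0+W_t+\int_0^t b(s,X_s)\,ds$, $t\in[0,T]$. For a time-step $h\in(0,T]$, let $(\delta_k)_{k}$ be independent random variables, $\delta_k$ being uniformly distributed on $[kh,(k+1)h]$, independent from $(X_0,(W_t)_{t\ge0})$. The Euler-Maruyama scheme with randomized time variable is defined by $X^h_0=X_0$ and $X^h_{(k+1)h}=X^h_{kh}+(W_{(k+1)h}-W_{kh})+b(\delta_k,X^h_{kh})h$ for $0\le k\le\lfloor T/h\rfloor-1$. $\mu_t$ denotes the law of $X_t$ and $\mu^h_{kh}$ the law of $X^h_{kh}$ (so $\mu_0=\mu^h_0=m$). For a signed measure $\mu$ on $\mathbb{R}^d$, $\|\mu\|_{\rm TV}=\sup_{\varphi}\int_{\mathbb{R}^d}\varphi\,d\mu$,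 the supremum being over all measurable $\varphi:\mathbb{R}^d\to[-1,1]$. *)

theory Defs
  imports "HOL-Probability.Probability"
begin

text \<open>
  Standard \<open>d\<close>-dimensional Brownian motion, \<open>d = CARD('n)\<close>. The product of normal densities is
  the density of \<open>N(0, (t - s) I\<^sub>d)\<close>.
\<close>

definition brownian_motion :: "'a measure \<Rightarrow> (real \<Rightarrow> 'a \<Rightarrow> real ^ 'n) \<Rightarrow> bool" where
  "brownian_motion M W \<longleftrightarrow>
     prob_space M \<and>
     (\<forall>t\<ge>0. W t \<in> borel_measurable M) \<and>
     (AE \<omega> in M. W 0 \<omega> = 0) \<and>
     (AE \<omega> in M. continuous_on {0..} (\<lambda>t. W t \<omega>)) \<and>
     (\<forall>n (\<tau> :: nat \<Rightarrow> real). 0 \<le> \<tau> 0 \<longrightarrow> (\<forall>i<n. \<tau> i \<le> \<tau> (Suc i)) \<longrightarrow>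
        prob_space.indep_vars M (\<lambda>_. borel) (\<lambda>i \<omega>. W (\<tau> (Suc i)) \<omega> - W (\<tau> i) \<omega>) {..<n}) \<and>
     (\<forall>s t. 0 \<le> s \<longrightarrow> s < t \<longrightarrow>
        distributed M lborel (\<lambda>\<omega>. W t \<omega> - W s \<omega>)
          (\<lambda>x. ennreal (\<Prod>i\<in>UNIV. normal_density 0 (sqrt (t - s)) (x $ i))))"

text \<open>
  Independence of two random variables with possibly different value types; the library's
  \<open>indep_var\<close> is the case of equal types.
\<close>

definition independent_rvs ::
  "'a measure \<Rightarrow> 'b measure \<Rightarrow> ('a \<Rightarrow> 'b) \<Rightarrow> 'c measure \<Rightarrow> ('a \<Rightarrow> 'c) \<Rightarrow> bool" where
  "independent_rvs M N Y L Z \<longleftrightarrow>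
     Y \<in> measurable M N \<and> Z \<in> measurable M L \<and>
     prob_space.indep_set M {Y -` A \<inter> space M | A. A \<in> sets N} {Z -` A \<inter> space M | A. A \<in> sets L}"

lemma independent_rvs_same_type:
  assumes "prob_space M"
  shows "independent_rvs M N Y L Z \<longleftrightarrow> prob_space.indep_var M N Y L Z"
proof -
  interpret prob_space M by fact
  have "{Y -` A \<inter> space M | A. A \<in> sets N} = sigma_sets (space M) {Y -` A \<inter> space M | A. A \<in> sets N}"
    if "Y \<in> measurable M N" for Y :: "'a \<Rightarrow> 'b" and N
    using sets_vimage_algebra2[of Y "space M" N] sets_vimage_algebra[of "space M" Y N] that
    by (simp add: measurable_def)
  then show ?thesis
    unfolding independent_rvs_def indep_var_eq by (metis (no_types, lifting))
qed

definition process_path :: "(real \<Rightarrow> 'a \<Rightarrow> 'b) \<Rightarrow> 'a \<Rightarrow> real \<Rightarrow> 'b" where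
  "process_path W \<omega> = (\<lambda>t\<in>{0..}. W t \<omega>)"

text \<open>The filtration generated by the initial condition, the driving process and the null events.\<close>

definition augmented_filtration ::
  "'a measure \<Rightarrow> ('a \<Rightarrow> 'b::topological_space) \<Rightarrow> (real \<Rightarrow> 'a \<Rightarrow> 'b) \<Rightarrow> real \<Rightarrow> 'a measure" where
  "augmented_filtration M X0 W t =
     sigma (space M)
       ({X0 -` A \<inter> space M | A. A \<in> sets borel} \<union>
        {W s -` A \<inter> space M | s A. 0 \<le> s \<and> s \<le> t \<and> A \<in> sets borel} \<union>
        null_sets M)"

text \<open>
  Strong solution on \<open>[0, T]\<close> of \<open>dX\<^sub>t = dW\<^sub>t + b(t, X\<^sub>t) dt\<close> started from \<open>X0\<close>. Continuity of the
  paths is a consequence of the integral equation.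
\<close>

definition sde_solution ::
  "'a measure \<Rightarrow> real \<Rightarrow> (real \<Rightarrow> real ^ 'n \<Rightarrow> real ^ 'n) \<Rightarrow> ('a \<Rightarrow> real ^ 'n) \<Rightarrow>
   (real \<Rightarrow> 'a \<Rightarrow> real ^ 'n) \<Rightarrow> (real \<Rightarrow> 'a \<Rightarrow> real ^ 'n) \<Rightarrow> bool" where
  "sde_solution M T b X0 W X \<longleftrightarrow>
     (\<forall>t\<in>{0..T}. X t \<in> borel_measurable (augmented_filtration M X0 W t)) \<and>
     (AE \<omega> in M.
        set_integrable lborel {0..T} (\<lambda>s. b s (X s \<omega>)) \<and>
        (\<forall>t\<in>{0..T}. X t \<omega> = X0 \<omega> + W t \<omega> + (LINT s:{0..t}|lborel. b s (X s \<omega>))))"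

text \<open>
  The random times used by the scheme with step \<open>h\<close> on \<open>[0, T]\<close>. They are required to lie in their
  interval surely, not merely almost surely, since \<open>b\<close> is only specified on \<open>[0, T]\<close>.
\<close>

definition randomized_times ::
  "'a measure \<Rightarrow> real \<Rightarrow> real \<Rightarrow> ('a \<Rightarrow> real ^ 'n) \<Rightarrow> (real \<Rightarrow> 'a \<Rightarrow> real ^ 'n) \<Rightarrow>
   (nat \<Rightarrow> 'a \<Rightarrow> real) \<Rightarrow> bool" where
  "randomized_times M T h X0 W \<delta> \<longleftrightarrow>
     (let I = {..<nat \<lfloor>T / h\<rfloor>} in
       (\<forall>k\<in>I. \<forall>\<omega>\<in>space M. \<delta> k \<omega> \<in> {real k * h..real (k + 1) * h}) \<and>
       (\<forall>k\<in>I. distr M borel (\<delta> k) = uniform_measure lborel {real k * h..real (k + 1) * h}) \<and>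
       prob_space.indep_vars M (\<lambda>_. borel) \<delta> I \<and>
       independent_rvs M
         (\<Pi>\<^sub>M k\<in>I. borel) (\<lambda>\<omega>. \<lambda>k\<in>I. \<delta> k \<omega>)
         (borel \<Otimes>\<^sub>M (\<Pi>\<^sub>M t\<in>{0..}. borel)) (\<lambda>\<omega>. (X0 \<omega>, process_path W \<omega>)))"

text \<open>\<open>euler_scheme b h X0 W \<delta> k\<close> is the scheme at time \<open>k h\<close>.\<close>

primrec euler_scheme ::
  "(real \<Rightarrow> real ^ 'n \<Rightarrow> real ^ 'n) \<Rightarrow> real \<Rightarrow> ('a \<Rightarrow> real ^ 'n) \<Rightarrow> (real \<Rightarrow> 'a \<Rightarrow> real ^ 'n) \<Rightarrow>
   (nat \<Rightarrow> 'a \<Rightarrow> real) \<Rightarrow> nat \<Rightarrow> 'a \<Rightarrow> real ^ 'n" where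
  "euler_scheme b h X0 W \<delta> 0 = X0"
| "euler_scheme b h X0 W \<delta> (Suc k) =
     (\<lambda>\<omega>. euler_scheme b h X0 W \<delta> k \<omega>
        + (W (real (k + 1) * h) \<omega> - W (real k * h) \<omega>)
        + h *\<^sub>R b (\<delta> k \<omega>) (euler_scheme b h X0 W \<delta> k \<omega>))"

text \<open>
  Total variation norm of the signed measure \<open>\<mu> - \<nu>\<close>, for finite Borel measures \<open>\<mu>\<close> and \<open>\<nu>\<close> (so
  that the supremum is over a bounded set of reals). Test functions take values in \<open>[-1, 1]\<close>, hence
  this is twice the supremum of \<open>\<bar>\<mu> A - \<nu> A\<bar>\<close> over events for probability measures.
\<close>

definition tv_norm_diff :: "'b::topological_space measure \<Rightarrow> 'b measure \<Rightarrow> real" where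
  "tv_norm_diff \<mu> \<nu> =
     (SUP \<phi>\<in>{\<phi> \<in> borel_measurable borel. \<forall>x. \<phi> x \<in> {-1..1}}.
        (LINT x|\<mu>. \<phi> x) - (LINT x|\<nu>. \<phi> x))"

end

theory Submission imports Defs begin

text \<open>
  Write \<open>P\<^sub>t\<close> for the heat semigroup, \<open>\<mu>\<^sub>t\<close> for the law of the solution at time \<open>t\<close> and
  \<open>\<nu>\<^sub>k\<close> for the law of the scheme after \<open>k\<close> steps. Although the drift is only measurable and
  bounded, a bounded test function \<open>f\<close> becomes smooth under \<open>P\<^sub>t\<close>: its gradient is of order
  \<open>1 / sqrt t\<close>, and this singularity is integrable. All regularity in the proof comes from there.

  The laws are compared through two expansions. Duhamel's formula (\<open>duhamel\<close>) expresses
  \<open>\<mu>\<^sub>t(f)\<close> as \<open>\<mu>\<^sub>0(P\<^sub>t f)\<close> plus the integral over \<open>s \<le> t\<close> of the mean, under \<open>\<mu>\<^sub>s\<close>, of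
  the gradient of \<open>P\<^bsub>t - s\<^esub> f\<close> paired with the drift at time \<open>s\<close>. It is derived without
  stochastic integrals from the independence of the Brownian increments. For the
  scheme, averaging over the random time \<open>\<delta> k\<close> makes the drift enter through its integral over the
  step (\<open>scheme_step\<close>), and a Taylor expansion gives the same formula with state and gradient frozen at
  the beginning of each step, up to \<open>O(sqrt h)\<close> (\<open>scheme_expansion\<close>). Randomizing the
  time is what makes the two formulas comparable without regularity of the drift in time.

  In the difference (\<open>flux_difference\<close>), freezing the time of the gradient costs \<open>O(sqrt h)\<close> in
  total because the bound telescopes (\<open>heat_grad_time_regularity\<close>). The remaining terms compare
  \<open>\<mu>\<^sub>s\<close> with \<open>\<mu>\<^bsub>k h\<^esub>\<close>, and \<open>\<mu>\<^bsub>k h\<^esub>\<close> with \<open>\<nu>\<^sub>k\<close>, on one bounded measurable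
  function, so total variation controls them. For the former, \<open>tv_time_regularity\<close> gives
  \<open>O(1 / k + sqrt h)\<close> on the step with index \<open>k\<close>, which is small enough after summation against the
  kernel. The latter leads to a recursion for the errors \<open>e\<^sub>k\<close> with the kernel
  \<open>sqrt h / sqrt (K - k)\<close> (\<open>tv_error_recursion\<close>), which \<open>singular_gronwall\<close> solves.

  Duhamel's formula needs Lipschitz test functions, for which the limit \<open>s \<rightarrow> t\<close> exists.
  Inequalities pass from them to all bounded measurable test functions by inner regularity
  (\<open>integral_diff_le_of_lipschitz\<close>).
\<close>

section \<open>Gaussian laws\<close>

definition gauss_density :: "real \<Rightarrow> 'a::euclidean_space \<Rightarrow> real" where
  "gauss_density t x = (\<Prod>b\<in>Basis. normal_density 0 (sqrt t) (x \<bullet> b))"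

text \<open>
  The law $N(0, t I)$ of a Brownian increment over time \<open>t\<close>. Reading it as the Dirac mass at the
  origin for \<open>t \<le> 0\<close> keeps the convolution law, and with it the semigroup law below, valid
  down to time \<open>0\<close>.
\<close>

definition gauss :: "real \<Rightarrow> 'a::euclidean_space measure" where
  "gauss t = (if t \<le> 0 then return borel 0 else density lborel (\<lambda>x. ennreal (gauss_density t x)))"

lemma sets_gauss [simp, measurable_cong]: "sets (gauss t) = sets borel"
  by (simp add: gauss_def)

lemma space_gauss [simp]: "space (gauss t) = UNIV"
  by (simp add: gauss_def)

lemma gauss_density_nonneg [simp]: "0 \<le> gauss_density t x"
  by (simp add: gauss_density_def prod_nonneg)

lemma gauss_density_measurable [measurable]: "gauss_density t \<in> borel_measurable borel"
  unfolding gauss_density_def[abs_def] by measurable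

text \<open>
  The rotation invariant form of the density gives its symmetry, its derivative along a line and its
  measurability in \<open>t\<close>. The absolute value is there for the last of these: the square of
  \<open>sqrt t\<close> is \<open>\<bar>t\<bar>\<close> for every real \<open>t\<close>.
\<close>

lemma gauss_density_eq:
  "gauss_density t (x :: 'a::euclidean_space) =
     (1 / sqrt (2 * pi * \<bar>t\<bar>)) ^ DIM('a) * exp (- (x \<bullet> x) / (2 * \<bar>t\<bar>))"
proof -
  have sq: "(sqrt t)\<^sup>2 = \<bar>t\<bar>"
    by (cases "t \<ge> 0") (auto simp: real_sqrt_minus[symmetric] power2_eq_square simp flip: real_sqrt_mult)
  have "gauss_density t x = (\<Prod>b\<in>Basis. 1 / sqrt (2 * pi * \<bar>t\<bar>) * exp (- (x \<bullet> b)\<^sup>2 / (2 * \<bar>t\<bar>)))"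
    by (simp add: gauss_density_def normal_density_def sq)
  also have "\<dots> = (1 / sqrt (2 * pi * \<bar>t\<bar>)) ^ DIM('a) * (\<Prod>b\<in>Basis. exp (- (x \<bullet> b)\<^sup>2 / (2 * \<bar>t\<bar>)))"
    by (simp only: prod.distrib prod_constant)
  also have "(\<Prod>b\<in>(Basis::'a set). exp (- (x \<bullet> b)\<^sup>2 / (2 * \<bar>t\<bar>))) = exp (\<Sum>b\<in>Basis. - (x \<bullet> b)\<^sup>2 / (2 * \<bar>t\<bar>))"
    by (simp add: exp_sum)
  also have "(\<Sum>b\<in>(Basis::'a set). - (x \<bullet> b)\<^sup>2 / (2 * \<bar>t\<bar>)) = - (x \<bullet> x) / (2 * \<bar>t\<bar>)"
    by (subst (2) euclidean_inner) (simp add: power2_eq_square sum_divide_distrib sum_negf)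
  finally show ?thesis .
qed

lemma gauss_density_uminus [simp]: "gauss_density t (- x) = gauss_density t x"
  by (simp add: gauss_density_eq)

text \<open>
  Tensorization: the total mass and the second moments reduce to the normal law on the line.
\<close>

lemma nn_integral_gauss_density_prod:
  fixes f :: "'a::euclidean_space \<Rightarrow> real \<Rightarrow> ennreal"
  assumes [measurable]: "\<And>b. b \<in> Basis \<Longrightarrow> f b \<in> borel_measurable borel" and t: "0 < t"
  shows "(\<integral>\<^sup>+x. (\<Prod>b\<in>Basis. f b (x \<bullet> b)) \<partial>gauss t) =
         (\<Prod>b\<in>Basis. \<integral>\<^sup>+x. ennreal (normal_density 0 (sqrt t) x) * f b x \<partial>lborel)"
proof -
  have "(\<integral>\<^sup>+x. (\<Prod>b\<in>Basis. f b (x \<bullet> b)) \<partial>gauss t) =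
        (\<integral>\<^sup>+x. (\<Prod>b\<in>Basis. ennreal (normal_density 0 (sqrt t) (x \<bullet> b)) * f b (x \<bullet> b)) \<partial>lborel)"
    using t by (simp add: gauss_def nn_integral_density gauss_density_def prod_ennreal prod.distrib)
  also have "\<dots> = (\<Prod>b\<in>Basis. \<integral>\<^sup>+x. ennreal (normal_density 0 (sqrt t) x) * f b x \<partial>lborel)"
    by (rule nn_integral_lborel_prod) auto
  finally show ?thesis .
qed

lemma nn_integral_normal_density: "0 < s \<Longrightarrow> (\<integral>\<^sup>+x. ennreal (normal_density 0 s x) \<partial>lborel) = 1"
  by (subst nn_integral_eq_integral) auto

lemma prob_space_gauss: "prob_space (gauss t :: 'a::euclidean_space measure)"
proof (cases "t \<le> 0")
  case False
  show ?thesis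
  proof
    have "emeasure (gauss t :: 'a measure) (space (gauss t)) = (\<integral>\<^sup>+x. (\<Prod>b\<in>Basis. (\<lambda>_ _. 1) b (x \<bullet> b)) \<partial>(gauss t :: 'a measure))"
      by simp
    also have "\<dots> = 1"
      using False by (subst nn_integral_gauss_density_prod) (simp_all add: nn_integral_normal_density)
    finally show "emeasure (gauss t :: 'a measure) (space (gauss t)) = 1" .
  qed
qed (auto simp: gauss_def intro!: prob_space_return)

interpretation gauss: prob_space "gauss t"
  by (rule prob_space_gauss)

lemma nn_integral_gauss_coord_square:
  fixes b :: "'a::euclidean_space"
  assumes b: "b \<in> Basis" and t: "0 < t"
  shows "(\<integral>\<^sup>+x. ennreal ((x \<bullet> b)\<^sup>2) \<partial>gauss t) = ennreal t"
proof -
  let ?f = "\<lambda>b' y. if b' = b then ennreal (y\<^sup>2) else 1"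
  have "(\<integral>\<^sup>+x. ennreal ((x \<bullet> b)\<^sup>2) \<partial>gauss t) = (\<integral>\<^sup>+x. (\<Prod>b'\<in>Basis. ?f b' (x \<bullet> b')) \<partial>gauss t)"
    using b by (simp add: prod.delta')
  also have "\<dots> = (\<Prod>b'\<in>Basis. \<integral>\<^sup>+x. ennreal (normal_density 0 (sqrt t) x) * ?f b' x \<partial>lborel)"
    by (rule nn_integral_gauss_density_prod) (use t in auto)
  also have "\<dots> = (\<Prod>b'\<in>Basis. if b' = b then ennreal t else 1)"
  proof (rule prod.cong[OF refl])
    have "has_bochner_integral lborel (\<lambda>x. normal_density 0 (sqrt t) x * (x - 0) ^ (2 * 1)) 
           (fact (2 * 1) / ((2 / (sqrt t)\<^sup>2) ^ 1 * fact 1))"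
      using t by (intro normal_moment_even) auto
    then have "has_bochner_integral lborel (\<lambda>x. normal_density 0 (sqrt t) x * x\<^sup>2) t"
      using t by (simp add: fact_numeral power2_eq_square)
    then have "(\<integral>\<^sup>+x. ennreal (normal_density 0 (sqrt t) x * x\<^sup>2) \<partial>lborel) = ennreal t"
      by (subst nn_integral_eq_integral) (auto simp: has_bochner_integral_iff)
    then show "(\<integral>\<^sup>+x. ennreal (normal_density 0 (sqrt t) x) * ?f b' x \<partial>lborel) = (if b' = b then ennreal t else 1)" for b'
      using t by (auto simp: nn_integral_normal_density ennreal_mult)
  qed
  also have "\<dots> = ennreal t" using b by (simp add: prod.delta')
  finally show ?thesis .
qed

lemma gauss_norm_square:
  fixes t :: real
  assumes t: "0 \<le> t"
  shows integrable_gauss_norm_square: "integrable (gauss t) (\<lambda>x::'a::euclidean_space. (norm x)\<^sup>2)"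
    and integral_gauss_norm_square: "(LINT x|gauss t. (norm (x::'a))\<^sup>2) = DIM('a) * t"
proof -
  have "integrable (gauss t) (\<lambda>x::'a. (norm x)\<^sup>2) \<and> (LINT x|gauss t. (norm (x::'a))\<^sup>2) = DIM('a) * t"
  proof (cases "t = 0")
    case True
    then show ?thesis by (simp add: gauss_def integral_return integrable_iff_bounded nn_integral_return)
  next
    case False
    with t have t: "t > 0" by simp
    have "(\<integral>\<^sup>+x. ennreal ((norm (x::'a))\<^sup>2) \<partial>gauss t) = (\<integral>\<^sup>+x. (\<Sum>b\<in>(Basis::'a set). ennreal ((x \<bullet> b)\<^sup>2)) \<partial>gauss t)"
      by (intro nn_integral_cong) (subst power2_norm_eq_inner, subst euclidean_inner, simp add: power2_eq_square)
    also have "\<dots> = (\<Sum>b\<in>(Basis::'a set). ennreal t)"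
      by (subst nn_integral_sum) (auto simp: nn_integral_gauss_coord_square[OF _ t])
    also have "\<dots> = ennreal (DIM('a) * t)"
      using t by (simp add: ennreal_of_nat_eq_real_of_nat ennreal_mult)
    finally have *: "(\<integral>\<^sup>+x. ennreal ((norm (x::'a))\<^sup>2) \<partial>gauss t) = ennreal (DIM('a) * t)" .
    show ?thesis
      using t by (intro nn_integral_eq_integrable[THEN iffD1] *) auto
  qed
  then show "integrable (gauss t) (\<lambda>x::'a. (norm x)\<^sup>2)" "(LINT x|gauss t. (norm (x::'a))\<^sup>2) = DIM('a) * t"
    by auto
qed

lemma integrable_gauss_norm: 
  assumes t: "0 \<le> t"
  shows "integrable (gauss t) (\<lambda>x::'a::euclidean_space. norm x)"
proof (rule Bochner_Integration.integrable_bound)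
  show "integrable (gauss t) (\<lambda>x::'a. 1 + (norm x)\<^sup>2)"
    by (intro Bochner_Integration.integrable_add integrable_gauss_norm_square t gauss.integrable_const)
  have "z \<le> 1 + z\<^sup>2" for z :: real
    using sum_squares_bound[of 1 z] zero_le_power2[of z] by (smt (verit) power2_eq_square mult_cancel_left1 power2_diff one_power2)
  then show "AE x in gauss t. norm (norm (x::'a)) \<le> norm (1 + (norm x)\<^sup>2)" by (intro AE_I2) simp
qed auto

text \<open>
  The first moment is at most the root of the second moment. The bound
  \<open>\<bar>x\<bar> \<le> (\<bar>x\<bar>\<^sup>2 / s + s) / 2\<close>, which holds for all \<open>s > 0\<close>, is used with that root as \<open>s\<close>.
\<close>

lemma integral_gauss_norm_le:
  assumes t: "0 \<le> t"
  shows "(LINT x|gauss t. norm (x::'a::euclidean_space)) \<le> sqrt DIM('a) * sqrt t"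
proof (cases "t = 0")
  case True then show ?thesis by (simp add: gauss_def integral_return)
next
  case False
  define s where "s = sqrt (DIM('a) * t)"
  have s: "s > 0" "s\<^sup>2 = DIM('a) * t" using False t by (auto simp: s_def)
  have "(LINT x|gauss t. norm (x::'a)) \<le> (LINT x|gauss t. ((norm (x::'a))\<^sup>2 / s + s) / 2)"
  proof (rule integral_mono)
    show "norm x \<le> ((norm x)\<^sup>2 / s + s) / 2" for x :: 'a
      using s sum_squares_bound[of "norm x" s] by (simp add: field_simps power2_eq_square)
  qed (intro integrable_gauss_norm integrable_gauss_norm_square t gauss.integrable_const
      Bochner_Integration.integrable_add integrable_divide)+
  also have "\<dots> = (DIM('a) * t / s + s) / 2"
    using t by (simp add: integrable_gauss_norm_square integral_gauss_norm_square gauss.prob_space[of t, simplified])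
  also have "\<dots> = s" using s by (simp flip: s(2) add: power2_eq_square)
  finally show ?thesis by (simp add: s_def real_sqrt_mult)
qed

lemma lborel_distr_uminus_euclidean: "distr lborel borel uminus = (lborel :: 'a::euclidean_space measure)"
  by (subst (2) lborel_affine[of "-1" 0]) (auto simp: density_1 one_ennreal_def[symmetric])

lemma distr_uminus_gauss: "distr (gauss t) borel uminus = (gauss t :: 'a::euclidean_space measure)"
proof (cases "t \<le> 0")
  case True
  then show ?thesis by (simp add: gauss_def distr_return)
next
  case False
  have "(gauss t :: 'a measure) = density (distr lborel borel uminus) (\<lambda>x. ennreal (gauss_density t x))"
    using False by (simp add: gauss_def lborel_distr_uminus_euclidean)
  also have "\<dots> = distr (density lborel (\<lambda>x. ennreal (gauss_density t (- x)))) borel uminus"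
    by (subst density_distr) (auto)
  finally show ?thesis using False by (simp add: gauss_def)
qed

text \<open>
  After a translation the density of the sum factorizes over the coordinates, and in each coordinate
  it is the convolution of two normal densities on the line.
\<close>

lemma gauss_convolution:
  assumes s: "0 \<le> s" and t: "0 \<le> t"
  shows "distr (gauss s \<Otimes>\<^sub>M gauss t) borel (\<lambda>(x, y). x + y) = (gauss (s + t) :: 'a::euclidean_space measure)"
    (is "?D = _")
proof (rule measure_eqI)
  fix A :: "'a set" assume "A \<in> sets ?D"
  then have A[measurable]: "A \<in> sets borel" by simp
  interpret p: pair_sigma_finite "gauss s" "gauss t" ..
  have "emeasure ?D A = (\<integral>\<^sup>+z. indicator A (fst z + snd z) \<partial>(gauss s \<Otimes>\<^sub>M gauss t))"
    by (subst nn_integral_indicator[symmetric], simp, subst nn_integral_distr) (auto simp: split_beta)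
  also have "\<dots> = (\<integral>\<^sup>+y. \<integral>\<^sup>+x. indicator A (x + y) \<partial>gauss s \<partial>gauss t)"
    by (subst p.nn_integral_snd[symmetric]) auto
  finally have D: "emeasure ?D A = (\<integral>\<^sup>+y. \<integral>\<^sup>+x. indicator A (x + y) \<partial>gauss s \<partial>gauss t)" .
  consider "s = 0" | "t = 0" | "s > 0" "t > 0" using s t by linarith
  then show "emeasure ?D A = emeasure (gauss (s + t)) A"
  proof cases
    case 1
    then show ?thesis unfolding D
      by (simp add: gauss_def[of 0] nn_integral_return)
  next
    case 2
    then show ?thesis unfolding D
      by (simp add: gauss_def[of 0] nn_integral_return)
  next
    case 3
    let ?g = "\<lambda>t x. ennreal (gauss_density t (x::'a))"
    have "emeasure ?D A = (\<integral>\<^sup>+y. ?g t y * (\<integral>\<^sup>+x. ?g s x * indicator A (x + y) \<partial>lborel) \<partial>lborel)"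
      unfolding D using 3 by (simp add: gauss_def nn_integral_density)
    also have "\<dots> = (\<integral>\<^sup>+y. ?g t y * (\<integral>\<^sup>+x. ?g s (x - y) * indicator A x \<partial>lborel) \<partial>lborel)"
    proof (rule nn_integral_cong, rule arg_cong2[where f="(*)", OF refl])
      fix y :: 'a
      have "(\<integral>\<^sup>+x. ?g s (x - y) * indicator A x \<partial>lborel) = (\<integral>\<^sup>+x. ?g s (x - y) * indicator A x \<partial>distr lborel borel ((+) y))"
        by (simp only: lborel_distr_plus)
      also have "\<dots> = (\<integral>\<^sup>+x. ?g s x * indicator A (x + y) \<partial>lborel)"
        by (subst nn_integral_distr) (auto simp: add.commute)
      finally show "(\<integral>\<^sup>+x. ?g s x * indicator A (x + y) \<partial>lborel) = (\<integral>\<^sup>+x. ?g s (x - y) * indicator A x \<partial>lborel)"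
        by (rule sym)
    qed
    also have "\<dots> = (\<integral>\<^sup>+y. (\<integral>\<^sup>+x. (?g s (x - y) * ?g t y) * indicator A x \<partial>lborel) \<partial>lborel)"
      by (subst nn_integral_cmult[symmetric]) (auto simp: mult_ac)
    also have "\<dots> = (\<integral>\<^sup>+x. (\<integral>\<^sup>+y. (?g s (x - y) * ?g t y) * indicator A x \<partial>lborel) \<partial>lborel)"
      by (rule lborel_pair.Fubini') measurable
    also have "\<dots> = (\<integral>\<^sup>+x. ?g (s + t) x * indicator A x \<partial>lborel)"
    proof (intro nn_integral_cong)
      fix x :: 'a
      have "(\<integral>\<^sup>+y. ?g s (x - y) * ?g t y \<partial>lborel) =
         (\<integral>\<^sup>+y. (\<Prod>b\<in>Basis. ennreal (normal_density 0 (sqrt s) (x \<bullet> b - y \<bullet> b) * normal_density 0 (sqrt t) (y \<bullet> b))) \<partial>lborel)"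
        by (simp add: gauss_density_def prod_ennreal prod_nonneg prod.distrib inner_diff_left flip: ennreal_mult)
      also have "\<dots> = (\<Prod>b\<in>Basis. \<integral>\<^sup>+y. ennreal (normal_density 0 (sqrt s) (x \<bullet> b - y) * normal_density 0 (sqrt t) y) \<partial>lborel)"
        by (rule nn_integral_lborel_prod) auto
      also have "\<dots> = (\<Prod>b\<in>Basis. ennreal (normal_density 0 (sqrt (s + t)) (x \<bullet> b)))"
        using fun_cong[OF conv_normal_density_zero_mean[of "sqrt s" "sqrt t"]] 3 by simp
      also have "\<dots> = ?g (s + t) x" by (simp add: gauss_density_def prod_ennreal)
      finally show "(\<integral>\<^sup>+y. (?g s (x - y) * ?g t y) * indicator A x \<partial>lborel) = ?g (s + t) x * indicator A x"
        by (subst nn_integral_multc) auto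
    qed
    also have "\<dots> = emeasure (gauss (s + t)) A"
      using 3 by (simp add: gauss_def emeasure_density)
    finally show ?thesis .
  qed
qed simp

section \<open>The heat semigroup\<close>

text \<open>
  The heat semigroup \<open>P\<^sub>t\<close>; on measurable functions it is the identity for
  \<open>t \<le> 0\<close>. The values of \<open>f\<close> may be vectors,
  because the semigroup is also applied to gradients.
\<close>

definition heat :: "real \<Rightarrow> ('a::euclidean_space \<Rightarrow> 'b::{banach, second_countable_topology}) \<Rightarrow> 'a \<Rightarrow> 'b" where
  "heat t f x = (LINT w|gauss t. f (x + w))"

lemma heat_nonpos: "t \<le> 0 \<Longrightarrow> f \<in> borel_measurable borel \<Longrightarrow> heat t f x = f x"
  by (simp add: heat_def gauss_def integral_return)

lemma heat_measurable [measurable]: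
  fixes f :: "'a::euclidean_space \<Rightarrow> 'b::{banach, second_countable_topology}"
  assumes [measurable]: "f \<in> borel_measurable borel"
  shows "heat t f \<in> borel_measurable borel"
  unfolding heat_def[abs_def] by measurable

text \<open>
  Integrability of \<open>f\<close> is not an issue: the Bochner integral of a function that is not
  integrable is \<open>0\<close>.
\<close>

lemma norm_integral_le_of_bound:
  fixes f :: "'a \<Rightarrow> 'b::{banach, second_countable_topology}"
  assumes "integrable M g" "AE x in M. norm (f x) \<le> g x"
  shows "norm (integral\<^sup>L M f) \<le> integral\<^sup>L M g"
proof (cases "integrable M f")
  case True
  have "norm (integral\<^sup>L M f) \<le> (LINT x|M. norm (f x))" by (rule integral_norm_bound)
  also have "\<dots> \<le> integral\<^sup>L M g" using True assms by (intro integral_mono_AE) auto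
  finally show ?thesis .
next
  case False
  have "0 \<le> integral\<^sup>L M g" by (intro integral_nonneg_AE) (use assms(2) in eventually_elim, use norm_ge_zero order_trans in blast)
  then show ?thesis using False by (simp add: not_integrable_integral_eq)
qed

lemma norm_set_integral_Icc_le:
  fixes f :: "real \<Rightarrow> 'b::{banach, second_countable_topology}"
  assumes "a \<le> b" and "\<And>r. a \<le> r \<Longrightarrow> r \<le> b \<Longrightarrow> norm (f r) \<le> K"
  shows "norm (LINT r:{a..b}|lborel. f r) \<le> K * (b - a)"
proof -
  have "norm (LINT r:{a..b}|lborel. f r) \<le> (LINT r::real|lborel. indicator {a..b} r * K)"
    unfolding set_lebesgue_integral_def
    by (rule norm_integral_le_of_bound)
       (use assms in \<open>auto intro!: AE_I2 integrable_mult_left integrable_real_indicator split: split_indicator\<close>)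
  then show ?thesis using assms by (simp add: mult.commute)
qed

lemma (in prob_space) norm_integral_le_const:
  fixes f :: "'a \<Rightarrow> 'b::{banach, second_countable_topology}"
  assumes "\<And>x. x \<in> space M \<Longrightarrow> norm (f x) \<le> C"
  shows "norm (integral\<^sup>L M f) \<le> C"
  using norm_integral_le_of_bound[of M "\<lambda>_. C" f] assms by (simp add: prob_space)

lemma (in finite_measure) integrable_of_bound:
  fixes f :: "'a \<Rightarrow> 'b::{banach, second_countable_topology}"
  assumes "f \<in> borel_measurable M" "\<And>x. x \<in> space M \<Longrightarrow> norm (f x) \<le> C"
  shows "integrable M f"
  using assms by (intro integrable_const_bound[of _ C]) auto

lemma heat_bound:
  assumes "\<And>x. norm (f x) \<le> C"
  shows "norm (heat t f x) \<le> C"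
  unfolding heat_def by (rule gauss.norm_integral_le_const) (rule assms)

lemma heat_integrable:
  fixes f :: "'a::euclidean_space \<Rightarrow> 'b::{banach, second_countable_topology}"
  assumes [measurable]: "f \<in> borel_measurable borel" and "\<And>x. norm (f x) \<le> C"
  shows "integrable (gauss t) (\<lambda>w. f (x + w))"
  by (rule gauss.integrable_of_bound[where C=C]) (auto simp: assms(2))

lemma heat_semigroup:
  fixes f :: "'a::euclidean_space \<Rightarrow> 'b::{banach, second_countable_topology}"
  assumes [measurable]: "f \<in> borel_measurable borel" and bd: "\<And>x. norm (f x) \<le> C"
    and s: "0 \<le> s" and t: "0 \<le> t"
  shows "heat s (heat t f) x = heat (s + t) f x"
proof -
  interpret p: pair_prob_space "gauss s" "gauss t :: 'a measure" ..
  have "heat (s + t) f x = (LINT z|(gauss s \<Otimes>\<^sub>M gauss t). f (x + (fst z + snd z)))"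
    unfolding heat_def gauss_convolution[OF s t, symmetric]
    by (subst integral_distr) (auto simp: split_beta)
  also have "\<dots> = (LINT u|gauss s. LINT w|gauss t. f (x + (u + w)))"
    by (subst p.integral_fst'[symmetric]) (auto intro!: p.P.integrable_of_bound[where C=C] bd)
  finally show ?thesis by (simp add: heat_def add_ac)
qed

text \<open>
  Gaussian integration by parts turns the gradient of \<open>P\<^sub>r f\<close> into the mean of \<open>f (x + w) w / r\<close>.
  This expression makes sense for every bounded measurable \<open>f\<close>, so it can serve as a definition
  that involves no derivative.
\<close>

definition stein :: "real \<Rightarrow> ('a::euclidean_space \<Rightarrow> real) \<Rightarrow> 'a \<Rightarrow> 'a" where
  "stein r f x = (LINT w|gauss r. (f (x + w) / r) *\<^sub>R w)"

lemma stein_measurable [measurable]: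
  fixes f :: "'a::euclidean_space \<Rightarrow> real"
  assumes [measurable]: "f \<in> borel_measurable borel"
  shows "stein r f \<in> borel_measurable borel"
  unfolding stein_def[abs_def] by measurable

lemma stein_integrable:
  fixes f :: "'a::euclidean_space \<Rightarrow> real"
  assumes [measurable]: "f \<in> borel_measurable borel" and bd: "\<And>x. \<bar>f x\<bar> \<le> C" and r: "0 \<le> r"
  shows "integrable (gauss r) (\<lambda>w. (f (x + w) / r) *\<^sub>R w)"
proof (rule Bochner_Integration.integrable_bound)
  show "integrable (gauss r) (\<lambda>w::'a. C / r * norm w)"
    by (intro integrable_mult_right integrable_gauss_norm r)
  show "AE w in gauss r. norm ((f (x + w) / r) *\<^sub>R w) \<le> norm (C / r * norm w)"
    using r bd order_trans[OF abs_ge_zero bd] 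
    by (intro AE_I2) (auto simp: abs_mult intro!: mult_right_mono divide_right_mono)
qed auto

text \<open>
  One derivative costs a factor of order \<open>1 / sqrt r\<close>, the mean of \<open>\<bar>w\<bar> / r\<close>.
\<close>

lemma stein_bound:
  fixes f :: "'a::euclidean_space \<Rightarrow> real"
  assumes bd: "\<And>x. \<bar>f x\<bar> \<le> C" and r: "0 < r"
  shows "norm (stein r f x) \<le> C * sqrt DIM('a) / sqrt r"
proof -
  have C: "0 \<le> C" using bd[of 0] by linarith
  have "norm (stein r f x) \<le> (LINT w|gauss r. C / r * norm (w::'a))"
    unfolding stein_def
  proof (rule norm_integral_le_of_bound)
    show "integrable (gauss r) (\<lambda>w::'a. C / r * norm w)"
      using r by (intro integrable_mult_right integrable_gauss_norm) auto
    show "AE w in gauss r. norm ((f (x + w) / r) *\<^sub>R w) \<le> C / r * norm w"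
      using r bd by (intro AE_I2) (auto simp: abs_mult intro!: mult_right_mono divide_right_mono)
  qed
  also have "\<dots> \<le> C / r * (sqrt DIM('a) * sqrt r)"
    using r C integral_gauss_norm_le[of r, where 'a='a] by (simp add: mult_left_mono divide_right_mono)
  also have "\<dots> = C * sqrt DIM('a) / sqrt r"
    using r by (simp add: field_simps) 
  finally show ?thesis .
qed

lemma stein_diff:
  fixes f :: "'a::euclidean_space \<Rightarrow> real"
  assumes "f \<in> borel_measurable borel" "\<And>x. \<bar>f x\<bar> \<le> C"
      and "g \<in> borel_measurable borel" "\<And>x. \<bar>g x\<bar> \<le> D" and "0 \<le> r"
  shows "stein r (\<lambda>x. f x - g x) x = stein r f x - stein r g x"
proof -
  have "stein r (\<lambda>x. f x - g x) x = (LINT w|gauss r. (f (x + w) / r) *\<^sub>R w - (g (x + w) / r) *\<^sub>R w)"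
    by (simp add: stein_def diff_divide_distrib scaleR_diff_left)
  then show ?thesis unfolding stein_def
    by (simp add: stein_integrable[OF assms(1,2,5)] stein_integrable[OF assms(3,4,5)])
qed

lemma stein_shift: "stein r (\<lambda>x. f (x + v)) x = stein r f (x + v)"
  by (simp add: stein_def add_ac)

text \<open>
  Both operations average translates of \<open>f\<close>, so they commute by Fubini.
\<close>

lemma stein_heat_commute:
  fixes f :: "'a::euclidean_space \<Rightarrow> real"
  assumes [measurable]: "f \<in> borel_measurable borel" and bd: "\<And>x. \<bar>f x\<bar> \<le> C" and r: "0 \<le> r"
  shows "heat s (stein r f) x = stein r (heat s f) x"
proof -
  interpret p: pair_prob_space "gauss s" "gauss r :: 'a measure" ..
  have int: "integrable (gauss s \<Otimes>\<^sub>M gauss r) (\<lambda>(u, w). (f (x + u + w) / r) *\<^sub>R w)"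
  proof (rule Bochner_Integration.integrable_bound)
    show "integrable (gauss s \<Otimes>\<^sub>M gauss r) (\<lambda>(u::'a, w::'a). C / r * norm w)"
    proof (rule p.Fubini_integrable)
      show "AE u in gauss s. integrable (gauss r) (\<lambda>w. case (u::'a, w::'a) of (u, w) \<Rightarrow> C / r * norm w)"
        using r by (simp add: integrable_gauss_norm)
    qed simp_all
    show "AE z in gauss s \<Otimes>\<^sub>M gauss r. norm (case z of (u, w) \<Rightarrow> (f (x + u + w) / r) *\<^sub>R w) \<le> norm (case z of (u::'a, w::'a) \<Rightarrow> C / r * norm w)"
      using r bd order_trans[OF abs_ge_zero bd] 
      by (intro AE_I2) (auto simp: abs_mult split_beta intro!: mult_right_mono divide_right_mono)
  qed simp
  have "heat s (stein r f) x = (LINT u|gauss s. LINT w|gauss r. (f (x + u + w) / r) *\<^sub>R w)"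
    by (simp add: heat_def stein_def)
  also have "\<dots> = (LINT w|gauss r. LINT u|gauss s. (f (x + u + w) / r) *\<^sub>R w)"
    using p.Fubini_integral[OF int] by simp
  also have "\<dots> = stein r (heat s f) x"
    unfolding stein_def heat_def
  proof (intro Bochner_Integration.integral_cong refl)
    fix w :: 'a
    have "integrable (gauss s) (\<lambda>u. f (x + w + u) / r)"
      by (intro integrable_divide heat_integrable[of f C]) (auto simp: bd)
    then show "(LINT u|gauss s. (f (x + u + w) / r) *\<^sub>R w) = ((LINT u|gauss s. f (x + w + u)) / r) *\<^sub>R w"
      by (simp add: add_ac)
  qed
  finally show ?thesis .
qed

lemma gauss_density_line_deriv:
  fixes y v :: "'a::euclidean_space"
  assumes r: "0 < r"
  shows "((\<lambda>\<theta>. gauss_density r (y - \<theta> *\<^sub>R v)) has_real_derivative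
     gauss_density r (y - \<theta> *\<^sub>R v) * (((y - \<theta> *\<^sub>R v) \<bullet> v) / r)) (at \<theta>)"
  unfolding gauss_density_eq using r
  by (auto intro!: derivative_eq_intros simp: inner_diff_left inner_diff_right field_simps inner_commute power2_eq_square)

lemma integral_gauss:
  fixes F :: "'a::euclidean_space \<Rightarrow> 'b::{banach, second_countable_topology}"
  assumes "F \<in> borel_measurable borel" "0 < r"
  shows "(LINT w|gauss r. F w) = (LINT w|lborel. gauss_density r w *\<^sub>R F w)"
    and "integrable (gauss r) F \<longleftrightarrow> integrable lborel (\<lambda>w. gauss_density r w *\<^sub>R F w)"
  using assms by (simp_all add: gauss_def integral_density integrable_density)

lemma lborel_shift:
  fixes F :: "'a::euclidean_space \<Rightarrow> 'b::{banach, second_countable_topology}"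
  assumes "F \<in> borel_measurable borel"
  shows "(LINT w|lborel. F (w - c)) = (LINT w|lborel. F w)"
    and "integrable lborel (\<lambda>w. F (w - c)) \<longleftrightarrow> integrable lborel F"
proof -
  have *: "lborel = distr lborel borel ((+) (- c))" by (simp only: lborel_distr_plus)
  show "(LINT w|lborel. F (w - c)) = (LINT w|lborel. F w)"
    using assms by (subst (2) *, subst integral_distr) auto
  show "integrable lborel (\<lambda>w. F (w - c)) \<longleftrightarrow> integrable lborel F"
    using assms by (subst (2) *, subst integrable_distr_eq) auto
qed

text \<open>
  The fundamental theorem of calculus is applied to the Gaussian density along the segment from
  \<open>x\<close> to \<open>x + v\<close>, for each fixed space variable; Fubini then exchanges the two integrals. In this
  way no derivative is taken under an integral sign.
\<close>

lemma heat_increment: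
  fixes f :: "'a::euclidean_space \<Rightarrow> real"
  assumes [measurable]: "f \<in> borel_measurable borel" and bd: "\<And>x. \<bar>f x\<bar> \<le> C" and r: "0 < r"
  shows "heat r f (x + v) - heat r f x = (LINT \<theta>:{0..1}|lborel. stein r f (x + \<theta> *\<^sub>R v) \<bullet> v)"
proof -
  let ?g = "gauss_density r :: 'a \<Rightarrow> real"
  define H where "H y \<theta> = ?g (y - \<theta> *\<^sub>R v) * (((y - \<theta> *\<^sub>R v) \<bullet> v) / r)" for y \<theta>
  define G where "G \<theta> y = indicator {0..1} \<theta> * (f (x + y) * H y \<theta>)" for \<theta> :: real and y
  have [measurable]: "(\<lambda>z. H (snd z) (fst z)) \<in> borel_measurable (lborel \<Otimes>\<^sub>M lborel)"
    unfolding H_def by measurable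
  have [measurable]: "(\<lambda>(\<theta>, y). G \<theta> y) \<in> borel_measurable (lborel \<Otimes>\<^sub>M lborel)"
    unfolding G_def by (simp add: split_beta) 
  have slice: "integrable lborel (\<lambda>y. f (x + y) * H y \<theta>) \<and>
      (LINT y|lborel. f (x + y) * H y \<theta>) = stein r f (x + \<theta> *\<^sub>R v) \<bullet> v" for \<theta>
  proof -
    let ?F = "\<lambda>w. ?g w *\<^sub>R (((f (x + \<theta> *\<^sub>R v + w) / r) *\<^sub>R w) \<bullet> v)"
    have eq: "(\<lambda>y. f (x + y) * H y \<theta>) = (\<lambda>y. ?F (y - \<theta> *\<^sub>R v))"
      by (simp add: fun_eq_iff H_def mult_ac)
    have si: "integrable (gauss r) (\<lambda>w. (f (x + \<theta> *\<^sub>R v + w) / r) *\<^sub>R w)"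
      using r by (intro stein_integrable[of f C] bd) auto
    have "integrable (gauss r) (\<lambda>w. ((f (x + \<theta> *\<^sub>R v + w) / r) *\<^sub>R w) \<bullet> v)"
      by (rule integrable_inner_left) (rule si)
    then have "integrable lborel ?F"
      by (rule integral_gauss(2)[THEN iffD1, rotated 2]) (use r in measurable)
    moreover have "(LINT w|lborel. ?F w) = stein r f (x + \<theta> *\<^sub>R v) \<bullet> v"
    proof -
      have "(LINT w|lborel. ?F w) = (LINT w|gauss r. ((f (x + \<theta> *\<^sub>R v + w) / r) *\<^sub>R w) \<bullet> v)"
        by (rule integral_gauss(1)[symmetric]) (use r in measurable)
      also have "\<dots> = stein r f (x + \<theta> *\<^sub>R v) \<bullet> v"
        unfolding stein_def by (rule integral_inner_left) (rule si)
      finally show ?thesis .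
    qed
    ultimately show ?thesis unfolding eq
      by (subst lborel_shift(2)[of ?F] , simp, subst lborel_shift(1)[of ?F]) auto
  qed
  have Gint: "integrable (lborel \<Otimes>\<^sub>M lborel) (\<lambda>(\<theta>, y). G \<theta> y)"
  proof (rule lborel_pair.Fubini_integrable)
    let ?K = "LINT w|gauss r. C / r * (norm v * norm (w::'a))"
    show "integrable lborel (\<lambda>\<theta>. LINT y|lborel. norm (case (\<theta>, y) of (\<theta>, y) \<Rightarrow> G \<theta> y))"
    proof (rule Bochner_Integration.integrable_bound)
      show "integrable lborel (\<lambda>\<theta>::real. indicator {0..1} \<theta> * ?K)"
        by (intro integrable_mult_left) (auto intro: integrable_real_indicator)
      have le: "(LINT y|lborel. norm (G \<theta> y)) \<le> indicator {0..1} \<theta> * ?K" for \<theta>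
      proof -
        let ?F = "\<lambda>w. ?g w *\<^sub>R (C / r * (norm v * norm w))"
        have int: "integrable (gauss r) (\<lambda>w::'a. C / r * (norm v * norm w))"
          using r by (intro integrable_mult_right integrable_gauss_norm) auto
        then have int': "integrable lborel ?F" using r by (subst (asm) integral_gauss(2)) auto
        have "norm (G \<theta> y) \<le> indicator {0..1} \<theta> * ?F (y - \<theta> *\<^sub>R v)" for y
        proof -
          have "\<bar>f (x + y) * (((y - \<theta> *\<^sub>R v) \<bullet> v) / r)\<bar> \<le> C * (norm (y - \<theta> *\<^sub>R v) * norm v / r)"
            unfolding abs_mult using bd r Cauchy_Schwarz_ineq2[of "y - \<theta> *\<^sub>R v" v]
            by (intro mult_mono) (auto simp: divide_right_mono order_trans[OF abs_ge_zero bd])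
          then have "\<bar>f (x + y) * (((y - \<theta> *\<^sub>R v) \<bullet> v) / r)\<bar> * ?g (y - \<theta> *\<^sub>R v) 
              \<le> C * (norm (y - \<theta> *\<^sub>R v) * norm v / r) * ?g (y - \<theta> *\<^sub>R v)"
            by (intro mult_right_mono) auto
          then show ?thesis
            by (auto simp: G_def H_def abs_mult mult_ac split: split_indicator)
        qed
        moreover have "integrable lborel (\<lambda>y. ?F (y - \<theta> *\<^sub>R v))"
          by (rule lborel_shift(2)[of ?F, THEN iffD2]) (use int' in simp_all)
        then have "integrable lborel (\<lambda>y. indicator {0..1} \<theta> * ?F (y - \<theta> *\<^sub>R v))"
          by (rule integrable_mult_right)
        moreover have "integrable lborel (\<lambda>y. norm (G \<theta> y))"
          using slice[of \<theta>] unfolding G_def by (intro integrable_norm integrable_mult_right) auto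
        ultimately have "(LINT y|lborel. norm (G \<theta> y)) \<le> (LINT y|lborel. indicator {0..1} \<theta> * ?F (y - \<theta> *\<^sub>R v))"
          by (intro integral_mono)
        also have "\<dots> = indicator {0..1} \<theta> * ?K"
          using r by (subst integral_mult_right_zero, subst lborel_shift(1)[of ?F], simp, subst integral_gauss(1)) auto
        finally show ?thesis .
      qed
      show "AE \<theta> in lborel. norm (LINT y|lborel. norm (case (\<theta>, y) of (\<theta>, y) \<Rightarrow> G \<theta> y)) \<le> norm (indicator {0..1} \<theta> * ?K)"
      proof (rule AE_I2)
        fix \<theta> :: real
        have "\<bar>LINT y|lborel. norm (G \<theta> y)\<bar> = (LINT y|lborel. norm (G \<theta> y))"
          by (intro abs_of_nonneg Bochner_Integration.integral_nonneg) simp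
        also note le[of \<theta>]
        also have "indicator {0..1} \<theta> * ?K \<le> \<bar>indicator {0..1} \<theta> * ?K\<bar>" by (rule abs_ge_self)
        finally show "norm (LINT y|lborel. norm (case (\<theta>, y) of (\<theta>, y) \<Rightarrow> G \<theta> y)) \<le> norm (indicator {0..1} \<theta> * ?K)"
          by (simp only: case_prod_conv real_norm_def)
      qed
    qed measurable
    show "AE \<theta> in lborel. integrable lborel (\<lambda>y. case (\<theta>, y) of (\<theta>, y) \<Rightarrow> G \<theta> y)"
      using slice by (intro AE_I2) (auto simp: G_def)
  qed measurable
  have "(LINT \<theta>:{0..1}|lborel. stein r f (x + \<theta> *\<^sub>R v) \<bullet> v) = (LINT \<theta>|lborel. LINT y|lborel. G \<theta> y)"
    using slice by (simp add: set_lebesgue_integral_def G_def)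
  also have "\<dots> = (LINT y|lborel. LINT \<theta>|lborel. G \<theta> y)"
    using lborel_pair.Fubini_integral[OF Gint] by simp
  also have "\<dots> = (LINT y|lborel. f (x + y) * (?g (y - v) - ?g y))"
  proof (intro Bochner_Integration.integral_cong refl)
    fix y
    have "(LINT \<theta>|lborel. H y \<theta> * indicator {0..1} \<theta>) = ?g (y - 1 *\<^sub>R v) - ?g (y - 0 *\<^sub>R v)"
    proof (rule integral_FTC_Icc_real)
      show "DERIV (\<lambda>\<theta>. ?g (y - \<theta> *\<^sub>R v)) \<theta> :> H y \<theta>" for \<theta>
        unfolding H_def by (rule gauss_density_line_deriv[OF r])
      show "isCont (H y) \<theta>" for \<theta>
        unfolding H_def gauss_density_eq using r by (intro continuous_intros) auto
    qed simp
    then have "f (x + y) * (LINT \<theta>|lborel. H y \<theta> * indicator {0..1} \<theta>) = f (x + y) * (?g (y - v) - ?g y)"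
      by simp
    then show "(LINT \<theta>|lborel. G \<theta> y) = f (x + y) * (?g (y - v) - ?g y)"
      by (simp add: G_def mult_ac flip: integral_mult_right_zero)
  qed
  also have "\<dots> = heat r f (x + v) - heat r f x"
  proof -
    let ?F = "\<lambda>u w. ?g w *\<^sub>R f (x + u + w)"
    have i: "integrable lborel (?F u)" for u
      using r by (subst integral_gauss(2)[symmetric]) (auto intro!: heat_integrable[of f C] simp: bd)
    have h: "heat r f (x + u) = (LINT w|lborel. ?F u w)" for u
      using r unfolding heat_def by (subst integral_gauss(1)) auto
    have e: "?F v (y - v) = f (x + y) * ?g (y - v)" "?F 0 y = f (x + y) * ?g y" for y
      by (simp_all add: mult.commute)
    have "heat r f (x + v) = (LINT y|lborel. ?F v (y - v))"
      unfolding h by (rule lborel_shift(1)[symmetric]) simp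
    moreover have "integrable lborel (\<lambda>y. ?F v (y - v))" 
      using i[of v] by (subst lborel_shift(2)[of "?F v"]) auto
    moreover have "heat r f x = (LINT y|lborel. ?F 0 y)" using h[of 0] by simp
    ultimately show ?thesis using i[of 0] unfolding e by (simp add: right_diff_distrib)
  qed
  finally show ?thesis ..
qed

section \<open>The gradient of the heat semigroup\<close>

text \<open>
  The gradient of \<open>P\<^sub>t f\<close>. One half of the time regularizes \<open>f\<close>, the other half carries the
  derivative. The function under the derivative is then already Lipschitz, and so is the gradient;
  no second derivative of the Gaussian density is needed.
\<close>

definition heat_grad :: "real \<Rightarrow> ('a::euclidean_space \<Rightarrow> real) \<Rightarrow> 'a \<Rightarrow> 'a" where
  "heat_grad t f = stein (t / 2) (heat (t / 2) f)"

lemma heat_grad_measurable [measurable]: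
  assumes [measurable]: "f \<in> borel_measurable borel"
  shows "heat_grad t f \<in> borel_measurable borel"
  unfolding heat_grad_def by measurable

lemma set_integrable_bounded_Icc:
  fixes g :: "real \<Rightarrow> 'b::{banach, second_countable_topology}"
  assumes "g \<in> borel_measurable borel" "\<And>x. a \<le> x \<Longrightarrow> x \<le> b \<Longrightarrow> norm (g x) \<le> K"
  shows "set_integrable lborel {a..b} g"
  unfolding set_integrable_def
  by (rule integrableI_bounded_set_indicator[where B=K])
     (use assms in \<open>auto simp: emeasure_lborel_Icc_eq\<close>)

lemma abs_set_integral_unit_interval_le:
  fixes g :: "real \<Rightarrow> real"
  assumes "\<And>\<theta>. 0 \<le> \<theta> \<Longrightarrow> \<theta> \<le> 1 \<Longrightarrow> \<bar>g \<theta>\<bar> \<le> K"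
  shows "\<bar>LINT \<theta>:{0..1}|lborel. g \<theta>\<bar> \<le> K"
  using norm_set_integral_Icc_le[of 0 1 g K] assms by simp

lemma sqrt_half_bound: "0 < t \<Longrightarrow> a \<ge> 0 \<Longrightarrow> a / sqrt (t / 2) \<le> 2 * a / sqrt t"
proof -
  assume "0 < t" "0 \<le> a"
  have "sqrt t \<le> 2 * sqrt (t / 2)" using \<open>0 < t\<close> by (intro real_le_lsqrt) (auto simp: power_mult_distrib)
  then show ?thesis using \<open>0 < t\<close> \<open>0 \<le> a\<close> by (simp add: field_simps mult_left_mono)
qed

context
  fixes f :: "'a::euclidean_space \<Rightarrow> real" and C :: real
  assumes f[measurable]: "f \<in> borel_measurable borel" and bd: "\<And>x. \<bar>f x\<bar> \<le> C"
begin

lemma C_nonneg: "0 \<le> C" using bd[of 0] by linarith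

lemma abs_heat_le: "\<bar>heat t f x\<bar> \<le> C"
  using heat_bound[of f C t x] bd by simp

text \<open>
  The increment over a segment is the integral of the derivative, which is of order \<open>1 / sqrt r\<close>.
\<close>

lemma heat_lipschitz:
  assumes r: "0 < r"
  shows "\<bar>heat r f (x + v) - heat r f x\<bar> \<le> C * sqrt DIM('a) / sqrt r * norm v"
proof -
  have "\<bar>stein r f (x + \<theta> *\<^sub>R v) \<bullet> v\<bar> \<le> C * sqrt DIM('a) / sqrt r * norm v" for \<theta>
    by (rule order_trans[OF Cauchy_Schwarz_ineq2 mult_right_mono[OF stein_bound[OF bd r] norm_ge_zero]])
  then show ?thesis
    unfolding heat_increment[OF f bd r] by (intro abs_set_integral_unit_interval_le)
qed

lemma norm_heat_grad_le:
  assumes t: "0 < t"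
  shows "norm (heat_grad t f x) \<le> 2 * C * sqrt DIM('a) / sqrt t"
proof -
  have "norm (heat_grad t f x) \<le> C * sqrt DIM('a) / sqrt (t / 2)"
    unfolding heat_grad_def using t by (intro stein_bound abs_heat_le) auto
  also have "\<dots> \<le> 2 * (C * sqrt DIM('a)) / sqrt t" using t C_nonneg by (intro sqrt_half_bound) auto
  finally show ?thesis by simp
qed

text \<open>
  Each half of the time contributes one factor of order \<open>1 / sqrt t\<close>: the first one to the
  increment of the regularized function, the second one to the derivative.
\<close>

lemma heat_grad_lipschitz:
  assumes t: "0 < t"
  shows "norm (heat_grad t f (x + v) - heat_grad t f x) \<le> 2 * C * (sqrt DIM('a))\<^sup>2 / t * norm v"
proof -
  let ?F = "heat (t / 2) f"
  have "heat_grad t f (x + v) - heat_grad t f x = stein (t / 2) (\<lambda>x. ?F (x + v) - ?F x) x"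
    unfolding heat_grad_def using t
    by (subst stein_diff[where C=C and D=C]) (auto simp: abs_heat_le stein_shift)
  also have "norm \<dots> \<le> (C * sqrt DIM('a) / sqrt (t / 2) * norm v) * sqrt DIM('a) / sqrt (t / 2)"
    using t by (intro stein_bound heat_lipschitz) simp_all
  also have "\<dots> = 2 * C * (sqrt DIM('a))\<^sup>2 / t * norm v"
  proof -
    have q: "sqrt (t / 2) * sqrt (t / 2) = t / 2" using t by simp
    have "(C * sqrt DIM('a) / sqrt (t / 2) * norm v) * sqrt DIM('a) / sqrt (t / 2) =
        C * sqrt DIM('a) * norm v * sqrt DIM('a) / (sqrt (t / 2) * sqrt (t / 2))" by (simp only: times_divide_eq_left divide_divide_eq_left)
    also have "\<dots> = C * sqrt DIM('a) * norm v * sqrt DIM('a) / (t / 2)" by (simp only: q)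
    also have "\<dots> = 2 * C * (sqrt DIM('a) * sqrt DIM('a)) / t * norm v" by simp
    finally show ?thesis by (simp only: power2_eq_square)
  qed
  finally show ?thesis .
qed

text \<open>
  Taylor's formula: the Lipschitz gradient is integrated along the segment. This is also what
  identifies \<open>heat_grad t f\<close> as the gradient of \<open>heat t f\<close>.
\<close>

lemma heat_expansion:
  assumes t: "0 < t"
  shows "\<bar>heat t f (x + v) - heat t f x - heat_grad t f x \<bullet> v\<bar> \<le> 2 * C * (sqrt DIM('a))\<^sup>2 / t * (norm v)\<^sup>2"
proof -
  let ?F = "heat (t / 2) f"
  let ?S = "\<lambda>\<theta>. stein (t / 2) ?F (x + \<theta> *\<^sub>R v) \<bullet> v"
  have "heat t f (x + v) - heat t f x = heat (t / 2) ?F (x + v) - heat (t / 2) ?F x"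
    using t bd by (simp add: heat_semigroup[of f C])
  also have "\<dots> = (LINT \<theta>:{0..1}|lborel. ?S \<theta>)"
    using t by (subst heat_increment[where C=C]) (auto simp: abs_heat_le)
  finally have 1: "heat t f (x + v) - heat t f x = (LINT \<theta>:{0..1}|lborel. ?S \<theta>)" .
  have "\<bar>?S \<theta>\<bar> \<le> C * sqrt DIM('a) / sqrt (t / 2) * norm v" for \<theta>
    using t by (intro order_trans[OF Cauchy_Schwarz_ineq2 mult_right_mono[OF stein_bound norm_ge_zero]])
               (auto simp: abs_heat_le)
  then have "set_integrable lborel {0..1} ?S"
    by (intro set_integrable_bounded_Icc[where K="C * sqrt DIM('a) / sqrt (t / 2) * norm v"])
       (simp_all only: real_norm_def, measurable)
  moreover have "set_integrable lborel {0..1::real} (\<lambda>_. heat_grad t f x \<bullet> v)"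
    by (simp add: set_integrable_def)
  ultimately have "heat t f (x + v) - heat t f x - heat_grad t f x \<bullet> v =
      (LINT \<theta>:{0..1}|lborel. ?S \<theta> - heat_grad t f x \<bullet> v)"
    unfolding 1 by (subst set_integral_diff(2)) (auto simp: set_integral_const)
  also have "\<bar>\<dots>\<bar> \<le> 2 * C * (sqrt DIM('a))\<^sup>2 / t * (norm v)\<^sup>2"
  proof (rule abs_set_integral_unit_interval_le)
    fix \<theta> :: real assume \<theta>: "0 \<le> \<theta>" "\<theta> \<le> 1"
    have "\<bar>?S \<theta> - heat_grad t f x \<bullet> v\<bar> = \<bar>(heat_grad t f (x + \<theta> *\<^sub>R v) - heat_grad t f x) \<bullet> v\<bar>"
      by (simp add: heat_grad_def inner_diff_left)
    also have "\<dots> \<le> norm (heat_grad t f (x + \<theta> *\<^sub>R v) - heat_grad t f x) * norm v"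
      by (rule Cauchy_Schwarz_ineq2)
    also have "\<dots> \<le> (2 * C * (sqrt DIM('a))\<^sup>2 / t * norm (\<theta> *\<^sub>R v)) * norm v"
      by (intro mult_right_mono heat_grad_lipschitz t) auto
    also have "\<dots> = (2 * C * (sqrt DIM('a))\<^sup>2 / t * (norm v)\<^sup>2) * \<theta>" using \<theta> by (simp add: power2_eq_square)
    also have "\<dots> \<le> 2 * C * (sqrt DIM('a))\<^sup>2 / t * (norm v)\<^sup>2" using \<theta> t C_nonneg by (intro mult_left_le) auto
    finally show "\<bar>?S \<theta> - heat_grad t f x \<bullet> v\<bar> \<le> 2 * C * (sqrt DIM('a))\<^sup>2 / t * (norm v)\<^sup>2" .
  qed
  finally show ?thesis .
qed

text \<open>
  The linear terms at \<open>v\<close> and \<open>- v\<close> cancel. Second differences stand in for second and third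
  derivatives in what follows.
\<close>

lemma heat_second_difference:
  assumes t: "0 < t"
  shows "\<bar>heat t f (x + v) + heat t f (x - v) - 2 * heat t f x\<bar> \<le> 4 * C * (sqrt DIM('a))\<^sup>2 / t * (norm v)\<^sup>2"
  using heat_expansion[OF t, of x v] heat_expansion[OF t, of x "- v"] by (simp add: inner_minus_right)

lemma heat_grad_second_difference:
  assumes t: "0 < t"
  shows "norm (heat_grad t f (x + v) + heat_grad t f (x - v) - 2 *\<^sub>R heat_grad t f x)
    \<le> 16 * C * sqrt DIM('a) ^ 3 / (t * sqrt t) * (norm v)\<^sup>2"
proof -
  let ?F = "heat (t / 2) f"
  have [simp]: "?F \<in> borel_measurable borel" by measurable
  have "heat_grad t f (x + v) + heat_grad t f (x - v) - 2 *\<^sub>R heat_grad t f x =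
     stein (t / 2) (\<lambda>x. (?F (x + v) - ?F x) - (?F x - ?F (x + (- v)))) x"
  proof -
    have 1: "stein (t / 2) (\<lambda>x. ?F (x + u) - ?F x) x = stein (t / 2) ?F (x + u) - stein (t / 2) ?F x" for u
      using t by (subst stein_diff[where C=C and D=C]) (auto simp: abs_heat_le stein_shift)
    have 2: "stein (t / 2) (\<lambda>x. ?F x - ?F (x + u)) x = stein (t / 2) ?F x - stein (t / 2) ?F (x + u)" for u
      using t by (subst stein_diff[where C=C and D=C]) (auto simp: abs_heat_le stein_shift)
    have 3: "\<bar>?F y - ?F z\<bar> \<le> C + C" for y z
      using abs_heat_le[of "t / 2" y] abs_heat_le[of "t / 2" z] by linarith
    have "stein (t / 2) (\<lambda>x. (?F (x + v) - ?F x) - (?F x - ?F (x + (- v)))) x =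
       stein (t / 2) (\<lambda>x. ?F (x + v) - ?F x) x - stein (t / 2) (\<lambda>x. ?F x - ?F (x + (- v))) x"
      using t by (intro stein_diff[where C="C + C" and D="C + C"] 3) auto
    then show ?thesis unfolding 1 2 heat_grad_def by (simp add: scaleR_2)
  qed
  also have "norm \<dots> \<le> (4 * C * (sqrt DIM('a))\<^sup>2 / (t / 2) * (norm v)\<^sup>2) * sqrt DIM('a) / sqrt (t / 2)"
  proof (rule stein_bound)
    show "\<bar>(?F (x + v) - ?F x) - (?F x - ?F (x + (- v)))\<bar> \<le> 4 * C * (sqrt DIM('a))\<^sup>2 / (t / 2) * (norm v)\<^sup>2" for x
      using heat_second_difference[of "t / 2" x v] t by (simp add: algebra_simps)
  qed (use t in auto)
  also have "\<dots> \<le> 2 * ((4 * C * (sqrt DIM('a))\<^sup>2 / (t / 2) * (norm v)\<^sup>2) * sqrt DIM('a)) / sqrt t"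
    using t C_nonneg by (intro sqrt_half_bound) auto
  also have "\<dots> = 16 * C * sqrt DIM('a) ^ 3 / (t * sqrt t) * (norm v)\<^sup>2"
    by (simp add: power3_eq_cube power2_eq_square)
  finally show ?thesis .
qed

end

text \<open>
  The Gaussian law is symmetric, so the increment in time is the mean of half a second difference.
  This trades two derivatives in space for one in time.
\<close>

lemma heat_minus_id_le:
  fixes g :: "'a::euclidean_space \<Rightarrow> 'b::{banach, second_countable_topology}"
  assumes [measurable]: "g \<in> borel_measurable borel" and bd: "\<And>x. norm (g x) \<le> C" and s: "0 \<le> s"
    and L: "\<And>v. norm (g (x + v) + g (x - v) - 2 *\<^sub>R g x) \<le> L * (norm v)\<^sup>2"
  shows "norm (heat s g x - g x) \<le> L * DIM('a) * s / 2"
proof -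
  have "heat s g x = (LINT w|distr (gauss s) borel uminus. g (x + w))"
    unfolding distr_uminus_gauss heat_def ..
  also have "\<dots> = (LINT w|gauss s. g (x - w))" by (subst integral_distr) auto
  finally have sym: "heat s g x = (LINT w|gauss s. g (x - w))" .
  have i: "integrable (gauss s) (\<lambda>w. g (x + w))" "integrable (gauss s) (\<lambda>w. g (x - w))"
    by (auto intro!: gauss.integrable_of_bound[where C=C] bd)
  have "2 *\<^sub>R (heat s g x - g x) = heat s g x + heat s g x - 2 *\<^sub>R g x"
    by (simp add: scaleR_2 algebra_simps)
  also have "\<dots> = (LINT w|gauss s. g (x + w) + g (x - w) - 2 *\<^sub>R g x)"
    apply (subst (2) sym)
    apply (simp add: i heat_def gauss.prob_space[of s, simplified])
    done
  finally have "norm (2 *\<^sub>R (heat s g x - g x)) = norm (LINT w|gauss s. g (x + w) + g (x - w) - 2 *\<^sub>R g x)"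
    by simp
  also have "\<dots> \<le> (LINT w|gauss s. L * (norm (w::'a))\<^sup>2)"
    by (rule norm_integral_le_of_bound) (use L s in \<open>auto intro!: integrable_mult_right integrable_gauss_norm_square\<close>)
  also have "\<dots> = L * (DIM('a) * s)" using s by (simp add: integral_gauss_norm_square)
  finally show ?thesis by simp
qed

text \<open>
  Uniqueness of the gradient, for functions with a first-order expansion as in \<open>heat_expansion\<close>.
\<close>

lemma linear_part_unique:
  fixes a b :: "'a::euclidean_space"
  assumes "\<And>v. \<bar>g v - a \<bullet> v\<bar> \<le> K * (norm v)\<^sup>2" "\<And>v. \<bar>g v - b \<bullet> v\<bar> \<le> L * (norm v)\<^sup>2"
  shows "a = b"
proof (rule ccontr)
  assume "a \<noteq> b"
  define n where "n = (norm (a - b))\<^sup>2"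
  have n: "n > 0" using \<open>a \<noteq> b\<close> by (simp add: n_def)
  have *: "e * n \<le> (K + L) * e\<^sup>2 * n" for e
  proof -
    have "\<bar>(a - b) \<bullet> (e *\<^sub>R (a - b))\<bar> \<le> (K + L) * (norm (e *\<^sub>R (a - b)))\<^sup>2"
      using assms(1)[of "e *\<^sub>R (a - b)"] assms(2)[of "e *\<^sub>R (a - b)"]
      by (simp only: inner_diff_left distrib_right)
    also have "(a - b) \<bullet> (e *\<^sub>R (a - b)) = e * n" by (simp add: n_def power2_norm_eq_inner)
    also have "(norm (e *\<^sub>R (a - b)))\<^sup>2 = e\<^sup>2 * n" by (simp add: n_def power_mult_distrib)
    finally show ?thesis by (simp add: mult.assoc)
  qed
  \<comment> \<open>for the vector \<open>e *\<^sub>R (a - b)\<close> with this small \<open>e\<close> the linear part exceeds the quadratic error\<close>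
  define e where "e = 1 / (\<bar>K + L\<bar> + 1)"
  have e: "e > 0" by (simp add: e_def add_nonneg_pos)
  have "1 \<le> (K + L) * e" using *[of e] e n by (simp add: power2_eq_square)
  also have "\<dots> < 1" unfolding e_def using abs_ge_self[of "K + L"] by (simp add: field_simps)
  finally show False by simp
qed

text \<open>
  Both sides are the gradient of \<open>P\<^bsub>s + t\<^esub> f\<close> at \<open>x\<close>.
\<close>

lemma heat_grad_semigroup:
  fixes f :: "'a::euclidean_space \<Rightarrow> real"
  assumes f[measurable]: "f \<in> borel_measurable borel" and bd: "\<And>x. \<bar>f x\<bar> \<le> C"
    and s: "0 \<le> s" and t: "0 < t"
  shows "heat s (heat_grad t f) x = heat_grad (s + t) f x"
proof -
  have bd': "norm (f x) \<le> C" for x using bd by simp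
  note ab = abs_heat_le[of f C, OF f bd]
  have "heat s (heat_grad t f) x = stein (t / 2) (heat s (heat (t / 2) f)) x"
    unfolding heat_grad_def using t by (intro stein_heat_commute[where C=C]) (auto simp: ab)
  also have "heat s (heat (t / 2) f) = heat (t / 2) (heat s f)"
    using s t bd' by (auto simp: fun_eq_iff heat_semigroup[of f C] add.commute)
  also have "stein (t / 2) (heat (t / 2) (heat s f)) x = heat_grad t (heat s f) x"
    by (simp add: heat_grad_def)
  also have "\<dots> = heat_grad (s + t) f x"
  proof (rule linear_part_unique)
    show "\<bar>(heat (s + t) f (x + v) - heat (s + t) f x) - heat_grad t (heat s f) x \<bullet> v\<bar> \<le> 2 * C * (sqrt DIM('a))\<^sup>2 / t * (norm v)\<^sup>2" for v
      using heat_expansion[of "heat s f" C t x v] ab s t bd' by (simp add: heat_semigroup[of f C] add.commute)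
    show "\<bar>(heat (s + t) f (x + v) - heat (s + t) f x) - heat_grad (s + t) f x \<bullet> v\<bar> \<le> 2 * C * (sqrt DIM('a))\<^sup>2 / (s + t) * (norm v)\<^sup>2" for v
      using s t by (intro heat_expansion bd) auto
  qed
  finally show ?thesis .
qed

lemma heat_time_increment:
  fixes f :: "'a::euclidean_space \<Rightarrow> real"
  assumes f[measurable]: "f \<in> borel_measurable borel" and bd: "\<And>x. \<bar>f x\<bar> \<le> C"
    and s: "0 \<le> s" and t: "0 < t"
  shows "\<bar>heat (s + t) f x - heat t f x\<bar> \<le> 2 * C * (real DIM('a))\<^sup>2 * s / t"
proof -
  have "heat (s + t) f x = heat s (heat t f) x"
    using s t bd by (simp add: heat_semigroup[of f C])
  then have "\<bar>heat (s + t) f x - heat t f x\<bar> \<le> (4 * C * (sqrt DIM('a))\<^sup>2 / t) * DIM('a) * s / 2"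
    using heat_minus_id_le[of "heat t f" C s x "4 * C * (sqrt DIM('a))\<^sup>2 / t"] s
       heat_second_difference[OF f bd t, of x] abs_heat_le[OF f bd]
    by simp
  then show ?thesis by (simp add: power2_eq_square mult_ac)
qed

lemma heat_grad_time_increment:
  fixes f :: "'a::euclidean_space \<Rightarrow> real"
  assumes f[measurable]: "f \<in> borel_measurable borel" and bd: "\<And>x. \<bar>f x\<bar> \<le> C"
    and s: "0 \<le> s" and t: "0 < t"
  shows "norm (heat_grad (s + t) f x - heat_grad t f x) \<le> 8 * C * sqrt DIM('a) ^ 5 * s / (t * sqrt t)"
proof -
  have "norm (heat_grad (s + t) f x - heat_grad t f x) \<le> (16 * C * sqrt DIM('a) ^ 3 / (t * sqrt t)) * DIM('a) * s / 2"
    unfolding heat_grad_semigroup[OF f bd s t, symmetric]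
    by (rule heat_minus_id_le[OF _ norm_heat_grad_le[OF f bd t] s heat_grad_second_difference[OF f bd t]]) auto
  also have "\<dots> = 8 * C * (sqrt DIM('a) ^ 3 * (sqrt DIM('a))\<^sup>2) * s / (t * sqrt t)"
    by (simp add: mult_ac)
  also have "sqrt DIM('a) ^ 3 * (sqrt DIM('a))\<^sup>2 = sqrt DIM('a) ^ 5" by (simp only: power_add[symmetric]) simp
  finally show ?thesis .
qed

text \<open>
  Joins a bound of order \<open>1 / sqrt t\<close>, which is the better one for \<open>s > t\<close>, and a bound of
  order \<open>s / (t sqrt t)\<close>, which is the better one for \<open>s \<le> t\<close>, into a single one that is
  a difference of values of one function.
\<close>

lemma inverse_sqrt_increment_interpolation:
  assumes X1: "X \<le> a / sqrt t" and X2: "X \<le> a * s / (t * sqrt t)" and s: "0 \<le> s" and t: "0 < t" and a: "0 \<le> (a::real)"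
  shows "X \<le> 4 * a * (1 / sqrt t - 1 / sqrt (s + t))"
proof -
  define p q where "p = sqrt t" and "q = sqrt (s + t)"
  have p: "p > 0" "p\<^sup>2 = t" and q: "q > 0" "q\<^sup>2 = s + t" and pq: "p \<le> q"
    using s t by (auto simp: p_def q_def)
  show ?thesis
  proof (cases "s \<le> t")
    case True
    have "q\<^sup>2 \<le> (3 / 2 * p)\<^sup>2"
      using True s p q by (simp add: power_mult_distrib power_divide)
    then have "q \<le> 3 / 2 * p" by (rule power2_le_imp_le) (use p in simp)
    then have "(q + p) * q \<le> (3 / 2 * p + p) * (3 / 2 * p)"
      using p(1) q(1) by (intro mult_mono) auto
    also have "\<dots> = 15 / 4 * p\<^sup>2" by (simp add: power2_eq_square)
    also have "\<dots> \<le> 4 * p\<^sup>2" using p(1) by simp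
    finally have "q + p \<le> 4 * p\<^sup>2 / q" using q(1) by (simp only: pos_le_divide_eq)
    then have "(q + p) / p\<^sup>2 \<le> 4 * p\<^sup>2 / q / p\<^sup>2" by (rule divide_right_mono) simp
    also have "\<dots> = 4 / q" using p(1) by simp
    finally have "(q + p) / p\<^sup>2 \<le> 4 / q" .
    then have "(q - p) * ((q + p) / p\<^sup>2) / p \<le> (q - p) * (4 / q) / p"
      using pq p(1) by (intro divide_right_mono mult_left_mono) auto
    also have "\<dots> = 4 * (1 / p - 1 / q)" using p(1) q(1) by (simp add: field_simps)
    also have "(q - p) * ((q + p) / p\<^sup>2) / p = ((q - p) * (q + p)) / (p\<^sup>2 * p)" by simp
    also have "(q - p) * (q + p) = s" using p(2) q(2) by (simp add: algebra_simps power2_eq_square)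
    also have "p\<^sup>2 * p = t * sqrt t" by (simp only: p(2)) (simp only: p_def)
    finally have "s / (t * sqrt t) \<le> 4 * (1 / p - 1 / q)" .
    from mult_left_mono[OF this a] X2 show ?thesis by (simp add: p_def q_def mult_ac)
  next
    case False
    have "(4 * p)\<^sup>2 \<le> (3 * q)\<^sup>2" using False p q s t by (simp add: power_mult_distrib)
    then have "4 * p \<le> 3 * q" by (rule power2_le_imp_le) (use q in simp)
    then have "1 / p \<le> 4 * (1 / p - 1 / q)" using p(1) q(1) by (simp add: field_simps)
    from mult_left_mono[OF this a] X1 show ?thesis by (simp add: p_def q_def mult_ac)
  qed
qed

text \<open>
  The form of the bound is what avoids logarithms later on. Along \<open>t = s + h\<close> it is
  integrable at \<open>s = 0\<close>, and its integral over any interval is of order \<open>sqrt h\<close>, because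
  the primitive \<open>2 sqrt s - 2 sqrt (s + h)\<close> has increments of that size.
\<close>

lemma heat_grad_time_regularity:
  fixes f :: "'a::euclidean_space \<Rightarrow> real"
  assumes f[measurable]: "f \<in> borel_measurable borel" and bd: "\<And>x. \<bar>f x\<bar> \<le> C"
    and s: "0 < s" "s \<le> t"
  shows "norm (heat_grad t f x - heat_grad s f x) \<le> 32 * C * sqrt DIM('a) ^ 5 * (1 / sqrt s - 1 / sqrt t)"
proof -
  let ?c = "sqrt (real DIM('a))"
  have C: "0 \<le> C" using bd[of 0] by linarith
  have c: "1 \<le> ?c" by simp
  have "norm (heat_grad t f x - heat_grad s f x) \<le> norm (heat_grad t f x) + norm (heat_grad s f x)"
    by (rule norm_triangle_ineq4)
  also have "\<dots> \<le> 2 * C * ?c / sqrt t + 2 * C * ?c / sqrt s"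
    using s by (intro add_mono norm_heat_grad_le[OF f bd]) auto
  also have "\<dots> \<le> 2 * C * ?c / sqrt s + 2 * C * ?c / sqrt s"
    using s C by (intro add_mono divide_left_mono) auto
  also have "\<dots> = 4 * C * ?c ^ 1 / sqrt s" by simp
  also have "\<dots> \<le> 8 * C * ?c ^ 5 / sqrt s"
    using s C c by (intro divide_right_mono mult_mono power_increasing) auto
  finally have 1: "norm (heat_grad t f x - heat_grad s f x) \<le> (8 * C * ?c ^ 5) / sqrt s" .
  have 2: "norm (heat_grad t f x - heat_grad s f x) \<le> (8 * C * ?c ^ 5) * (t - s) / (s * sqrt s)"
    using heat_grad_time_increment[OF f bd, of "t - s" s x] s by simp
  show ?thesis
    using inverse_sqrt_increment_interpolation[OF 1 2] s C by simp
qed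

lemma heat_jointly_measurable [measurable]:
  fixes f :: "'a::euclidean_space \<Rightarrow> real"
  assumes [measurable]: "f \<in> borel_measurable borel"
  shows "(\<lambda>z. heat (fst z) f (snd z)) \<in> borel_measurable (borel \<Otimes>\<^sub>M borel)"
proof -
  have eq: "heat (fst z) f (snd z) = (if fst z \<le> 0 then f (snd z) else
      (LINT w|lborel. gauss_density (fst z) w *\<^sub>R f (snd z + w)))" for z
  proof (cases "fst z \<le> 0")
    case False
    then show ?thesis by (simp add: heat_def integral_gauss)
  qed (simp add: heat_nonpos)
  show ?thesis unfolding eq gauss_density_eq by measurable
qed

lemma heat_grad_jointly_measurable [measurable]:
  fixes f :: "'a::euclidean_space \<Rightarrow> real"
  assumes [measurable]: "f \<in> borel_measurable borel"
  shows "(\<lambda>z. heat_grad (fst z) f (snd z)) \<in> borel_measurable (borel \<Otimes>\<^sub>M borel)"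
proof -
  have eq: "heat_grad (fst z) f (snd z) = (if fst z \<le> 0 then 0 else
      (LINT w|lborel. gauss_density (fst z / 2) w *\<^sub>R (heat (fst z / 2) f (snd z + w) / (fst z / 2)) *\<^sub>R w))" for z
  proof (cases "fst z \<le> 0")
    case True
    then show ?thesis by (simp add: heat_grad_def stein_def gauss_def integral_return)
  next
    case False
    then show ?thesis by (simp add: heat_grad_def stein_def integral_gauss)
  qed
  have [measurable]: "(\<lambda>z. heat (fst (fst z) / 2) f (snd (fst z) + snd z)) \<in> borel_measurable ((borel \<Otimes>\<^sub>M borel) \<Otimes>\<^sub>M lborel)"
    using measurable_compose[OF _ heat_jointly_measurable[of f], of "\<lambda>z. (fst (fst z) / 2, snd (fst z) + snd z)"] by simp
  show ?thesis unfolding eq gauss_density_eq by measurable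
qed

section \<open>From Lipschitz test functions to total variation\<close>

lemma lipschitz_on_borel_measurable:
  fixes g :: "'a::euclidean_space \<Rightarrow> real"
  shows "L-lipschitz_on UNIV g \<Longrightarrow> g \<in> borel_measurable borel"
  using lipschitz_on_continuous_on borel_measurable_continuous_onI by blast

lemma indicator_lipschitz_approximation:
  fixes K :: "'a::euclidean_space set"
  assumes K: "closed K" "K \<noteq> {}"
  obtains g where "\<And>n. (real n)-lipschitz_on UNIV (g n)" "\<And>n x. 0 \<le> g n x \<and> g n x \<le> 1"
    "\<And>x. (\<lambda>n. g n x) \<longlonglongrightarrow> indicat_real K x"
proof
  define g where "g n x = max 0 (1 - real n * infdist x K)" for n x
  show "(real n)-lipschitz_on UNIV (g n)" for n
  proof (rule lipschitz_onI)
    fix x y :: 'a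
    have contraction: "\<bar>max 0 p - max 0 q\<bar> \<le> \<bar>p - q\<bar>" for p q :: real by (simp add: max_def)
    have "\<bar>g n x - g n y\<bar> \<le> \<bar>(1 - real n * infdist x K) - (1 - real n * infdist y K)\<bar>"
      unfolding g_def by (rule contraction)
    also have "(1 - real n * infdist x K) - (1 - real n * infdist y K) = real n * (infdist y K - infdist x K)"
      by (simp add: algebra_simps)
    also have "\<bar>\<dots>\<bar> = real n * \<bar>infdist y K - infdist x K\<bar>" by (simp add: abs_mult)
    also have "\<dots> \<le> real n * dist y x" by (intro mult_left_mono infdist_triangle_abs) auto
    finally show "dist (g n x) (g n y) \<le> real n * dist x y" by (simp add: dist_real_def dist_commute)
  qed simp
  show "0 \<le> g n x \<and> g n x \<le> 1" for n x by (auto simp: g_def infdist_nonneg)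
  show "(\<lambda>n. g n x) \<longlonglongrightarrow> indicat_real K x" for x
  proof (cases "x \<in> K")
    case True
    then show ?thesis by (simp add: g_def)
  next
    case False
    have d: "infdist x K > 0" using infdist_pos_not_in_closed[OF K False] .
    obtain N :: nat where N: "1 / infdist x K < N" using reals_Archimedean2 by blast
    have "g m x = 0" if "m \<ge> N" for m
    proof -
      have "1 \<le> N * infdist x K" using N d by (simp add: field_simps)
      also have "\<dots> \<le> m * infdist x K" using that d by (intro mult_right_mono) auto
      finally show ?thesis by (simp add: g_def)
    qed
    then show ?thesis using False by (intro tendsto_eventually eventually_sequentiallyI[of N]) simp
  qed
qed

text \<open>
  Writes a test function as an average of indicators of its superlevel sets; the shift by \<open>1\<close>
  makes it nonnegative.
\<close>

lemma (in prob_space) layer_cake: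
  fixes f :: "'a \<Rightarrow> real"
  assumes [measurable]: "f \<in> borel_measurable M" and bd: "\<And>x. \<bar>f x\<bar> \<le> 1"
  shows "(LINT x|M. f x) = (LINT s:{0..2}|lborel. prob {x \<in> space M. s < f x + 1}) - 1"
proof -
  interpret p: pair_sigma_finite lborel M ..
  let ?F = "\<lambda>s x. indicator {0..2::real} s * (if s < f x + 1 then 1 else 0 :: real)"
  have "integrable (lborel \<Otimes>\<^sub>M M) (\<lambda>(s, x). ?F s x)"
  proof (rule integrableI_bounded_set[where A="{0..2::real} \<times> space M" and B=1])
    show "emeasure (lborel \<Otimes>\<^sub>M M) ({0..2::real} \<times> space M) < \<infinity>"
      by (subst emeasure_pair_measure_Times) (auto simp: emeasure_space_1)
    show "AE z in lborel \<Otimes>\<^sub>M M. z \<in> {0..2} \<times> space M \<longrightarrow> norm (case z of (s, x) \<Rightarrow> ?F s x) \<le> 1"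
      by (intro AE_I2) auto
    show "AE z in lborel \<Otimes>\<^sub>M M. z \<notin> {0..2} \<times> space M \<longrightarrow> (case z of (s, x) \<Rightarrow> ?F s x) = 0"
      by (intro AE_I2) (auto simp: space_pair_measure indicator_eq_0_iff)
  qed measurable
  from p.Fubini_integral[OF this]
  have swap: "(LINT x|M. LINT s|lborel. ?F s x) = (LINT s|lborel. LINT x|M. ?F s x)" .
  have section_s: "(LINT s|lborel. ?F s x) = f x + 1" for x
  proof -
    have "?F s x = indicator {0..<f x + 1} s" for s
      using bd[of x] by (auto simp: abs_le_iff split: split_indicator)
    then show ?thesis using bd[of x] by (simp add: abs_le_iff)
  qed
  have section_x: "(LINT x|M. ?F s x) = indicator {0..2} s * prob {x \<in> space M. s < f x + 1}" for s
  proof -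
    have "(LINT x|M. (if s < f x + 1 then 1 else 0 :: real)) = (LINT x|M. indicat_real {x \<in> space M. s < f x + 1} x)"
      by (intro Bochner_Integration.integral_cong) auto
    also have "\<dots> = prob {x \<in> space M. s < f x + 1}" by simp
    finally show ?thesis by simp
  qed
  have "integrable M f" by (rule integrable_of_bound[where C=1]) (auto simp: bd)
  then have "(LINT x|M. f x + 1) = (LINT x|M. f x) + 1" by (simp add: prob_space)
  then show ?thesis using swap unfolding section_s section_x by (simp add: set_lebesgue_integral_def)
qed

context
  fixes \<mu> \<nu> :: "'a::euclidean_space measure" and c :: real
  assumes prob: "prob_space \<mu>" "prob_space \<nu>" and sets: "sets \<mu> = sets borel" "sets \<nu> = sets borel"
    and lip: "\<And>(g :: 'a \<Rightarrow> real) L. L-lipschitz_on UNIV g \<Longrightarrow> (\<And>x. \<bar>g x\<bar> \<le> 1) \<Longrightarrow> (LINT x|\<mu>. g x) - (LINT x|\<nu>. g x) \<le> c"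
begin

interpretation \<mu>: prob_space \<mu> by (rule prob)
interpretation \<nu>: prob_space \<nu> by (rule prob)

text \<open>
  If Lipschitz functions \<open>g\<^sub>n\<close> with values in \<open>[0, 1]\<close> converge to the indicator of \<open>K\<close>,
  then \<open>2 g\<^sub>n - 1\<close> are admissible test functions; the constant cancels since both measures
  have mass one.
\<close>

lemma measure_diff_le_of_lipschitz_closed:
  assumes K: "closed K"
  shows "2 * (measure \<mu> K - measure \<nu> K) \<le> c"
proof (cases "K = {}")
  case True
  then show ?thesis using lip[of 0 "\<lambda>_. 0"] by (simp add: lipschitz_on_constant)
next
  case False
  obtain g where g: "\<And>n. (real n)-lipschitz_on UNIV (g n)" "\<And>n x. 0 \<le> g n x \<and> g n x \<le> 1"
    "\<And>x. (\<lambda>n. g n x) \<longlonglongrightarrow> indicat_real K x"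
    using indicator_lipschitz_approximation[OF K False] by blast
  have [measurable]: "K \<in> sets borel" "\<And>n. g n \<in> borel_measurable borel"
    using K lipschitz_on_borel_measurable[OF g(1)] by auto
  have lim: "(\<lambda>n. LINT x|N. g n x) \<longlonglongrightarrow> measure N K" if N: "prob_space N" "sets N = sets borel" for N
  proof -
    interpret N: prob_space N by fact
    note [measurable_cong] = N(2)
    have "(\<lambda>n. LINT x|N. g n x) \<longlonglongrightarrow> (LINT x|N. indicat_real K x)"
      by (rule integral_dominated_convergence[where w="\<lambda>_. 1"]) (use g in auto)
    then show ?thesis by (simp add: sets_eq_imp_space_eq[OF N(2)])
  qed
  have "2 * ((LINT x|\<mu>. g n x) - (LINT x|\<nu>. g n x)) \<le> c" for n
  proof -
    have e: "(LINT x|N. 2 * g n x - 1) = 2 * (LINT x|N. g n x) - 1" if N: "prob_space N" "sets N = sets borel" for N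
    proof -
      interpret N: prob_space N by fact
      note [measurable_cong] = N(2)
      have "integrable N (g n)" by (rule N.integrable_of_bound[where C=1]) (use g(2) in auto)
      then show ?thesis by (simp add: N.prob_space)
    qed
    have "(2 * real n)-lipschitz_on UNIV (\<lambda>x. 2 * g n x - 1)"
    proof (rule lipschitz_onI)
      show "dist (2 * g n x - 1) (2 * g n y - 1) \<le> 2 * real n * dist x y" for x y
        using lipschitz_onD[OF g(1) UNIV_I UNIV_I, of n x y] by (simp add: dist_real_def)
    qed simp
    moreover have "\<bar>2 * g n x - 1\<bar> \<le> 1" for x using g(2)[of n x] by (simp add: abs_le_iff)
    ultimately have "(LINT x|\<mu>. 2 * g n x - 1) - (LINT x|\<nu>. 2 * g n x - 1) \<le> c" by (rule lip)
    then show ?thesis unfolding e[OF prob(1) sets(1)] e[OF prob(2) sets(2)] by simp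
  qed
  then show ?thesis
    by (intro LIMSEQ_le_const2[OF tendsto_mult[OF tendsto_const tendsto_diff[OF lim[OF prob(1) sets(1)] lim[OF prob(2) sets(2)]]]]) blast
qed

text \<open>
  Inner regularity of \<open>\<mu>\<close> alone is enough, since passing to a compact subset of \<open>A\<close> can only
  decrease the measure under \<open>\<nu>\<close>.
\<close>

lemma measure_diff_le_of_lipschitz:
  assumes A: "A \<in> sets borel"
  shows "2 * (measure \<mu> A - measure \<nu> A) \<le> c"
proof (rule field_le_epsilon)
  fix \<epsilon> :: real assume \<epsilon>: "\<epsilon> > 0"
  have "\<exists>K. K \<subseteq> A \<and> compact K \<and> measure \<mu> A - \<epsilon> / 2 < measure \<mu> K"
  proof (cases "measure \<mu> A - \<epsilon> / 2 < 0")
    case True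
    then show ?thesis by (intro exI[of _ "{}"]) auto
  next
    case False
    have "ennreal (measure \<mu> A - \<epsilon> / 2) < emeasure \<mu> A"
      unfolding \<mu>.emeasure_eq_measure using False \<epsilon> by (intro ennreal_lessI) (auto intro: zero_less_measure_iff[THEN iffD1])
    also have "emeasure \<mu> A = (SUP K \<in> {K. K \<subseteq> A \<and> compact K}. emeasure \<mu> K)"
      using sets A by (intro inner_regular) auto
    finally obtain K where "K \<subseteq> A" "compact K" "ennreal (measure \<mu> A - \<epsilon> / 2) < emeasure \<mu> K"
      by (auto simp: less_SUP_iff)
    then show ?thesis using False by (auto simp: \<mu>.emeasure_eq_measure ennreal_less_iff intro!: exI[of _ K])
  qed
  then obtain K where K: "K \<subseteq> A" "compact K" "measure \<mu> A - \<epsilon> / 2 < measure \<mu> K" by blast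
  have "measure \<nu> K \<le> measure \<nu> A" using K A sets by (intro \<nu>.finite_measure_mono) auto
  then show "2 * (measure \<mu> A - measure \<nu> A) \<le> c + \<epsilon>"
    using measure_diff_le_of_lipschitz_closed[OF compact_imp_closed[OF K(2)]] K(3) by argo
qed

text \<open>
  Averages the bound for events over the superlevel sets of \<open>\<phi>\<close>. This is what allows the Duhamel
  formula to be stated for Lipschitz test functions only.
\<close>

lemma integral_diff_le_of_lipschitz:
  fixes \<phi> :: "'a \<Rightarrow> real"
  assumes \<phi>[measurable]: "\<phi> \<in> borel_measurable borel" and bd: "\<And>x. \<bar>\<phi> x\<bar> \<le> 1"
  shows "(LINT x|\<mu>. \<phi> x) - (LINT x|\<nu>. \<phi> x) \<le> c"
proof -
  note [measurable_cong] = sets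
  let ?A = "\<lambda>s. {x. s < \<phi> x + 1}"
  have cake: "(LINT x|N. \<phi> x) = (LINT s:{0..2}|lborel. measure N (?A s)) - 1 \<and> set_integrable lborel {0..2} (\<lambda>s. measure N (?A s))"
    if N: "prob_space N" "sets N = sets borel" for N
  proof -
    interpret N: prob_space N by fact
    note [measurable_cong] = N(2)
    have sp: "space N = UNIV" using sets_eq_imp_space_eq[OF N(2)] by simp
    have "(\<lambda>s. LINT x|N. indicat_real (?A s) x) \<in> borel_measurable borel" by measurable
    then have "(\<lambda>s. measure N (?A s)) \<in> borel_measurable borel" by (simp add: sp)
    then show ?thesis using N.layer_cake[OF _ bd] sp
      by (auto intro!: set_integrable_bounded_Icc[where K=1])
  qed
  note \<mu> = cake[OF prob(1) sets(1)] and \<nu> = cake[OF prob(2) sets(2)]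
  have "(LINT s:{0..2}|lborel. measure \<mu> (?A s)) - (LINT s:{0..2}|lborel. measure \<nu> (?A s)) =
      (LINT s:{0..2}|lborel. measure \<mu> (?A s) - measure \<nu> (?A s))"
    using \<mu> \<nu> by (intro set_integral_diff(2)[symmetric]) auto
  moreover have "\<dots> \<le> (LINT s:{0..2::real}|lborel. c / 2)"
  proof (rule set_integral_mono)
    show "set_integrable lborel {0..2} (\<lambda>s. measure \<mu> (?A s) - measure \<nu> (?A s))"
      using \<mu> \<nu> by (intro set_integral_diff(1)) auto
    show "set_integrable lborel {0..2::real} (\<lambda>_. c / 2)" by (simp add: set_integrable_def)
    show "measure \<mu> (?A s) - measure \<nu> (?A s) \<le> c / 2" for s
      using measure_diff_le_of_lipschitz[of "?A s"] by simp
  qed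
  moreover have "(LINT s:{0..2::real}|lborel. c / 2) = c" by (simp add: set_integral_const)
  ultimately show ?thesis using \<mu> \<nu> by linarith
qed

end

section \<open>Independence and the past of Brownian motion\<close>

lemma gauss_density_vec:
  "gauss_density t (x :: real ^ 'n) = (\<Prod>i\<in>UNIV. normal_density 0 (sqrt t) (x $ i))"
proof -
  have B: "(Basis :: (real ^ 'n) set) = (\<lambda>i. axis i 1) ` UNIV" by (auto simp: Basis_vec_def)
  have "inj_on (\<lambda>i::'n. axis i (1::real)) UNIV" by (auto simp: inj_on_def axis_eq_axis)
  then show ?thesis unfolding gauss_density_def B by (simp add: prod.reindex inner_axis)
qed

lemma brownian_increment_distr:
  fixes W :: "real \<Rightarrow> 'a \<Rightarrow> real ^ 'n"
  assumes "brownian_motion M W" "0 \<le> s" "s < u"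
  shows "distr M borel (\<lambda>\<omega>. W u \<omega> - W s \<omega>) = gauss (u - s)"
proof -
  have "distr M lborel (\<lambda>\<omega>. W u \<omega> - W s \<omega>) = gauss (u - s)"
    using assms unfolding brownian_motion_def distributed_def gauss_def gauss_density_vec by auto
  then show ?thesis by (simp cong: distr_cong)
qed

context prob_space
begin

text \<open>
  Adjoins a third family to the first one. The product formula for triples is only asked for
  \<open>D\<close> against the pairs from \<open>A\<close> and \<open>C\<close>, which is how independence of a whole vector of random
  variables is available.
\<close>

lemma indep_set_Int_third:
  assumes AC: "indep_set A C" and D: "D \<subseteq> events" and sp: "space M \<in> C"
    and third: "\<And>a c d. a \<in> A \<Longrightarrow> c \<in> C \<Longrightarrow> d \<in> D \<Longrightarrow> prob ((a \<inter> c) \<inter> d) = prob (a \<inter> c) * prob d"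
  shows "indep_set {a \<inter> d | a d. a \<in> A \<and> d \<in> D} C"
  unfolding indep_sets2_eq
proof (intro conjI ballI)
  have A: "A \<subseteq> events" and C: "C \<subseteq> events"
    and prod: "\<And>a c. a \<in> A \<Longrightarrow> c \<in> C \<Longrightarrow> prob (a \<inter> c) = prob a * prob c"
    using AC unfolding indep_sets2_eq by auto
  show "{a \<inter> d | a d. a \<in> A \<and> d \<in> D} \<subseteq> events" using A D by auto
  show "C \<subseteq> events" by fact
  fix x c assume "x \<in> {a \<inter> d | a d. a \<in> A \<and> d \<in> D}" and c: "c \<in> C"
  then obtain a d where x: "x = a \<inter> d" and a: "a \<in> A" and d: "d \<in> D" by blast
  have "prob (a \<inter> d) = prob a * prob d"
    using third[OF a sp d] A a sets.sets_into_space[of a M] by (simp add: Int_absorb2 subset_eq)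
  moreover have "prob (x \<inter> c) = prob (a \<inter> c) * prob d"
    using third[OF a c d] unfolding x by (simp add: Int_ac)
  ultimately show "prob (x \<inter> c) = prob x * prob c"
    using prod[OF a c] unfolding x by simp
qed

text \<open>
  Null sets are added to a generator rather than to a sigma-algebra: the result is still stable under
  intersections.
\<close>

lemma indep_set_Un_null_sets:
  assumes "indep_set A C"
  shows "indep_set (A \<union> null_sets M) C"
  unfolding indep_sets2_eq
proof (intro conjI ballI)
  have A: "A \<subseteq> events" and C: "C \<subseteq> events"
    and prod: "\<And>a c. a \<in> A \<Longrightarrow> c \<in> C \<Longrightarrow> prob (a \<inter> c) = prob a * prob c"
    using assms unfolding indep_sets2_eq by auto
  show "A \<union> null_sets M \<subseteq> events" "C \<subseteq> events" using A C by auto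
  fix a c assume a: "a \<in> A \<union> null_sets M" and c: "c \<in> C"
  show "prob (a \<inter> c) = prob a * prob c"
  proof (cases "a \<in> A")
    case False
    then have n: "a \<in> null_sets M" using a by auto
    then have "a \<inter> c \<in> null_sets M" using c C by (intro null_set_Int2) auto
    then show ?thesis using n by (simp add: null_sets_def measure_def)
  qed (rule prod[OF _ c])
qed

lemma Int_stable_Un_null_sets:
  assumes "Int_stable A" "A \<subseteq> events"
  shows "Int_stable (A \<union> null_sets M)"
proof (rule Int_stableI)
  fix a b assume ab: "a \<in> A \<union> null_sets M" "b \<in> A \<union> null_sets M"
  show "a \<inter> b \<in> A \<union> null_sets M"
  proof (cases "a \<in> A \<and> b \<in> A")
    case True then show ?thesis using Int_stableD[OF assms(1)] by auto
  next
    case False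
    then show ?thesis using ab assms(2) null_set_Int1[of a M b] null_set_Int2[of b M a] by (auto simp: null_setsD2 subset_eq Int_commute)
  qed
qed

lemma independent_rvs_of_generators:
  assumes ind: "indep_set A C" and st: "Int_stable A" "Int_stable C"
    and Y: "Y \<in> measurable (sigma (space M) A) N" and Z: "Z \<in> measurable (sigma (space M) C) L"
  shows "independent_rvs M N Y L Z"
proof -
  have A: "A \<subseteq> events" and C: "C \<subseteq> events" using ind unfolding indep_sets2_eq by auto
  have pre: "V -` B \<inter> space M \<in> sigma_sets (space M) G"
    if "V \<in> measurable (sigma (space M) G) K" "G \<subseteq> events" "B \<in> sets K" for V G B and K :: "'z measure"
    using measurable_sets[OF that(1,3)] order_trans[OF that(2) sets.space_closed]
    by (simp add: space_measure_of_conv sets_measure_of)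
  have meas: "V \<in> measurable M K"
    if "V \<in> measurable (sigma (space M) G) K" "G \<subseteq> events" for V G and K :: "'z measure"
  proof (rule measurableI)
    show "V \<omega> \<in> space K" if "\<omega> \<in> space M" for \<omega>
      using measurable_space[OF \<open>V \<in> _\<close>] that by (simp add: space_measure_of_conv)
    show "V -` B \<inter> space M \<in> events" if "B \<in> sets K" for B
      using pre[OF \<open>V \<in> _\<close> \<open>G \<subseteq> _\<close> that] sets.sigma_sets_subset[OF \<open>G \<subseteq> _\<close>] by blast
  qed
  have ind': "indep_set (sigma_sets (space M) A) (sigma_sets (space M) C)"
    using ind st by (rule indep_set_sigma_sets)
  have "{Y -` B \<inter> space M | B. B \<in> sets N} \<subseteq> sigma_sets (space M) A"
    "{Z -` B \<inter> space M | B. B \<in> sets L} \<subseteq> sigma_sets (space M) C"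
    using pre[OF Y A] pre[OF Z C] by blast+
  then have "indep_set {Y -` B \<inter> space M | B. B \<in> sets N} {Z -` B \<inter> space M | B. B \<in> sets L}"
    using ind' unfolding indep_sets2_eq by blast
  then show ?thesis unfolding independent_rvs_def using meas[OF Y A] meas[OF Z C] by simp
qed

text \<open>
  Given \<open>X\<close>, the variable \<open>Y\<close> can be averaged out, and conversely.
\<close>

lemma indep_integral:
  fixes F :: "'b \<times> 'c \<Rightarrow> real"
  assumes ind: "independent_rvs M S X T Y" and F[measurable]: "F \<in> borel_measurable (S \<Otimes>\<^sub>M T)" and bd: "\<And>z. \<bar>F z\<bar> \<le> C"
  shows "(LINT \<omega>|M. F (X \<omega>, Y \<omega>)) = (LINT \<omega>|M. LINT y|distr M T Y. F (X \<omega>, y))"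
    and "(LINT \<omega>|M. F (X \<omega>, Y \<omega>)) = (LINT y|distr M T Y. LINT \<omega>|M. F (X \<omega>, y))"
proof -
  have X[measurable]: "X \<in> measurable M S" and Y[measurable]: "Y \<in> measurable M T"
    and prod: "\<And>A B. A \<in> sets S \<Longrightarrow> B \<in> sets T \<Longrightarrow>
        prob ((X -` A \<inter> space M) \<inter> (Y -` B \<inter> space M)) = prob (X -` A \<inter> space M) * prob (Y -` B \<inter> space M)"
    using ind unfolding independent_rvs_def indep_sets2_eq by blast+
  interpret DX: prob_space "distr M S X" by (rule prob_space_distr) fact
  interpret DY: prob_space "distr M T Y" by (rule prob_space_distr) fact
  have eq: "distr M S X \<Otimes>\<^sub>M distr M T Y = distr M (S \<Otimes>\<^sub>M T) (\<lambda>x. (X x, Y x))"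
  proof (rule pair_measure_eqI)
    fix A B assume "A \<in> sets (distr M S X)" "B \<in> sets (distr M T Y)"
    then have AB: "A \<in> sets S" "B \<in> sets T" by auto
    have "emeasure (distr M (S \<Otimes>\<^sub>M T) (\<lambda>x. (X x, Y x))) (A \<times> B) =
        emeasure M ((X -` A \<inter> space M) \<inter> (Y -` B \<inter> space M))"
      using AB by (subst emeasure_distr) (auto intro!: arg_cong[where f="emeasure M"])
    then show "emeasure (distr M S X) A * emeasure (distr M T Y) B =
        emeasure (distr M (S \<Otimes>\<^sub>M T) (\<lambda>x. (X x, Y x))) (A \<times> B)"
      using AB prod[OF AB] by (simp add: emeasure_distr emeasure_eq_measure ennreal_mult)
  qed (auto intro: DX.sigma_finite_measure_axioms DY.sigma_finite_measure_axioms)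
  interpret p: pair_prob_space "distr M S X" "distr M T Y" ..
  have int: "integrable (distr M S X \<Otimes>\<^sub>M distr M T Y) F"
    by (intro p.P.integrable_of_bound[where C=C]) (use bd in auto)
  have "(LINT \<omega>|M. F (X \<omega>, Y \<omega>)) = (LINT z|(distr M S X \<Otimes>\<^sub>M distr M T Y). F z)"
    unfolding eq by (subst integral_distr) auto
  also have "\<dots> = (LINT x|distr M S X. LINT y|distr M T Y. F (x, y))"
    using p.integral_fst'[OF int] by simp
  also have "\<dots> = (LINT \<omega>|M. LINT y|distr M T Y. F (X \<omega>, y))"
    by (subst integral_distr) auto
  finally show "(LINT \<omega>|M. F (X \<omega>, Y \<omega>)) = (LINT \<omega>|M. LINT y|distr M T Y. F (X \<omega>, y))" .
  have "(LINT \<omega>|M. F (X \<omega>, Y \<omega>)) = (LINT z|(distr M S X \<Otimes>\<^sub>M distr M T Y). F z)"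
    unfolding eq by (subst integral_distr) auto
  also have "\<dots> = (LINT y|distr M T Y. LINT x|distr M S X. F (x, y))"
    using p.integral_snd[of "\<lambda>x y. F (x, y)"] int by simp
  also have "\<dots> = (LINT y|distr M T Y. LINT \<omega>|M. F (X \<omega>, y))"
    by (intro Bochner_Integration.integral_cong refl) (subst integral_distr, auto)
  finally show "(LINT \<omega>|M. F (X \<omega>, Y \<omega>)) = (LINT y|distr M T Y. LINT \<omega>|M. F (X \<omega>, y))" .
qed

end

text \<open>
  The events of the form that \<open>independent_rvs\<close> speaks about, that is, the sigma-algebra generated
  by \<open>Y\<close>, as a plain set of events.
\<close>

definition preimages :: "'a measure \<Rightarrow> ('a \<Rightarrow> 'b) \<Rightarrow> 'b measure \<Rightarrow> 'a set set" where
  "preimages M Y N = {Y -` A \<inter> space M | A. A \<in> sets N}"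

lemma preimages_I: "A \<in> sets N \<Longrightarrow> Y -` A \<inter> space M \<in> preimages M Y N"
  by (auto simp: preimages_def)

lemma preimages_subset: "Y \<in> measurable M N \<Longrightarrow> preimages M Y N \<subseteq> sets M"
  by (auto simp: preimages_def)

lemma Int_stable_preimages: "Int_stable (preimages M Y N)"
proof (rule Int_stableI)
  fix a b assume "a \<in> preimages M Y N" "b \<in> preimages M Y N"
  then obtain A B where "a = Y -` A \<inter> space M" "b = Y -` B \<inter> space M" "A \<in> sets N" "B \<in> sets N"
    by (auto simp: preimages_def)
  then show "a \<inter> b \<in> preimages M Y N"
    using preimages_I[of "A \<inter> B" N Y M] by (simp add: Int_ac vimage_Int Int_left_absorb)
qed

lemma space_in_preimages: "Y \<in> measurable M N \<Longrightarrow> space M \<in> preimages M Y N"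
proof -
  assume "Y \<in> measurable M N"
  then have "Y -` space N \<inter> space M = space M" by (auto dest: measurable_space)
  then show ?thesis using preimages_I[of "space N" N Y M] by simp
qed

lemma measurable_sigma_preimages:
  assumes Y: "Y \<in> measurable M N" and sub: "preimages M Y N \<subseteq> G" and G: "G \<subseteq> Pow (space M)"
  shows "Y \<in> measurable (sigma (space M) G) N"
proof (rule measurableI)
  show "Y \<omega> \<in> space N" if "\<omega> \<in> space (sigma (space M) G)" for \<omega>
    using measurable_space[OF Y] that by (simp add: space_measure_of_conv)
  show "Y -` A \<inter> space (sigma (space M) G) \<in> sets (sigma (space M) G)" if "A \<in> sets N" for A
    using preimages_I[OF that, of Y M] sub G by (auto simp: space_measure_of_conv)
qed

lemma Int_stable_pairwise_Int:
  assumes "Int_stable A" "Int_stable D"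
  shows "Int_stable {a \<inter> d | a d. a \<in> A \<and> d \<in> D}"
proof (rule Int_stableI)
  fix x y assume "x \<in> {a \<inter> d | a d. a \<in> A \<and> d \<in> D}" "y \<in> {a \<inter> d | a d. a \<in> A \<and> d \<in> D}"
  then obtain a d a' d' where "x = a \<inter> d" "y = a' \<inter> d'" "a \<in> A" "d \<in> D" "a' \<in> A" "d' \<in> D" by blast
  then show "x \<inter> y \<in> {a \<inter> d | a d. a \<in> A \<and> d \<in> D}"
    using Int_stableD[OF assms(1), of a a'] Int_stableD[OF assms(2), of d d']
    by (intro CollectI exI[of _ "a \<inter> a'"] exI[of _ "d \<inter> d'"]) auto
qed

text \<open>
  Events that depend on finitely many times up to \<open>s\<close>: they are stable under intersections, generate
  the past, and only involve finitely many increments.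
\<close>

definition past_cylinders :: "'a measure \<Rightarrow> (real \<Rightarrow> 'a \<Rightarrow> 'b::topological_space) \<Rightarrow> real \<Rightarrow> 'a set set" where
  "past_cylinders M W s = {{\<omega> \<in> space M. \<forall>r\<in>R. W r \<omega> \<in> C r} | R C. finite R \<and> R \<subseteq> {0..s} \<and> (\<forall>r. C r \<in> sets borel)}"

lemma Int_stable_past_cylinders: "Int_stable (past_cylinders M W s)"
proof (rule Int_stableI)
  fix a b assume "a \<in> past_cylinders M W s" "b \<in> past_cylinders M W s"
  then obtain R C R' C' where R: "a = {\<omega> \<in> space M. \<forall>r\<in>R. W r \<omega> \<in> C r}" "finite R" "R \<subseteq> {0..s}" "\<And>r. C r \<in> sets borel"
    and R': "b = {\<omega> \<in> space M. \<forall>r\<in>R'. W r \<omega> \<in> C' r}" "finite R'" "R' \<subseteq> {0..s}" "\<And>r. C' r \<in> sets borel"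
    unfolding past_cylinders_def by blast
  let ?C = "\<lambda>r. (if r \<in> R then C r else UNIV) \<inter> (if r \<in> R' then C' r else UNIV)"
  have 1: "a \<inter> b = {\<omega> \<in> space M. \<forall>r\<in>R \<union> R'. W r \<omega> \<in> ?C r}" unfolding R R' by auto
  have 2: "finite (R \<union> R')" using R(2) R'(2) by simp
  have 3: "R \<union> R' \<subseteq> {0..s}" using R(3) R'(3) by simp
  have 4: "?C r \<in> sets borel" for r using R(4) R'(4) by auto
  show "a \<inter> b \<in> past_cylinders M W s" unfolding past_cylinders_def
    by (rule CollectI, rule exI[of _ "R \<union> R'"], rule exI[of _ ?C]) (intro conjI allI 1 2 3 4)
qed

text \<open>
  Sort the finitely many times of a cylinder, together with \<open>0\<close> and \<open>s\<close>. Since \<open>W 0 = 0\<close> almost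
  surely, the cylinder is up to a null set an event about the increments between consecutive times,
  and these are jointly independent of the increment from \<open>s\<close> to \<open>u\<close>.
\<close>

lemma past_cylinders_indep_increment:
  fixes W :: "real \<Rightarrow> 'a \<Rightarrow> real ^ 'n"
  assumes bm: "brownian_motion M W" and s: "0 \<le> s" "s \<le> u"
  shows "prob_space.indep_set M (past_cylinders M W s) (preimages M (\<lambda>\<omega>. W u \<omega> - W s \<omega>) borel)"
proof -
  interpret prob_space M using bm by (simp add: brownian_motion_def)
  have Wm[measurable]: "\<And>t. 0 \<le> t \<Longrightarrow> W t \<in> borel_measurable M" using bm by (simp add: brownian_motion_def)
  have W0: "AE \<omega> in M. W 0 \<omega> = 0" using bm by (simp add: brownian_motion_def)
  have dm: "(\<lambda>\<omega>. W u \<omega> - W s \<omega>) \<in> borel_measurable M" using s by simp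
  show ?thesis unfolding indep_sets2_eq
  proof (intro conjI ballI)
    show cyl: "past_cylinders M W s \<subseteq> events"
    proof
      fix a assume "a \<in> past_cylinders M W s"
      then obtain R C where R: "a = {\<omega> \<in> space M. \<forall>r\<in>R. W r \<omega> \<in> C r}" "finite R" "R \<subseteq> {0..s}" "\<And>r. C r \<in> sets borel"
        unfolding past_cylinders_def by blast
      have "{\<omega> \<in> space M. W r \<omega> \<in> C r} \<in> events" if "r \<in> R" for r
        using measurable_sets[OF Wm R(4), of r r] R(3) that by (auto simp: vimage_def Int_def conj_commute)
      then show "a \<in> events" unfolding R(1) using R(2) by (intro sets.sets_Collect_finite_All) auto
    qed
    show "preimages M (\<lambda>\<omega>. W u \<omega> - W s \<omega>) borel \<subseteq> events" using dm by (rule preimages_subset)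
    fix a c assume a: "a \<in> past_cylinders M W s" and c: "c \<in> preimages M (\<lambda>\<omega>. W u \<omega> - W s \<omega>) borel"
    obtain R C where R: "a = {\<omega> \<in> space M. \<forall>r\<in>R. W r \<omega> \<in> C r}" "finite R" "R \<subseteq> {0..s}" "\<And>r. C r \<in> sets borel"
      using a unfolding past_cylinders_def by blast
    note [measurable] = R(4)
    obtain D where D[measurable]: "D \<in> sets borel" and cD: "c = (\<lambda>\<omega>. W u \<omega> - W s \<omega>) -` D \<inter> space M" using c by (auto simp: preimages_def)
    define Q where "Q = insert 0 (insert s R)"
    define xs where "xs = sorted_list_of_set Q"
    define n where "n = length xs"
    have Q: "finite Q" "Q \<noteq> {}" "Q \<subseteq> {0..s}" "0 \<in> Q" "s \<in> Q" using R s by (auto simp: Q_def)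
    have xs: "set xs = Q" "sorted xs" "distinct xs" using Q by (auto simp: xs_def)
    have n: "n > 0" using xs Q unfolding n_def by (metis length_greater_0_conv list.set(1))
    have mono: "xs ! i \<le> xs ! j" if "i \<le> j" "j < n" for i j using xs that by (auto simp: n_def sorted_nth_mono)
    have inQ: "xs ! i \<in> Q" if "i < n" for i using xs that by (metis n_def nth_mem)
    have idx: "\<exists>j<n. xs ! j = r" if "r \<in> Q" for r using that xs by (metis in_set_conv_nth n_def)
    have first: "xs ! 0 = 0"
    proof -
      obtain j where j: "j < n" "xs ! j = 0" using idx Q by blast
      have "xs ! 0 \<le> 0" using mono[of 0 j] j by simp
      moreover have "0 \<le> xs ! 0" using inQ[OF n] Q by auto
      ultimately show ?thesis by simp
    qed
    have last: "xs ! (n - 1) = s"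
    proof -
      obtain j where j: "j < n" "xs ! j = s" using idx Q by blast
      have "s \<le> xs ! (n - 1)" using mono[of j "n - 1"] j by simp
      moreover have "xs ! (n - 1) \<le> s" using inQ[of "n - 1"] n Q by auto
      ultimately show ?thesis by simp
    qed
    \<comment> \<open>beyond the largest time \<open>s\<close> of the cylinder, the last increment is the one from \<open>s\<close> to \<open>u\<close>\<close>
    define \<tau> where "\<tau> i = (if i < n then xs ! i else u)" for i
    define \<Delta> where "\<Delta> i \<omega> = W (\<tau> (Suc i)) \<omega> - W (\<tau> i) \<omega>" for i \<omega>
    have t0: "0 \<le> \<tau> 0" using first n by (simp add: \<tau>_def)
    have tm: "\<tau> i \<le> \<tau> (Suc i)" if "i < n" for i
    proof (cases "Suc i < n")
      case True then show ?thesis using mono by (simp add: \<tau>_def)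
    next
      case False
      then have "i = n - 1" using that by simp
      then show ?thesis using last s n by (simp add: \<tau>_def)
    qed
    have ind: "indep_vars (\<lambda>_. borel) \<Delta> {..<n}"
      using bm t0 tm unfolding brownian_motion_def \<Delta>_def by blast
    let ?A = "{..<n - 1}" and ?B = "{n - 1}"
    have iv: "indep_var (PiM ?A (\<lambda>_. borel)) (\<lambda>\<omega>. restrict (\<lambda>i. \<Delta> i \<omega>) ?A) (PiM ?B (\<lambda>_. borel)) (\<lambda>\<omega>. restrict (\<lambda>i. \<Delta> i \<omega>) ?B)"
      using n by (intro indep_var_restrict[OF ind]) auto
    define QA where "QA = {f \<in> space (PiM ?A (\<lambda>_. borel)). \<forall>j\<in>{j\<in>{..<n}. xs ! j \<in> R}. (\<Sum>i<j. f i) \<in> C (xs ! j)}"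
    have QA: "QA \<in> sets (PiM ?A (\<lambda>_. borel))"
      unfolding QA_def
    proof (rule sets.sets_Collect_finite_All)
      fix j assume j: "j \<in> {j\<in>{..<n}. xs ! j \<in> R}"
      have [measurable]: "(\<lambda>f. \<Sum>i<j. f i) \<in> borel_measurable (PiM ?A (\<lambda>_. borel :: (real ^ 'n) measure))"
        using j by (intro borel_measurable_sum measurable_component_singleton) auto
      show "{f \<in> space (PiM ?A (\<lambda>_. borel)). (\<Sum>i<j. f i) \<in> C (xs ! j)} \<in> sets (PiM ?A (\<lambda>_. borel))"
        by measurable
    qed simp
    define QB where "QB = {f \<in> space (PiM ?B (\<lambda>_. borel)). f (n - 1) \<in> D}"
    have QB: "QB \<in> sets (PiM ?B (\<lambda>_. borel))" unfolding QB_def by measurable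
    let ?a = "(\<lambda>\<omega>. restrict (\<lambda>i. \<Delta> i \<omega>) ?A) -` QA \<inter> space M"
    have ca: "(\<lambda>\<omega>. restrict (\<lambda>i. \<Delta> i \<omega>) ?B) -` QB \<inter> space M = c"
      using n last by (auto simp: QB_def cD space_PiM \<Delta>_def \<tau>_def)
    have tel: "W (xs ! j) \<omega> = W 0 \<omega> + (\<Sum>i<j. \<Delta> i \<omega>)" if "j < n" for j \<omega>
      using sum_lessThan_telescope[of "\<lambda>i. W (\<tau> i) \<omega>" j] that first n by (simp add: \<Delta>_def \<tau>_def)
    have AEa: "AE \<omega> in M. \<omega> \<in> ?a \<longleftrightarrow> \<omega> \<in> a"
      using W0
    proof (eventually_elim)
      fix \<omega> assume w: "W 0 \<omega> = 0"
      have "(\<forall>j\<in>{j\<in>{..<n}. xs ! j \<in> R}. (\<Sum>i<j. restrict (\<lambda>i. \<Delta> i \<omega>) ?A i) \<in> C (xs ! j)) \<longleftrightarrow>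
        (\<forall>j\<in>{j\<in>{..<n}. xs ! j \<in> R}. W (xs ! j) \<omega> \<in> C (xs ! j))"
      proof (intro ball_cong refl)
        fix j assume "j \<in> {j\<in>{..<n}. xs ! j \<in> R}"
        then have j: "j < n" by simp
        have "(\<Sum>i<j. restrict (\<lambda>i. \<Delta> i \<omega>) ?A i) = (\<Sum>i<j. \<Delta> i \<omega>)" using j by (intro sum.cong) auto
        then show "((\<Sum>i<j. restrict (\<lambda>i. \<Delta> i \<omega>) ?A i) \<in> C (xs ! j)) = (W (xs ! j) \<omega> \<in> C (xs ! j))"
          using tel[OF j, of \<omega>] w by simp
      qed
      also have "\<dots> \<longleftrightarrow> (\<forall>r\<in>R. W r \<omega> \<in> C r)"
      proof -
        have "\<exists>j\<in>{j\<in>{..<n}. xs ! j \<in> R}. xs ! j = r" if "r \<in> R" for r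
          using idx[of r] that by (auto simp: Q_def)
        then show ?thesis by fastforce
      qed
      finally show "\<omega> \<in> ?a \<longleftrightarrow> \<omega> \<in> a" by (auto simp: QA_def R(1) space_PiM)
    qed
    have am: "a \<in> events" using cyl a by blast
    have cm: "c \<in> events" using c dm preimages_subset by blast
    have am': "?a \<in> events" using iv QA unfolding indep_var_distribution_eq by (auto intro: measurable_sets)
    have "prob (a \<inter> c) = prob (?a \<inter> c)"
      using AEa am cm am' by (intro finite_measure_eq_AE) auto
    also have "?a \<inter> c = (\<lambda>\<omega>. (restrict (\<lambda>i. \<Delta> i \<omega>) ?A, restrict (\<lambda>i. \<Delta> i \<omega>) ?B)) -` (QA \<times> QB) \<inter> space M"
      unfolding ca[symmetric] by auto
    also have "prob \<dots> = prob ?a * prob c"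
      unfolding ca[symmetric] by (rule indep_varD[OF iv QA QB])
    also have "prob ?a = prob a" using AEa am am' by (intro finite_measure_eq_AE) auto
    finally show "prob (a \<inter> c) = prob a * prob c" .
  qed
qed

text \<open>
  A generator, stable under intersections, of the past up to time \<open>s\<close> before it is augmented by
  null sets.
\<close>

definition past_events :: "'a measure \<Rightarrow> ('a \<Rightarrow> 'b::topological_space) \<Rightarrow> (real \<Rightarrow> 'a \<Rightarrow> 'b) \<Rightarrow> real \<Rightarrow> 'a set set" where
  "past_events M X0 W s = {a \<inter> d | a d. a \<in> past_cylinders M W s \<and> d \<in> preimages M X0 borel}"

lemma Int_stable_past_events: "Int_stable (past_events M X0 W s)"
  unfolding past_events_def by (intro Int_stable_pairwise_Int Int_stable_past_cylinders Int_stable_preimages)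

abbreviation "path_space \<equiv> (\<Pi>\<^sub>M t\<in>{0..}. borel) :: (real \<Rightarrow> 'b::topological_space) measure"

lemma process_path_in_space: "process_path W \<omega> \<in> space (path_space)"
  by (auto simp: process_path_def space_PiM)

lemma past_cylinders_path_preimages:
  "past_cylinders M W s \<subseteq> preimages M (process_path W) path_space"
proof
  fix a assume "a \<in> past_cylinders M W s"
  then obtain R C where R: "a = {\<omega> \<in> space M. \<forall>r\<in>R. W r \<omega> \<in> C r}" "finite R" "R \<subseteq> {0..s}" "\<And>r. C r \<in> sets borel"
    unfolding past_cylinders_def by blast
  have "{p \<in> space path_space. \<forall>r\<in>R. p r \<in> C r} \<in> sets path_space"
  proof (rule sets.sets_Collect_finite_All[OF _ R(2)])
    fix r assume "r \<in> R"
    then have [measurable]: "(\<lambda>p. p r) \<in> measurable path_space borel"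
      using R(3) by (intro measurable_component_singleton) auto
    note [measurable] = R(4)
    show "{p \<in> space path_space. p r \<in> C r} \<in> sets path_space" by measurable
  qed
  moreover have "a = process_path W -` {p \<in> space path_space. \<forall>r\<in>R. p r \<in> C r} \<inter> space M"
    using R(1,3) process_path_in_space[of W] by (auto simp: process_path_def subset_eq)
  ultimately show "a \<in> preimages M (process_path W) path_space" by (simp only: preimages_I)
qed

lemma increment_path_preimages:
  fixes W :: "real \<Rightarrow> 'a \<Rightarrow> 'b::euclidean_space"
  assumes "0 \<le> s" "0 \<le> u"
  shows "preimages M (\<lambda>\<omega>. W u \<omega> - W s \<omega>) borel \<subseteq> preimages M (process_path W) path_space"
proof
  fix c assume "c \<in> preimages M (\<lambda>\<omega>. W u \<omega> - W s \<omega>) borel"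
  then obtain D where D[measurable]: "D \<in> sets borel" and c: "c = (\<lambda>\<omega>. W u \<omega> - W s \<omega>) -` D \<inter> space M" by (auto simp: preimages_def)
  have [measurable]: "(\<lambda>p. p s) \<in> measurable path_space (borel :: 'b measure)" "(\<lambda>p. p u) \<in> measurable path_space (borel :: 'b measure)"
    using assms by (intro measurable_component_singleton; simp)+
  have "{p \<in> space path_space. p u - p s \<in> D} \<in> sets path_space" by measurable
  moreover have "c = process_path W -` {p \<in> space path_space. p u - p s \<in> D} \<inter> space M"
    using assms process_path_in_space[of W] unfolding c by (auto simp: process_path_def)
  ultimately show "c \<in> preimages M (process_path W) path_space" by (simp only: preimages_I)
qed

lemma preimages_snd_Pair: "Z \<in> space M \<rightarrow> space L \<Longrightarrow> Y \<in> space M \<rightarrow> space N \<Longrightarrow> preimages M Z L \<subseteq> preimages M (\<lambda>\<omega>. (Y \<omega>, Z \<omega>)) (N \<Otimes>\<^sub>M L)"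
proof
  fix c assume YZ: "Z \<in> space M \<rightarrow> space L" "Y \<in> space M \<rightarrow> space N" and "c \<in> preimages M Z L"
  then obtain D where D: "D \<in> sets L" "c = Z -` D \<inter> space M" by (auto simp: preimages_def)
  then have "c = (\<lambda>\<omega>. (Y \<omega>, Z \<omega>)) -` (space N \<times> D) \<inter> space M" using YZ by auto
  then show "c \<in> preimages M (\<lambda>\<omega>. (Y \<omega>, Z \<omega>)) (N \<Otimes>\<^sub>M L)" using D by (auto simp: preimages_def)
qed

lemma preimages_fst_Pair: "Z \<in> space M \<rightarrow> space L \<Longrightarrow> Y \<in> space M \<rightarrow> space N \<Longrightarrow> preimages M Y N \<subseteq> preimages M (\<lambda>\<omega>. (Y \<omega>, Z \<omega>)) (N \<Otimes>\<^sub>M L)"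
proof
  fix c assume YZ: "Z \<in> space M \<rightarrow> space L" "Y \<in> space M \<rightarrow> space N" and "c \<in> preimages M Y N"
  then obtain D where D: "D \<in> sets N" "c = Y -` D \<inter> space M" by (auto simp: preimages_def)
  then have "c = (\<lambda>\<omega>. (Y \<omega>, Z \<omega>)) -` (D \<times> space L) \<inter> space M" using YZ by auto
  then show "c \<in> preimages M (\<lambda>\<omega>. (Y \<omega>, Z \<omega>)) (N \<Otimes>\<^sub>M L)" using D by (auto simp: preimages_def)
qed

lemma (in prob_space) independent_rvs_iff_preimages:
  "independent_rvs M N Y L Z \<longleftrightarrow> Y \<in> measurable M N \<and> Z \<in> measurable M L \<and> indep_set (preimages M Y N) (preimages M Z L)"
  by (simp add: independent_rvs_def preimages_def)

lemma past_events_indep_increment: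
  fixes W :: "real \<Rightarrow> 'a \<Rightarrow> real ^ 'n"
  assumes bm: "brownian_motion M W" and ind: "independent_rvs M borel X0 path_space (process_path W)"
    and s: "0 \<le> s" "s \<le> u"
  shows "prob_space.indep_set M (past_events M X0 W s) (preimages M (\<lambda>\<omega>. W u \<omega> - W s \<omega>) borel)"
proof -
  interpret prob_space M using bm by (simp add: brownian_motion_def)
  have Wm[measurable]: "\<And>t. 0 \<le> t \<Longrightarrow> W t \<in> borel_measurable M" using bm by (simp add: brownian_motion_def)
  have X0: "X0 \<in> borel_measurable M" and indep: "indep_set (preimages M X0 borel) (preimages M (process_path W) path_space)"
    using ind by (auto simp: independent_rvs_iff_preimages)
  show ?thesis unfolding past_events_def
  proof (rule indep_set_Int_third)
    show "indep_set (past_cylinders M W s) (preimages M (\<lambda>\<omega>. W u \<omega> - W s \<omega>) borel)"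
      using bm s by (rule past_cylinders_indep_increment)
    show "preimages M X0 borel \<subseteq> events" using X0 by (rule preimages_subset)
    show "space M \<in> preimages M (\<lambda>\<omega>. W u \<omega> - W s \<omega>) borel"
      using s by (intro space_in_preimages) auto
    fix a c d assume a: "a \<in> past_cylinders M W s" and c: "c \<in> preimages M (\<lambda>\<omega>. W u \<omega> - W s \<omega>) borel"
      and d: "d \<in> preimages M X0 borel"
    have "a \<inter> c \<in> preimages M (process_path W) path_space"
      using a c s past_cylinders_path_preimages[of M W s] increment_path_preimages[of s u M W]
      by (intro Int_stableD[OF Int_stable_preimages]) auto
    then show "prob (a \<inter> c \<inter> d) = prob (a \<inter> c) * prob d"
      using indep d unfolding indep_sets2_eq by (metis Int_commute mult.commute)
  qed
qed

lemma past_generators: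
  assumes X0: "X0 \<in> borel_measurable M" 
  shows "preimages M X0 borel \<subseteq> past_events M X0 W s"
    and "0 \<le> r \<Longrightarrow> r \<le> s \<Longrightarrow> preimages M (W r) borel \<subseteq> past_events M X0 W s"
proof -
  have sp: "space M \<in> past_cylinders M W s" unfolding past_cylinders_def
    by (rule CollectI, rule exI[of _ "{}"], rule exI[of _ "\<lambda>_. UNIV"]) auto
  show "preimages M X0 borel \<subseteq> past_events M X0 W s"
  proof
    fix d assume d: "d \<in> preimages M X0 borel"
    then have "d = space M \<inter> d" by (auto simp: preimages_def)
    then show "d \<in> past_events M X0 W s" unfolding past_events_def using sp d by blast
  qed
  assume r: "0 \<le> r" "r \<le> s"
  show "preimages M (W r) borel \<subseteq> past_events M X0 W s"
  proof
    fix a assume "a \<in> preimages M (W r) borel"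
    then obtain A where A: "A \<in> sets borel" "a = W r -` A \<inter> space M" by (auto simp: preimages_def)
    have "a \<in> past_cylinders M W s" unfolding past_cylinders_def
      by (rule CollectI, rule exI[of _ "{r}"], rule exI[of _ "\<lambda>_. A"]) (use A r in auto)
    moreover have "a = a \<inter> space M" using A by auto
    ultimately show "a \<in> past_events M X0 W s" unfolding past_events_def using space_in_preimages[OF X0] by blast
  qed
qed

text \<open>
  The generator of the augmented filtration lies in the past events and the null sets, a family which
  is stable under intersections and independent of the increment.
\<close>

lemma adapted_indep_increment:
  fixes W :: "real \<Rightarrow> 'a \<Rightarrow> real ^ 'n"
  assumes bm: "brownian_motion M W" and ind: "independent_rvs M borel X0 path_space (process_path W)"
    and s: "0 \<le> s" "s \<le> u" and Y: "Y \<in> borel_measurable (augmented_filtration M X0 W s)"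
  shows "independent_rvs M borel Y borel (\<lambda>\<omega>. W u \<omega> - W s \<omega>)"
proof -
  interpret prob_space M using bm by (simp add: brownian_motion_def)
  have Wm[measurable]: "\<And>t. 0 \<le> t \<Longrightarrow> W t \<in> borel_measurable M" using bm by (simp add: brownian_motion_def)
  have X0: "X0 \<in> borel_measurable M" using ind by (auto simp: independent_rvs_def)
  have pe: "indep_set (past_events M X0 W s) (preimages M (\<lambda>\<omega>. W u \<omega> - W s \<omega>) borel)"
    by (rule past_events_indep_increment[OF bm ind s])
  then have ev: "past_events M X0 W s \<subseteq> events" "preimages M (\<lambda>\<omega>. W u \<omega> - W s \<omega>) borel \<subseteq> events" unfolding indep_sets2_eq by auto
  let ?G = "{X0 -` A \<inter> space M | A. A \<in> sets borel} \<union>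
        {W r -` A \<inter> space M | r A. 0 \<le> r \<and> r \<le> s \<and> A \<in> sets borel} \<union> null_sets M"
  let ?P = "past_events M X0 W s \<union> null_sets M"
  have "X0 -` A \<inter> space M \<in> ?P" if "A \<in> sets borel" for A
    using past_generators(1)[OF X0, of W s] preimages_I[OF that, of X0 M] by blast
  moreover have "W r -` A \<inter> space M \<in> ?P" if "A \<in> sets borel" "0 \<le> r" "r \<le> s" for r A
    using past_generators(2)[OF X0, of r s W] preimages_I[OF that(1), of "W r" M] that by blast
  ultimately have GP: "?G \<subseteq> ?P" by blast
  have P: "?P \<subseteq> Pow (space M)" using ev(1) sets.space_closed[of M] by auto
  have "Y \<in> borel_measurable (sigma (space M) ?P)"
  proof (rule measurableI)
    fix A :: "'b set" assume A: "A \<in> sets borel"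
    have "Y -` A \<inter> space M \<in> sigma_sets (space M) ?G"
      using measurable_sets[OF Y A] GP P unfolding augmented_filtration_def
      by (subst (asm) sets_measure_of) (auto simp: space_measure_of_conv)
    also have "\<dots> \<subseteq> sigma_sets (space M) ?P" by (rule sigma_sets_mono'[OF GP])
    finally show "Y -` A \<inter> space (sigma (space M) ?P) \<in> sets (sigma (space M) ?P)"
      using P by (simp add: space_measure_of_conv sets_measure_of)
  qed simp
  moreover have "(\<lambda>\<omega>. W u \<omega> - W s \<omega>) \<in> borel_measurable (sigma (space M) (preimages M (\<lambda>\<omega>. W u \<omega> - W s \<omega>) borel))"
    using s ev(2) sets.space_closed[of M] by (intro measurable_sigma_preimages) auto
  ultimately show ?thesis
    by (intro independent_rvs_of_generators[OF indep_set_Un_null_sets[OF pe]]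
          Int_stable_Un_null_sets Int_stable_past_events Int_stable_preimages ev(1))
qed

section \<open>A jointly measurable version of the solution\<close>

text \<open>
  The process is the limit of its values at the grid points \<open>\<lfloor>n t\<rfloor> / n\<close>, of which there are
  countably many.
\<close>

lemma continuous_process_jointly_measurable:
  fixes Y :: "real \<Rightarrow> 'a \<Rightarrow> 'b::euclidean_space"
  assumes Y: "\<And>t. Y t \<in> borel_measurable M"
    and cont: "\<And>\<omega>. \<omega> \<in> space M \<Longrightarrow> continuous_on UNIV (\<lambda>t. Y t \<omega>)"
  shows "(\<lambda>z. Y (fst z) (snd z)) \<in> borel_measurable (borel \<Otimes>\<^sub>M M)"
proof (rule borel_measurable_LIMSEQ_metric)
  fix n :: nat
  note [measurable] = Y
  have [measurable]: "(\<lambda>z. Y (real_of_int i / real (Suc n)) (snd z)) \<in> borel_measurable ((borel :: real measure) \<Otimes>\<^sub>M M)" for i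
    by (rule measurable_compose[OF measurable_snd Y])
  have "(\<lambda>z. \<lfloor>real (Suc n) * fst z\<rfloor>) \<in> measurable ((borel :: real measure) \<Otimes>\<^sub>M M) (count_space UNIV)" by measurable
  then show "(\<lambda>z. Y (real_of_int \<lfloor>real (Suc n) * fst z\<rfloor> / real (Suc n)) (snd z)) \<in> borel_measurable (borel \<Otimes>\<^sub>M M)"
    by (rule measurable_compose_countable[rotated]) measurable
next
  fix z :: "real \<times> 'a" assume "z \<in> space (borel \<Otimes>\<^sub>M M)"
  then have \<omega>: "snd z \<in> space M" by (auto simp: space_pair_measure)
  have "(\<lambda>n. real_of_int \<lfloor>real (Suc n) * fst z\<rfloor> / real (Suc n)) \<longlonglongrightarrow> fst z"
  proof (rule LIMSEQ_I)
    fix e :: real assume "e > 0"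
    then obtain N where N: "inverse (real (Suc N)) < e" using reals_Archimedean by blast
    have "norm (real_of_int \<lfloor>real (Suc n) * fst z\<rfloor> / real (Suc n) - fst z) < e" if "n \<ge> N" for n
    proof -
      have "\<bar>real_of_int \<lfloor>real (Suc n) * fst z\<rfloor> - real (Suc n) * fst z\<bar> \<le> 1" by linarith
      then have "\<bar>real_of_int \<lfloor>real (Suc n) * fst z\<rfloor> - real (Suc n) * fst z\<bar> / real (Suc n) \<le> 1 / real (Suc n)"
        by (intro divide_right_mono) auto
      also have "\<bar>real_of_int \<lfloor>real (Suc n) * fst z\<rfloor> - real (Suc n) * fst z\<bar> / real (Suc n) =
         \<bar>(real_of_int \<lfloor>real (Suc n) * fst z\<rfloor> - real (Suc n) * fst z) / real (Suc n)\<bar>" by (simp only: abs_divide abs_of_nat)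
      also have "(real_of_int \<lfloor>real (Suc n) * fst z\<rfloor> - real (Suc n) * fst z) / real (Suc n) = real_of_int \<lfloor>real (Suc n) * fst z\<rfloor> / real (Suc n) - fst z"
        by (simp only: diff_divide_distrib) simp
      also have "1 / real (Suc n) \<le> inverse (real (Suc N))" using that by (simp add: field_simps)
      finally show ?thesis using N by simp
    qed
    then show "\<exists>N. \<forall>n\<ge>N. norm (real_of_int \<lfloor>real (Suc n) * fst z\<rfloor> / real (Suc n) - fst z) < e" by blast
  qed
  moreover have "isCont (\<lambda>t. Y t (snd z)) (fst z)" using cont[OF \<omega>] by (simp add: continuous_on_eq_continuous_at)
  ultimately show "(\<lambda>n. Y (real_of_int \<lfloor>real (Suc n) * fst z\<rfloor> / real (Suc n)) (snd z)) \<longlonglongrightarrow> Y (fst z) (snd z)"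
    by (rule isCont_tendsto_compose[rotated])
qed

lemma set_integral_Icc_split:
  fixes f :: "real \<Rightarrow> 'b::{banach, second_countable_topology}"
  assumes "a \<le> c" "c \<le> b" and f: "set_integrable lborel {a..b} f"
  shows "(LINT r:{a..b}|lborel. f r) = (LINT r:{a..c}|lborel. f r) + (LINT r:{c..b}|lborel. f r)"
proof -
  have "{a..b} = {a..c} \<union> {c..b}" using assms by auto
  moreover have "AE x in lborel. \<not> (x \<in> {a..c} \<and> x \<in> {c..b})"
    using AE_lborel_singleton[of c] by eventually_elim auto
  ultimately show ?thesis
    using assms by (simp, intro set_integral_Un_AE) (auto intro: set_integrable_subset[OF f])
qed

text \<open>
  Fubini in time and randomness needs a jointly measurable process, whereas a solution is only known
  to be adapted. The integral equation makes almost all of its paths continuous. Projecting the time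
  argument to \<open>[0, T]\<close> and putting the process to zero on an exceptional null set gives a
  version that is continuous everywhere; it is still adapted because the filtration contains
  the null sets.
\<close>

lemma sde_regular_version:
  fixes X W :: "real \<Rightarrow> 'a \<Rightarrow> real ^ 'n"
  assumes bm: "brownian_motion M W" and sde: "sde_solution M T b X0 W X" and T: "0 < T"
    and X0: "X0 \<in> borel_measurable M" and bb: "\<And>t x. norm (b t x) \<le> \<beta>"
  obtains Y where "(\<lambda>z. Y (fst z) (snd z)) \<in> borel_measurable (borel \<Otimes>\<^sub>M M)"
    and "\<And>t. t \<in> {0..T} \<Longrightarrow> AE \<omega> in M. Y t \<omega> = X t \<omega>"
    and "\<And>t. t \<in> {0..T} \<Longrightarrow> Y t \<in> borel_measurable (augmented_filtration M X0 W t)"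
    and "AE \<omega> in M. \<forall>s t. 0 \<le> s \<longrightarrow> s \<le> t \<longrightarrow> t \<le> T \<longrightarrow>
            Y t \<omega> - Y s \<omega> = (W t \<omega> - W s \<omega>) + (LINT r:{s..t}|lborel. b r (Y r \<omega>))"
    and "AE \<omega> in M. Y 0 \<omega> = X0 \<omega>"
    and "\<And>t. t \<in> {0..T} \<Longrightarrow> X t \<in> borel_measurable M"
proof -
  interpret prob_space M using bm by (simp add: brownian_motion_def)
  define P where "P \<omega> \<longleftrightarrow> W 0 \<omega> = 0 \<and> continuous_on {0..} (\<lambda>t. W t \<omega>) \<and>
      set_integrable lborel {0..T} (\<lambda>s. b s (X s \<omega>)) \<and>
      (\<forall>t\<in>{0..T}. X t \<omega> = X0 \<omega> + W t \<omega> + (LINT s:{0..t}|lborel. b s (X s \<omega>)))" for \<omega>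
  have "AE \<omega> in M. P \<omega>"
    using bm sde unfolding brownian_motion_def sde_solution_def P_def by auto
  then obtain N where N: "{\<omega> \<in> space M. \<not> P \<omega>} \<subseteq> N" "emeasure M N = 0" "N \<in> events" by (rule AE_E)
  then have N0: "N \<in> null_sets M" by auto
  have AEN: "AE \<omega> in M. \<omega> \<notin> N" by (rule AE_not_in[OF N0])
  \<comment> \<open>the projection of the time axis onto the interval from \<open>0\<close> to \<open>T\<close>\<close>
  define clip where "clip t = max 0 (min T t)" for t :: real
  have clip: "clip t \<in> {0..T}" for t using T by (auto simp: clip_def)
  have clip_id: "clip t = t" if "t \<in> {0..T}" for t using that by (auto simp: clip_def)
  define Y where "Y t \<omega> = (if \<omega> \<in> N then 0 else X (clip t) \<omega>)" for t \<omega>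
  have Wm: "\<And>r. 0 \<le> r \<Longrightarrow> W r \<in> borel_measurable M" using bm by (simp add: brownian_motion_def)
  have filt: "space (augmented_filtration M X0 W t) = space M" "N \<in> sets (augmented_filtration M X0 W t)"
     "sets (augmented_filtration M X0 W t) \<subseteq> events" for t
  proof -
    let ?G = "{X0 -` A \<inter> space M | A. A \<in> sets borel} \<union>
        {W r -` A \<inter> space M | r A. 0 \<le> r \<and> r \<le> t \<and> A \<in> sets borel} \<union> null_sets M"
    have G: "?G \<subseteq> events" using measurable_sets[OF X0] measurable_sets[OF Wm] by auto
    then have G': "?G \<subseteq> Pow (space M)" using sets.space_closed by blast
    show "space (augmented_filtration M X0 W t) = space M" by (simp add: augmented_filtration_def space_measure_of_conv)
    show "N \<in> sets (augmented_filtration M X0 W t)" unfolding augmented_filtration_def using G' N0 by (intro in_measure_of) auto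
    show "sets (augmented_filtration M X0 W t) \<subseteq> events" unfolding augmented_filtration_def
      using sets.sigma_sets_subset[OF G] G' by (simp add: sets_measure_of)
  qed
  have Xm: "X t \<in> borel_measurable (augmented_filtration M X0 W t)" if "t \<in> {0..T}" for t
    using sde that by (simp add: sde_solution_def)
  have XM: "X t \<in> borel_measurable M" if "t \<in> {0..T}" for t
  proof (rule measurableI)
    show "X t -` A \<inter> space M \<in> events" if "A \<in> sets borel" for A
      using subsetD[OF filt(3)[of t] measurable_sets[OF Xm[OF \<open>t \<in> {0..T}\<close>] that]] by (simp add: filt(1))
  qed simp
  have Yfilt: "Y t \<in> borel_measurable (augmented_filtration M X0 W t)" if "t \<in> {0..T}" for t
    unfolding Y_def clip_id[OF that] using N filt Xm[OF that] sets.sets_into_space[OF N(3)]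
    by (intro measurable_If_set) (auto simp: Int_absorb2)
  have YM: "Y t \<in> borel_measurable M" for t
    unfolding Y_def using N(3) XM[OF clip, of t] by (intro measurable_If_set) auto
  have \<beta>: "0 \<le> \<beta>" using bb[of 0 0] norm_ge_zero order_trans by blast
  have good: "X0 \<omega> + W 0 \<omega> + (LINT r:{0..0}|lborel. b r (X r \<omega>)) = X0 \<omega> \<and>
     (\<forall>s t. 0 \<le> s \<longrightarrow> s \<le> t \<longrightarrow> t \<le> T \<longrightarrow>
        X t \<omega> - X s \<omega> = (W t \<omega> - W s \<omega>) + (LINT r:{s..t}|lborel. b r (X r \<omega>)))" if "P \<omega>" for \<omega>
  proof (intro conjI allI impI)
    have "norm (LINT r:{0..0}|lborel. b r (X r \<omega>)) \<le> \<beta> * (0 - 0)" by (rule norm_set_integral_Icc_le) (auto simp: bb)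
    then show "X0 \<omega> + W 0 \<omega> + (LINT r:{0..0}|lborel. b r (X r \<omega>)) = X0 \<omega>" using that by (simp add: P_def)
    fix s t assume st: "0 \<le> s" "s \<le> t" "t \<le> T"
    have "set_integrable lborel {0..t} (\<lambda>s. b s (X s \<omega>))"
      using that st by (auto simp: P_def intro: set_integrable_subset)
    then have "(LINT r:{0..t}|lborel. b r (X r \<omega>)) = (LINT r:{0..s}|lborel. b r (X r \<omega>)) + (LINT r:{s..t}|lborel. b r (X r \<omega>))"
      using st by (intro set_integral_Icc_split) auto
    then show "X t \<omega> - X s \<omega> = (W t \<omega> - W s \<omega>) + (LINT r:{s..t}|lborel. b r (X r \<omega>))"
      using that st by (simp add: P_def)
  qed
  have cont: "continuous_on UNIV (\<lambda>t. Y t \<omega>)" if \<omega>: "\<omega> \<in> space M" for \<omega>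
  proof (cases "\<omega> \<in> N")
    case True
    then show ?thesis by (simp add: Y_def)
  next
    case False
    then have P: "P \<omega>" using N \<omega> by blast
    define I where "I t = X t \<omega> - W t \<omega>" for t
    have "\<beta>-lipschitz_on {0..T} I"
    proof (rule lipschitz_on_leI)
      fix s t assume st: "s \<in> {0..T}" "t \<in> {0..T}" "s \<le> t"
      have "I t - I s = (LINT r:{s..t}|lborel. b r (X r \<omega>))"
        using good[OF P] st by (simp add: I_def algebra_simps)
      then have "norm (I t - I s) \<le> \<beta> * (t - s)" using st by (simp add: norm_set_integral_Icc_le bb)
      then show "dist (I s) (I t) \<le> \<beta> * dist s t" using st by (simp add: dist_norm norm_minus_commute dist_real_def)
    qed (rule \<beta>)
    then have I: "continuous_on {0..T} I" by (rule lipschitz_on_continuous_on)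
    have W: "continuous_on {0..} (\<lambda>t. W t \<omega>)" using P by (simp add: P_def)
    have c: "continuous_on UNIV clip" unfolding clip_def by (intro continuous_intros)
    have "continuous_on UNIV (\<lambda>t. W (clip t) \<omega> + I (clip t))"
      using clip by (intro continuous_on_add continuous_on_compose2[OF W c] continuous_on_compose2[OF I c]) auto
    then show ?thesis using False by (simp add: Y_def I_def)
  qed
  show ?thesis
  proof (rule that)
    show "(\<lambda>z. Y (fst z) (snd z)) \<in> borel_measurable (borel \<Otimes>\<^sub>M M)"
      using YM cont by (rule continuous_process_jointly_measurable)
    show "AE \<omega> in M. Y t \<omega> = X t \<omega>" if "t \<in> {0..T}" for t
      using AEN by eventually_elim (simp add: Y_def clip_id[OF that])
    show "Y t \<in> borel_measurable (augmented_filtration M X0 W t)" if "t \<in> {0..T}" for t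
      by (rule Yfilt[OF that])
    show "AE \<omega> in M. \<forall>s t. 0 \<le> s \<longrightarrow> s \<le> t \<longrightarrow> t \<le> T \<longrightarrow>
            Y t \<omega> - Y s \<omega> = (W t \<omega> - W s \<omega>) + (LINT r:{s..t}|lborel. b r (Y r \<omega>))"
      using AEN AE_space
    proof eventually_elim
      fix \<omega> assume \<omega>: "\<omega> \<notin> N" "\<omega> \<in> space M"
      then have P: "P \<omega>" using N by blast
      show "\<forall>s t. 0 \<le> s \<longrightarrow> s \<le> t \<longrightarrow> t \<le> T \<longrightarrow>
            Y t \<omega> - Y s \<omega> = (W t \<omega> - W s \<omega>) + (LINT r:{s..t}|lborel. b r (Y r \<omega>))"
      proof (intro allI impI)
        fix s t assume st: "0 \<le> s" "s \<le> t" "t \<le> T"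
        have "(LINT r:{s..t}|lborel. b r (Y r \<omega>)) = (LINT r:{s..t}|lborel. b r (X r \<omega>))"
          using st \<omega> by (intro set_lebesgue_integral_cong) (auto simp: Y_def clip_id)
        then show "Y t \<omega> - Y s \<omega> = (W t \<omega> - W s \<omega>) + (LINT r:{s..t}|lborel. b r (Y r \<omega>))"
          using good[OF P] st \<omega> by (simp add: Y_def clip_id)
      qed
    qed
    show "X t \<in> borel_measurable M" if "t \<in> {0..T}" for t by (rule XM[OF that])
    show "AE \<omega> in M. Y 0 \<omega> = X0 \<omega>"
      using AEN AE_space
    proof eventually_elim
      fix \<omega> assume \<omega>: "\<omega> \<notin> N" "\<omega> \<in> space M"
      then have P: "P \<omega>" using N by blast
      have "Y 0 \<omega> = X 0 \<omega>" using \<omega> T by (simp add: Y_def clip_id)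
      also have "\<dots> = X0 \<omega> + W 0 \<omega> + (LINT s:{0..0}|lborel. b s (X s \<omega>))" using P T unfolding P_def by auto
      also have "\<dots> = X0 \<omega>" using good[OF P] by blast
      finally show "Y 0 \<omega> = X0 \<omega>" .
    qed
  qed
qed

section \<open>Duhamel formula for a process with bounded drift\<close>

text \<open>
  The fundamental theorem of calculus, with a primitive that is continuous up to the singularity
  at \<open>t\<close>.
\<close>

lemma inverse_sqrt_integral:
  fixes a b t :: real
  assumes ab: "a \<le> b" "b \<le> t"
  shows "set_integrable lborel {a..b} (\<lambda>r. 1 / sqrt (t - r))"
    and "(LINT r:{a..b}|lborel. 1 / sqrt (t - r)) = 2 * sqrt (t - a) - 2 * sqrt (t - b)"
proof -
  have "((\<lambda>r. 1 / sqrt (t - r)) has_integral (- 2 * sqrt (t - b)) - (- 2 * sqrt (t - a))) {a..b}"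
  proof (rule fundamental_theorem_of_calculus_interior[OF ab(1)])
    show "continuous_on {a..b} (\<lambda>r. - 2 * sqrt (t - r))" by (intro continuous_intros)
    fix r assume "r \<in> {a<..<b}"
    then have "0 < t - r" using ab by auto
    then have "((\<lambda>r. - 2 * sqrt (t - r)) has_real_derivative 1 / sqrt (t - r)) (at r)"
      by (auto intro!: derivative_eq_intros simp: field_simps)
    then show "((\<lambda>r. - 2 * sqrt (t - r)) has_vector_derivative 1 / sqrt (t - r)) (at r)"
      by (simp add: has_real_derivative_iff_has_vector_derivative)
  qed
  then have hi: "((\<lambda>r. 1 / sqrt (t - r)) has_integral (2 * sqrt (t - a) - 2 * sqrt (t - b))) {a..b}" by simp
  have eq: "(\<integral>\<^sup>+ r. ennreal (indicator {a..b} r *\<^sub>R (1 / sqrt (t - r))) \<partial>lborel) = ennreal (2 * sqrt (t - a) - 2 * sqrt (t - b))"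
    using nn_integral_has_integral_lebesgue[OF _ hi] ab by simp
  have "integrable lborel (\<lambda>r. indicator {a..b} r *\<^sub>R (1 / sqrt (t - r))) \<and>
     integral\<^sup>L lborel (\<lambda>r. indicator {a..b} r *\<^sub>R (1 / sqrt (t - r))) = 2 * sqrt (t - a) - 2 * sqrt (t - b)"
    using ab by (intro nn_integral_eq_integrable[THEN iffD1, OF _ _ _ eq]) (auto split: split_indicator)
  then show "set_integrable lborel {a..b} (\<lambda>r. 1 / sqrt (t - r))"
    "(LINT r:{a..b}|lborel. 1 / sqrt (t - r)) = 2 * sqrt (t - a) - 2 * sqrt (t - b)"
    unfolding set_integrable_def set_lebesgue_integral_def by auto
qed

text \<open>
  Over \<open>n\<close> equal steps the increments add up to at most \<open>K a sqrt (a / n)\<close>.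
\<close>

lemma constant_of_small_increments:
  fixes g :: "real \<Rightarrow> real"
  assumes a: "0 \<le> a" and K: "0 \<le> K"
    and inc: "\<And>s s'. 0 \<le> s \<Longrightarrow> s < s' \<Longrightarrow> s' \<le> a \<Longrightarrow> \<bar>g s' - g s\<bar> \<le> K * ((s' - s) * sqrt (s' - s))"
  shows "g a = g 0"
proof (cases "a = 0")
  case False
  with a have a: "0 < a" by simp
  have *: "\<bar>g a - g 0\<bar> \<le> K * a * sqrt a * (1 / sqrt (real (Suc n)))" for n
  proof -
    define x where "x i = real i * a / real (Suc n)" for i
    have d: "x (Suc i) - x i = a / real (Suc n)" for i by (simp add: x_def add_divide_distrib distrib_right)
    have "\<bar>g (x (Suc i)) - g (x i)\<bar> \<le> K * (a / real (Suc n) * sqrt (a / real (Suc n)))" if "i < Suc n" for i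
    proof -
      have "x (Suc i) \<le> a"
      proof -
        have "real (Suc i) * a \<le> real (Suc n) * a" using that a by (intro mult_right_mono) auto
        then show ?thesis by (simp add: x_def divide_le_eq mult.commute del: of_nat_Suc)
      qed
      moreover have "0 \<le> x i" using a by (simp add: x_def)
      moreover have "0 < a / real (Suc n)" using a by simp
      then have "x i < x (Suc i)" using d[of i] by linarith
      ultimately have "\<bar>g (x (Suc i)) - g (x i)\<bar> \<le> K * ((x (Suc i) - x i) * sqrt (x (Suc i) - x i))" by (intro inc)
      then show ?thesis unfolding d .
    qed
    then have "(\<Sum>i<Suc n. \<bar>g (x (Suc i)) - g (x i)\<bar>) \<le> real (card {..<Suc n}) * (K * (a / real (Suc n) * sqrt (a / real (Suc n))))"
      by (intro sum_bounded_above) auto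
    moreover have "\<bar>g (x (Suc n)) - g (x 0)\<bar> \<le> (\<Sum>i<Suc n. \<bar>g (x (Suc i)) - g (x i)\<bar>)"
      by (subst sum_lessThan_telescope[symmetric]) (rule sum_abs)
    moreover have "x (Suc n) = a" "x 0 = 0" by (simp_all add: x_def del: of_nat_Suc)
    moreover have "real (card {..<Suc n}) * (K * (a / real (Suc n) * sqrt (a / real (Suc n)))) = K * a * sqrt a * (1 / sqrt (real (Suc n)))"
      by (simp add: real_sqrt_divide del: of_nat_Suc)
    ultimately show ?thesis by simp
  qed
  have "(\<lambda>n. K * a * sqrt a * (1 / sqrt (real (Suc n)))) \<longlonglongrightarrow> K * a * sqrt a * 0"
  proof (intro tendsto_mult tendsto_const)
    have "(\<lambda>n. sqrt (inverse (real (Suc n)))) \<longlonglongrightarrow> sqrt 0"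
      by (intro tendsto_real_sqrt LIMSEQ_inverse_real_of_nat)
    then show "(\<lambda>n. 1 / sqrt (real (Suc n))) \<longlonglongrightarrow> 0" by (simp add: real_sqrt_divide inverse_eq_divide)
  qed
  then have "\<bar>g a - g 0\<bar> \<le> K * a * sqrt a * 0"
    by (rule LIMSEQ_le_const) (use * in blast)
  then show ?thesis by simp
qed simp

text \<open>
  What the Duhamel formula needs of a solution and its driving process: increments that are Gaussian
  and independent of the present state, and the integral equation with a bounded drift.
\<close>

locale bounded_drift_process = prob_space M for M :: "'a measure" +
  fixes Y W :: "real \<Rightarrow> 'a \<Rightarrow> 'v::euclidean_space" and b :: "real \<Rightarrow> 'v \<Rightarrow> 'v" and \<beta> T :: real
  assumes Y_measurable: "(\<lambda>z. Y (fst z) (snd z)) \<in> borel_measurable (borel \<Otimes>\<^sub>M M)"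
    and b_measurable: "(\<lambda>z. b (fst z) (snd z)) \<in> borel_measurable (borel \<Otimes>\<^sub>M borel)"
    and b_bounded: "\<And>t x. norm (b t x) \<le> \<beta>"
    and W_measurable: "\<And>t. 0 \<le> t \<Longrightarrow> W t \<in> borel_measurable M"
    and increment_distr: "\<And>s u. 0 \<le> s \<Longrightarrow> s < u \<Longrightarrow> distr M borel (\<lambda>\<omega>. W u \<omega> - W s \<omega>) = gauss (u - s)"
    and increment_indep: "\<And>s u. 0 \<le> s \<Longrightarrow> s \<le> u \<Longrightarrow> u \<le> T \<Longrightarrow>
       independent_rvs M borel (Y s) borel (\<lambda>\<omega>. W u \<omega> - W s \<omega>)"
    and integral_equation: "AE \<omega> in M. \<forall>s t. 0 \<le> s \<longrightarrow> s \<le> t \<longrightarrow> t \<le> T \<longrightarrow>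
            Y t \<omega> - Y s \<omega> = (W t \<omega> - W s \<omega>) + (LINT r:{s..t}|lborel. b r (Y r \<omega>))"
begin

lemma Y_comp_measurable [measurable (raw)]:
  assumes [measurable]: "f \<in> borel_measurable N" "g \<in> measurable N M"
  shows "(\<lambda>x. Y (f x) (g x)) \<in> borel_measurable N"
  using measurable_compose[OF measurable_Pair[OF assms] Y_measurable] by simp

lemma b_comp_measurable [measurable (raw)]:
  assumes [measurable]: "f \<in> borel_measurable N" "g \<in> borel_measurable N"
  shows "(\<lambda>x. b (f x) (g x)) \<in> borel_measurable N"
  using measurable_compose[OF measurable_Pair[OF assms] b_measurable] by simp

lemma \<beta>_nonneg: "0 \<le> \<beta>" using b_bounded[of 0 0] norm_ge_zero order_trans by blast

lemma drift_path_measurable: "\<omega> \<in> space M \<Longrightarrow> (\<lambda>r. b r (Y r \<omega>)) \<in> borel_measurable borel"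
  by measurable

lemma drift_integral_le: "s \<le> t \<Longrightarrow> norm (LINT r:{s..t}|lborel. b r (Y r \<omega>)) \<le> \<beta> * (t - s)"
  by (rule norm_set_integral_Icc_le) (auto simp: b_bounded)

lemma expectation_increment_norm:
  assumes "0 \<le> s" "s \<le> u"
  shows "integrable M (\<lambda>\<omega>. norm (W u \<omega> - W s \<omega>))"
    and "(LINT \<omega>|M. norm (W u \<omega> - W s \<omega>)) \<le> sqrt DIM('v) * sqrt (u - s)"
proof -
  have [measurable]: "W u \<in> borel_measurable M" "W s \<in> borel_measurable M" using assms by (auto intro: W_measurable)
  have "integrable M (\<lambda>\<omega>. norm (W u \<omega> - W s \<omega>)) \<and> (LINT \<omega>|M. norm (W u \<omega> - W s \<omega>)) \<le> sqrt DIM('v) * sqrt (u - s)"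
  proof (cases "s = u")
    case False
    with assms have su: "s < u" by simp
    let ?D = "distr M borel (\<lambda>\<omega>. W u \<omega> - W s \<omega>)"
    have "integrable ?D norm" "(LINT w|?D. norm w) \<le> sqrt DIM('v) * sqrt (u - s)"
      unfolding increment_distr[OF assms(1) su] using su by (auto intro!: integrable_gauss_norm integral_gauss_norm_le)
    then show ?thesis by (simp add: integrable_distr_eq integral_distr)
  qed simp
  then show "integrable M (\<lambda>\<omega>. norm (W u \<omega> - W s \<omega>))"
    and "(LINT \<omega>|M. norm (W u \<omega> - W s \<omega>)) \<le> sqrt DIM('v) * sqrt (u - s)" by auto
qed

text \<open>
  Without drift, one step of the process averages test functions with the heat semigroup.
\<close>

lemma expectation_free_step:
  fixes f :: "'v \<Rightarrow> real"
  assumes f[measurable]: "f \<in> borel_measurable borel" and bd: "\<And>x. \<bar>f x\<bar> \<le> C" and s: "0 \<le> s" "s \<le> u" "u \<le> T"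
  shows "(LINT \<omega>|M. f (Y s \<omega> + (W u \<omega> - W s \<omega>))) = (LINT \<omega>|M. heat (u - s) f (Y s \<omega>))"
proof (cases "s = u")
  case True
  then show ?thesis by (simp add: heat_nonpos)
next
  case False
  with s have su: "s < u" by simp
  have "(LINT \<omega>|M. (\<lambda>(x, w). f (x + w)) (Y s \<omega>, W u \<omega> - W s \<omega>)) =
      (LINT \<omega>|M. LINT w|distr M borel (\<lambda>\<omega>. W u \<omega> - W s \<omega>). (\<lambda>(x, w). f (x + w)) (Y s \<omega>, w))"
    by (rule indep_integral(1)[OF increment_indep[OF s], where C=C]) (auto simp: bd split_beta)
  then show ?thesis by (simp add: increment_distr[OF s(1) su] heat_def)
qed

lemma displacement_bound:
  assumes s: "0 \<le> s" "s \<le> r" "r \<le> u" "u \<le> T"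
  shows "AE \<omega> in M. norm (Y s \<omega> + (W u \<omega> - W s \<omega>) - Y r \<omega>) \<le> norm (W u \<omega> - W r \<omega>) + \<beta> * (r - s)"
  using integral_equation
proof eventually_elim
  fix \<omega> assume "\<forall>s t. 0 \<le> s \<longrightarrow> s \<le> t \<longrightarrow> t \<le> T \<longrightarrow>
            Y t \<omega> - Y s \<omega> = (W t \<omega> - W s \<omega>) + (LINT r:{s..t}|lborel. b r (Y r \<omega>))"
  then have "Y r \<omega> - Y s \<omega> = (W r \<omega> - W s \<omega>) + (LINT r:{s..r}|lborel. b r (Y r \<omega>))" using s by auto
  then have "Y s \<omega> + (W u \<omega> - W s \<omega>) - Y r \<omega> = (W u \<omega> - W r \<omega>) - (LINT r:{s..r}|lborel. b r (Y r \<omega>))"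
    by (simp add: algebra_simps)
  also have "norm \<dots> \<le> norm (W u \<omega> - W r \<omega>) + norm (LINT r:{s..r}|lborel. b r (Y r \<omega>))" by (rule norm_triangle_ineq4)
  finally show "norm (Y s \<omega> + (W u \<omega> - W s \<omega>) - Y r \<omega>) \<le> norm (W u \<omega> - W r \<omega>) + \<beta> * (r - s)"
    using drift_integral_le[OF s(2), of \<omega>] by linarith
qed

lemma inner_drift_le: "\<bar>g \<bullet> b r x\<bar> \<le> norm g * \<beta>"
  by (rule order_trans[OF Cauchy_Schwarz_ineq2]) (intro mult_left_mono b_bounded norm_ge_zero)

text \<open>
  For smooth enough data, the derivative in \<open>r\<close> of the mean of \<open>heat (t - r) f (Y r \<omega>)\<close>: in
  Ito's formula the second-order term cancels the time derivative, and the drift term remains.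
\<close>

definition flux :: "real \<Rightarrow> ('v \<Rightarrow> real) \<Rightarrow> real \<Rightarrow> real" where
  "flux t f r = (LINT \<omega>|M. heat_grad (t - r) f (Y r \<omega>) \<bullet> b r (Y r \<omega>))"

context
  fixes f :: "'v \<Rightarrow> real" and C :: real
  assumes f[measurable]: "f \<in> borel_measurable borel" and bd: "\<And>x. \<bar>f x\<bar> \<le> C"
begin

lemma heat_grad_comp_measurable:
  assumes [measurable]: "p \<in> borel_measurable N" "g \<in> borel_measurable N"
  shows "(\<lambda>x. heat_grad (p x) f (g x)) \<in> borel_measurable N"
  using measurable_compose[OF measurable_Pair[OF assms] heat_grad_jointly_measurable[OF f]] by simp

lemma flux_measurable [measurable]: "flux t f \<in> borel_measurable borel"
proof -
  have [measurable]: "(\<lambda>z. heat_grad (t - fst z) f (Y (fst z) (snd z))) \<in> borel_measurable (borel \<Otimes>\<^sub>M M)"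
    by (rule heat_grad_comp_measurable) measurable
  have "(\<lambda>z. heat_grad (t - fst z) f (Y (fst z) (snd z)) \<bullet> b (fst z) (Y (fst z) (snd z))) \<in> borel_measurable (borel \<Otimes>\<^sub>M M)"
    by measurable
  then show ?thesis unfolding flux_def[abs_def]
    by (intro borel_measurable_lebesgue_integral) (simp add: split_beta)
qed

lemma gradient_drift_le:
  assumes "0 < s"
  shows "\<bar>heat_grad s f x \<bullet> b r y\<bar> \<le> 2 * C * sqrt DIM('v) * \<beta> / sqrt s"
proof -
  have "\<bar>heat_grad s f x \<bullet> b r y\<bar> \<le> 2 * C * sqrt DIM('v) / sqrt s * \<beta>"
    by (intro order_trans[OF inner_drift_le] mult_right_mono norm_heat_grad_le[OF f bd assms] \<beta>_nonneg)
  then show ?thesis by simp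
qed

lemma flux_le:
  assumes "r < t"
  shows "\<bar>flux t f r\<bar> \<le> 2 * C * sqrt DIM('v) * \<beta> / sqrt (t - r)"
proof -
  have "norm (flux t f r) \<le> 2 * C * sqrt DIM('v) * \<beta> / sqrt (t - r)"
    unfolding flux_def
    by (rule norm_integral_le_const) (unfold real_norm_def, rule gradient_drift_le, use assms in simp)
  then show ?thesis by simp
qed

lemma flux_integrable:
  assumes "s \<le> u" "u \<le> t"
  shows "set_integrable lborel {s..u} (flux t f)"
    and "\<bar>LINT r:{s..u}|lborel. flux t f r\<bar> \<le> 2 * C * sqrt DIM('v) * \<beta> * (2 * sqrt (t - s) - 2 * sqrt (t - u))"
proof -
  let ?K = "2 * C * sqrt DIM('v) * \<beta>"
  have i: "integrable lborel (\<lambda>r. ?K * (indicator {s..u} r *\<^sub>R (1 / sqrt (t - r))))"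
    using inverse_sqrt_integral(1)[OF assms] unfolding set_integrable_def by (rule integrable_mult_right)
  have le: "AE r in lborel. norm (indicator {s..u} r *\<^sub>R flux t f r) \<le> ?K * (indicator {s..u} r *\<^sub>R (1 / sqrt (t - r)))"
    using AE_lborel_singleton[of t]
  proof eventually_elim
    fix r assume "r \<noteq> t"
    then show "norm (indicator {s..u} r *\<^sub>R flux t f r) \<le> ?K * (indicator {s..u} r *\<^sub>R (1 / sqrt (t - r)))"
      using flux_le[of r t] assms by (auto split: split_indicator)
  qed
  show "set_integrable lborel {s..u} (flux t f)" unfolding set_integrable_def
  proof (rule Bochner_Integration.integrable_bound[OF i])
    show "AE r in lborel. norm (indicator {s..u} r *\<^sub>R flux t f r) \<le> norm (?K * (indicator {s..u} r *\<^sub>R (1 / sqrt (t - r))))"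
      using le by eventually_elim (unfold real_norm_def, erule order_trans, rule abs_ge_self)
  qed measurable
  have "norm (LINT r:{s..u}|lborel. flux t f r) \<le> (LINT r|lborel. ?K * (indicator {s..u} r *\<^sub>R (1 / sqrt (t - r))))"
    unfolding set_lebesgue_integral_def by (rule norm_integral_le_of_bound[OF i le])
  also have "\<dots> = ?K * (LINT r:{s..u}|lborel. 1 / sqrt (t - r))"
    unfolding set_lebesgue_integral_def by (rule integral_mult_right_zero)
  finally show "\<bar>LINT r:{s..u}|lborel. flux t f r\<bar> \<le> ?K * (2 * sqrt (t - s) - 2 * sqrt (t - u))"
    unfolding inverse_sqrt_integral(2)[OF assms] by simp
qed

end

end

context bounded_drift_process
begin

context
  fixes f :: "'v \<Rightarrow> real" and C :: real
  assumes f[measurable]: "f \<in> borel_measurable borel" and bd: "\<And>x. \<bar>f x\<bar> \<le> C"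
begin

lemma expectation_affine:
  fixes g :: "'a \<Rightarrow> real"
  assumes "integrable M g"
  shows "(LINT \<omega>|M. \<beta> * (k * (g \<omega> + p) + q)) = \<beta> * (k * ((LINT \<omega>|M. g \<omega>) + p) + q)"
  using assms by (simp add: prob_space)

text \<open>
  Let \<open>Z\<close> be the state at time \<open>u\<close> if the drift is switched off after \<open>s\<close>, so that
  \<open>Y u = Z + A\<close> with \<open>\<bar>A\<bar> \<le> \<beta> e\<close>. Averaging over the increment of \<open>W\<close> turns
  \<open>heat (t - u) f\<close> at \<open>Z\<close> into \<open>heat (t - s) f\<close> at \<open>Y s\<close>. An expansion in \<open>A\<close>
  leaves the gradient at \<open>Z\<close> against the drift. Moving the gradient from time \<open>u\<close> and state \<open>Z\<close>
  to time \<open>r\<close> and state \<open>Y r\<close> costs the modulus of continuity \<open>sqrt e\<close> of the noise, hence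
  \<open>e sqrt e\<close> after integration over the step. This replaces Ito's formula.
\<close>

lemma duhamel_small_step:
  fixes s u t :: real
  defines "\<tau> \<equiv> t - u" and "e \<equiv> u - s"
  assumes su: "0 \<le> s" "s < u" "u < t" "t \<le> T"
  shows "\<bar>(LINT \<omega>|M. heat (t - u) f (Y u \<omega>)) - (LINT \<omega>|M. heat (t - s) f (Y s \<omega>)) - (LINT r:{s..u}|lborel. flux t f r)\<bar>
    \<le> 2 * C * DIM('v) / \<tau> * (\<beta> * e)\<^sup>2 +
       \<beta> * (2 * C * DIM('v) / \<tau> * (sqrt DIM('v) * sqrt e + \<beta> * e) + 8 * C * sqrt DIM('v) ^ 5 * e / (\<tau> * sqrt \<tau>)) * e"
proof -
  let ?c = "sqrt (real DIM('v))"
  have \<tau>: "0 < \<tau>" and e: "0 < e" using su by (auto simp: \<tau>_def e_def)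
  have C: "0 \<le> C" using bd[of 0] by linarith
  have [measurable]: "W u \<in> borel_measurable M" "W s \<in> borel_measurable M" using su by (auto intro!: W_measurable)
  \<comment> \<open>the free evolution from time \<open>s\<close>, and the effect of the drift\<close>
  define Z where "Z \<omega> = Y s \<omega> + (W u \<omega> - W s \<omega>)" for \<omega>
  define A where "A \<omega> = (LINT r:{s..u}|lborel. b r (Y r \<omega>))" for \<omega>
  let ?h = "heat \<tau> f" and ?G = "heat_grad \<tau> f"
  have [measurable]: "Z \<in> borel_measurable M" unfolding Z_def by measurable
  have [measurable]: "A \<in> borel_measurable M" unfolding A_def set_lebesgue_integral_def by measurable
  have hb: "\<bar>?h x\<bar> \<le> C" for x by (rule abs_heat_le[OF f bd])
  have Gb: "norm (?G x) \<le> 2 * C * ?c / sqrt \<tau>" for x by (rule norm_heat_grad_le[OF f bd \<tau>])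
  have Ab: "norm (A \<omega>) \<le> \<beta> * e" for \<omega> unfolding A_def e_def using su by (intro drift_integral_le) auto
  have GAb: "\<bar>?G (Z \<omega>) \<bullet> A \<omega>\<bar> \<le> 2 * C * ?c / sqrt \<tau> * (\<beta> * e)" for \<omega>
    using C \<tau> by (intro order_trans[OF Cauchy_Schwarz_ineq2] mult_mono Gb Ab) auto
  have i1: "integrable M (\<lambda>\<omega>. ?h (Y u \<omega>))" by (rule integrable_of_bound[where C=C]) (auto simp: hb)
  have i2: "integrable M (\<lambda>\<omega>. ?h (Z \<omega>))" by (rule integrable_of_bound[where C=C]) (auto simp: hb)
  have i3: "integrable M (\<lambda>\<omega>. ?G (Z \<omega>) \<bullet> A \<omega>)"
    by (rule integrable_of_bound[where C="2 * C * ?c / sqrt \<tau> * (\<beta> * e)"]) (measurable, simp only: real_norm_def GAb)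
  have free: "(LINT \<omega>|M. ?h (Z \<omega>)) = (LINT \<omega>|M. heat (t - s) f (Y s \<omega>))"
  proof -
    have "(LINT \<omega>|M. ?h (Z \<omega>)) = (LINT \<omega>|M. heat (u - s) ?h (Y s \<omega>))"
      unfolding Z_def using su hb by (intro expectation_free_step[where C=C]) auto
    also have "\<dots> = (LINT \<omega>|M. heat (t - s) f (Y s \<omega>))"
      using su bd by (simp add: heat_semigroup[of f C] \<tau>_def)
    finally show ?thesis .
  qed
  have "AE \<omega> in M. norm (?h (Y u \<omega>) - ?h (Z \<omega>) - ?G (Z \<omega>) \<bullet> A \<omega>) \<le> 2 * C * DIM('v) / \<tau> * (\<beta> * e)\<^sup>2"
    using integral_equation
  proof eventually_elim
    fix \<omega> assume "\<forall>s t. 0 \<le> s \<longrightarrow> s \<le> t \<longrightarrow> t \<le> T \<longrightarrow>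
            Y t \<omega> - Y s \<omega> = (W t \<omega> - W s \<omega>) + (LINT r:{s..t}|lborel. b r (Y r \<omega>))"
    then have "Y u \<omega> - Y s \<omega> = (W u \<omega> - W s \<omega>) + A \<omega>" unfolding A_def using su by auto
    then have Yu: "Y u \<omega> = Z \<omega> + A \<omega>" by (simp add: Z_def algebra_simps)
    have "\<bar>?h (Y u \<omega>) - ?h (Z \<omega>) - ?G (Z \<omega>) \<bullet> A \<omega>\<bar> \<le> 2 * C * ?c\<^sup>2 / \<tau> * (norm (A \<omega>))\<^sup>2"
      unfolding Yu by (rule heat_expansion[OF f bd \<tau>])
    also have "\<dots> \<le> 2 * C * ?c\<^sup>2 / \<tau> * (\<beta> * e)\<^sup>2"
      using C \<tau> by (intro mult_left_mono power_mono Ab) auto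
    finally show "norm (?h (Y u \<omega>) - ?h (Z \<omega>) - ?G (Z \<omega>) \<bullet> A \<omega>) \<le> 2 * C * DIM('v) / \<tau> * (\<beta> * e)\<^sup>2" by simp
  qed
  then have "norm (LINT \<omega>|M. ?h (Y u \<omega>) - ?h (Z \<omega>) - ?G (Z \<omega>) \<bullet> A \<omega>) \<le> (LINT \<omega>|M. 2 * C * DIM('v) / \<tau> * (\<beta> * e)\<^sup>2)"
    by (intro norm_integral_le_of_bound) auto
  then have taylor: "\<bar>(LINT \<omega>|M. ?h (Y u \<omega>)) - (LINT \<omega>|M. ?h (Z \<omega>)) - (LINT \<omega>|M. ?G (Z \<omega>) \<bullet> A \<omega>)\<bar> \<le> 2 * C * DIM('v) / \<tau> * (\<beta> * e)\<^sup>2"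
    using i1 i2 i3 by (simp add: prob_space)
  \<comment> \<open>the flux with gradient frozen at \<open>Z\<close> and time \<open>u\<close>\<close>
  define q where "q r = (LINT \<omega>|M. ?G (Z \<omega>) \<bullet> b r (Y r \<omega>))" for r
  have qm[measurable]: "q \<in> borel_measurable borel" unfolding q_def[abs_def] by measurable
  have Gbb: "\<bar>?G (Z \<omega>) \<bullet> b r (Y r \<omega>)\<bar> \<le> 2 * C * ?c / sqrt \<tau> * \<beta>" for r \<omega>
    by (intro order_trans[OF inner_drift_le] mult_right_mono Gb \<beta>_nonneg)
  have qb: "norm (q r) \<le> 2 * C * ?c / sqrt \<tau> * \<beta>" for r
    unfolding q_def by (rule norm_integral_le_const) (simp only: real_norm_def Gbb)
  have fubini: "(LINT \<omega>|M. ?G (Z \<omega>) \<bullet> A \<omega>) = (LINT r:{s..u}|lborel. q r)"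
  proof -
    interpret p: pair_sigma_finite lborel M ..
    let ?F = "\<lambda>r \<omega>. indicator {s..u} r *\<^sub>R (?G (Z \<omega>) \<bullet> b r (Y r \<omega>))"
    have int: "integrable (lborel \<Otimes>\<^sub>M M) (\<lambda>(r, \<omega>). ?F r \<omega>)"
    proof (rule integrableI_bounded_set[where A="{s..u} \<times> space M" and B="2 * C * ?c / sqrt \<tau> * \<beta>"])
      show "emeasure (lborel \<Otimes>\<^sub>M M) ({s..u} \<times> space M) < \<infinity>"
        using su by (subst emeasure_pair_measure_Times) (auto simp: emeasure_space_1)
      show "AE z in lborel \<Otimes>\<^sub>M M. z \<in> {s..u} \<times> space M \<longrightarrow> norm (case z of (r, \<omega>) \<Rightarrow> ?F r \<omega>) \<le> 2 * C * ?c / sqrt \<tau> * \<beta>"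
        using Gbb by (intro AE_I2) (auto split: prod.split)
      show "AE z in lborel \<Otimes>\<^sub>M M. z \<notin> {s..u} \<times> space M \<longrightarrow> (case z of (r, \<omega>) \<Rightarrow> ?F r \<omega>) = 0"
        by (intro AE_I2) (auto simp: space_pair_measure indicator_eq_0_iff)
    qed measurable
    have "(LINT \<omega>|M. ?G (Z \<omega>) \<bullet> A \<omega>) = (LINT \<omega>|M. LINT r|lborel. ?F r \<omega>)"
    proof (rule Bochner_Integration.integral_cong[OF refl])
      fix \<omega> assume \<omega>: "\<omega> \<in> space M"
      have "set_integrable lborel {s..u} (\<lambda>r. b r (Y r \<omega>))"
        using drift_path_measurable[OF \<omega>] b_bounded by (intro set_integrable_bounded_Icc[where K=\<beta>]) auto
      then have "?G (Z \<omega>) \<bullet> (LINT r|lborel. indicator {s..u} r *\<^sub>R b r (Y r \<omega>)) = (LINT r|lborel. ?G (Z \<omega>) \<bullet> (indicator {s..u} r *\<^sub>R b r (Y r \<omega>)))"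
        unfolding set_integrable_def by (intro integral_inner_right[symmetric])
      then show "?G (Z \<omega>) \<bullet> A \<omega> = (LINT r|lborel. ?F r \<omega>)" by (simp add: A_def set_lebesgue_integral_def)
    qed
    also have "\<dots> = (LINT r|lborel. LINT \<omega>|M. ?F r \<omega>)" by (rule p.Fubini_integral[OF int])
    also have "\<dots> = (LINT r:{s..u}|lborel. q r)" by (simp add: q_def set_lebesgue_integral_def)
    finally show ?thesis .
  qed
  let ?D = "\<beta> * (2 * C * DIM('v) / \<tau> * (?c * sqrt e + \<beta> * e) + 8 * C * ?c ^ 5 * e / (\<tau> * sqrt \<tau>))"
  have close: "norm (q r - flux t f r) \<le> ?D" if r: "s \<le> r" "r \<le> u" for r
  proof -
    let ?H = "\<lambda>\<omega>. heat_grad (t - r) f (Y r \<omega>)"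
    let ?R = "8 * C * ?c ^ 5 * e / (\<tau> * sqrt \<tau>)"
    have [measurable]: "W r \<in> borel_measurable M" using su r by (auto intro!: W_measurable)
    have tr: "0 < t - r" using r su by simp
    have Hb: "norm (?H \<omega> \<bullet> b r (Y r \<omega>)) \<le> 2 * C * ?c / sqrt (t - r) * \<beta>" for \<omega>
      unfolding real_norm_def by (intro order_trans[OF inner_drift_le] mult_right_mono norm_heat_grad_le[OF f bd tr] \<beta>_nonneg)
    have iH: "integrable M (\<lambda>\<omega>. ?H \<omega> \<bullet> b r (Y r \<omega>))" by (rule integrable_of_bound[OF _ Hb]) measurable
    have iG: "integrable M (\<lambda>\<omega>. ?G (Z \<omega>) \<bullet> b r (Y r \<omega>))" by (rule integrable_of_bound[OF _ Gbb[folded real_norm_def]]) measurable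
    have eq: "q r - flux t f r = (LINT \<omega>|M. ?G (Z \<omega>) \<bullet> b r (Y r \<omega>) - ?H \<omega> \<bullet> b r (Y r \<omega>))"
      unfolding q_def flux_def using iH iG by simp
    have "norm (q r - flux t f r) \<le> (LINT \<omega>|M. \<beta> * (2 * C * DIM('v) / \<tau> * (norm (W u \<omega> - W r \<omega>) + \<beta> * e) + ?R))"
      unfolding eq
    proof (rule norm_integral_le_of_bound)
      show "integrable M (\<lambda>\<omega>. \<beta> * (2 * C * DIM('v) / \<tau> * (norm (W u \<omega> - W r \<omega>) + \<beta> * e) + ?R))"
        using expectation_increment_norm(1)[of r u] su r by simp
      show "AE \<omega> in M. norm (?G (Z \<omega>) \<bullet> b r (Y r \<omega>) - ?H \<omega> \<bullet> b r (Y r \<omega>)) \<le> \<beta> * (2 * C * DIM('v) / \<tau> * (norm (W u \<omega> - W r \<omega>) + \<beta> * e) + ?R)"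
        using displacement_bound[OF su(1) r order_trans[OF less_imp_le[OF su(3)] su(4)]]
      proof eventually_elim
        fix \<omega> assume "norm (Y s \<omega> + (W u \<omega> - W s \<omega>) - Y r \<omega>) \<le> norm (W u \<omega> - W r \<omega>) + \<beta> * (r - s)"
        moreover have "\<beta> * (r - s) \<le> \<beta> * e" using r \<beta>_nonneg by (intro mult_left_mono) (auto simp: e_def)
        ultimately have dist: "norm (Z \<omega> - Y r \<omega>) \<le> norm (W u \<omega> - W r \<omega>) + \<beta> * e" by (simp add: Z_def)
        have "norm (?G (Z \<omega>) - ?G (Y r \<omega>)) \<le> 2 * C * ?c\<^sup>2 / \<tau> * norm (Z \<omega> - Y r \<omega>)"
          using heat_grad_lipschitz[OF f bd \<tau>, of "Y r \<omega>" "Z \<omega> - Y r \<omega>"] by simp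
        also have "\<dots> \<le> 2 * C * ?c\<^sup>2 / \<tau> * (norm (W u \<omega> - W r \<omega>) + \<beta> * e)"
          using C \<tau> by (intro mult_left_mono dist) auto
        finally have 1: "norm (?G (Z \<omega>) - ?G (Y r \<omega>)) \<le> 2 * C * DIM('v) / \<tau> * (norm (W u \<omega> - W r \<omega>) + \<beta> * e)" by simp
        have "norm (heat_grad ((u - r) + \<tau>) f (Y r \<omega>) - ?G (Y r \<omega>)) \<le> 8 * C * ?c ^ 5 * (u - r) / (\<tau> * sqrt \<tau>)"
          using r by (intro heat_grad_time_increment[OF f bd] \<tau>) auto
        also have "(u - r) + \<tau> = t - r" by (simp add: \<tau>_def)
        also have "8 * C * ?c ^ 5 * (u - r) / (\<tau> * sqrt \<tau>) \<le> ?R"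
          using C \<tau> r by (intro divide_right_mono mult_left_mono) (auto simp: e_def)
        finally have 2: "norm (?H \<omega> - ?G (Y r \<omega>)) \<le> ?R" .
        have "norm (?G (Z \<omega>) - ?H \<omega>) \<le> norm (?G (Z \<omega>) - ?G (Y r \<omega>)) + norm (?H \<omega> - ?G (Y r \<omega>))"
          using norm_triangle_ineq4[of "?G (Z \<omega>) - ?G (Y r \<omega>)" "?H \<omega> - ?G (Y r \<omega>)"] by simp
        then have 3: "norm (?G (Z \<omega>) - ?H \<omega>) \<le> 2 * C * DIM('v) / \<tau> * (norm (W u \<omega> - W r \<omega>) + \<beta> * e) + ?R"
          using 1 2 by linarith
        have "\<bar>?G (Z \<omega>) \<bullet> b r (Y r \<omega>) - ?H \<omega> \<bullet> b r (Y r \<omega>)\<bar> = \<bar>(?G (Z \<omega>) - ?H \<omega>) \<bullet> b r (Y r \<omega>)\<bar>" by (simp add: inner_diff_left)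
        also have "\<dots> \<le> norm (?G (Z \<omega>) - ?H \<omega>) * \<beta>" by (rule inner_drift_le)
        also have "\<dots> \<le> (2 * C * DIM('v) / \<tau> * (norm (W u \<omega> - W r \<omega>) + \<beta> * e) + ?R) * \<beta>"
          by (intro mult_right_mono 3 \<beta>_nonneg)
        finally show "norm (?G (Z \<omega>) \<bullet> b r (Y r \<omega>) - ?H \<omega> \<bullet> b r (Y r \<omega>)) \<le> \<beta> * (2 * C * DIM('v) / \<tau> * (norm (W u \<omega> - W r \<omega>) + \<beta> * e) + ?R)"
          by (simp only: real_norm_def mult.commute[of \<beta>])
      qed
    qed
    also have "\<dots> = \<beta> * (2 * C * DIM('v) / \<tau> * ((LINT \<omega>|M. norm (W u \<omega> - W r \<omega>)) + \<beta> * e) + ?R)"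
      using su r by (intro expectation_affine[OF expectation_increment_norm(1)]) linarith+
    also have "\<dots> \<le> ?D"
    proof -
      have "(LINT \<omega>|M. norm (W u \<omega> - W r \<omega>)) \<le> ?c * sqrt (u - r)" using su r by (intro expectation_increment_norm(2)) auto
      also have "\<dots> \<le> ?c * sqrt e" using r by (intro mult_left_mono) (auto simp: e_def)
      finally show ?thesis using \<beta>_nonneg C \<tau> by (intro mult_left_mono add_right_mono) auto
    qed
    finally show ?thesis .
  qed
  have diff: "(LINT r:{s..u}|lborel. q r) - (LINT r:{s..u}|lborel. flux t f r) = (LINT r:{s..u}|lborel. q r - flux t f r)"
    using flux_integrable(1)[OF f bd, of s u t] su
    by (intro set_integral_diff(2)[symmetric] set_integrable_bounded_Icc[OF qm qb]) auto
  have "norm (LINT r:{s..u}|lborel. q r - flux t f r) \<le> ?D * (u - s)"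
    using su by (intro norm_set_integral_Icc_le close) auto
  then have flux_close: "\<bar>(LINT r:{s..u}|lborel. q r) - (LINT r:{s..u}|lborel. flux t f r)\<bar> \<le> ?D * e"
    unfolding diff e_def real_norm_def .
  have triangle: "\<bar>x - y - w\<bar> \<le> p \<Longrightarrow> \<bar>w - z\<bar> \<le> p' \<Longrightarrow> \<bar>x - y - z\<bar> \<le> p + p'" for x y w z p p' :: real
    by linarith
  show ?thesis
    using triangle[OF taylor[unfolded free fubini] flux_close] unfolding \<tau>_def .
qed

text \<open>
  Away from the singularity at \<open>t\<close> the errors over a step of length \<open>e\<close> are of order
  \<open>e sqrt e\<close> uniformly, and a function with such increments is constant.
\<close>

lemma duhamel_interior:
  assumes t: "0 < \<eta>" "\<eta> \<le> t" "t \<le> T"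
  shows "(LINT \<omega>|M. heat \<eta> f (Y (t - \<eta>) \<omega>)) = (LINT \<omega>|M. heat t f (Y 0 \<omega>)) + (LINT r:{0..t - \<eta>}|lborel. flux t f r)"
proof -
  let ?c = "sqrt (real DIM('v))" and ?d = "real DIM('v)"
  have C: "0 \<le> C" using bd[of 0] by linarith
  have T: "0 < T" using t by simp
  define g where "g s = (LINT \<omega>|M. heat (t - s) f (Y s \<omega>)) - (LINT r:{0..s}|lborel. flux t f r)" for s
  define K where "K = 2 * C * ?d / \<eta> * (\<beta>\<^sup>2 * sqrt T) +
       \<beta> * (2 * C * ?d / \<eta> * (?c + \<beta> * sqrt T) + 8 * C * ?c ^ 5 * sqrt T / (\<eta> * sqrt \<eta>))"
  have K: "0 \<le> K" unfolding K_def using C \<beta>_nonneg t T by (intro add_nonneg_nonneg mult_nonneg_nonneg divide_nonneg_nonneg) auto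
  have "g (t - \<eta>) = g 0"
  proof (rule constant_of_small_increments[OF _ K])
    show "0 \<le> t - \<eta>" using t by simp
    fix s u assume su: "0 \<le> s" "s < u" "u \<le> t - \<eta>"
    define e where "e = u - s"
    have e: "0 < e" "e \<le> T" using su t by (auto simp: e_def)
    have eT: "e \<le> sqrt T * sqrt e" using e real_sqrt_le_mono[OF e(2)] mult_right_mono[of "sqrt e" "sqrt T" "sqrt e"] by simp
    have \<tau>: "\<eta> \<le> t - u" using su by simp
    have q: "2 * C * ?d / (t - u) \<le> 2 * C * ?d / \<eta>" using C t \<tau> by (intro divide_left_mono) auto
    have "g u - g s = (LINT \<omega>|M. heat (t - u) f (Y u \<omega>)) - (LINT \<omega>|M. heat (t - s) f (Y s \<omega>)) - (LINT r:{s..u}|lborel. flux t f r)"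
      using set_integral_Icc_split[OF su(1) less_imp_le[OF su(2)] flux_integrable(1)[OF f bd, of 0 u t]] su t by (simp add: g_def)
    then have "\<bar>g u - g s\<bar> \<le> 2 * C * ?d / (t - u) * (\<beta> * e)\<^sup>2 +
       \<beta> * (2 * C * ?d / (t - u) * (?c * sqrt e + \<beta> * e) + 8 * C * ?c ^ 5 * e / ((t - u) * sqrt (t - u))) * e"
      using duhamel_small_step[of s u t] su t by (simp add: e_def)
    also have "\<dots> \<le> 2 * C * ?d / \<eta> * (\<beta>\<^sup>2 * (e * (sqrt T * sqrt e))) +
       \<beta> * (2 * C * ?d / \<eta> * (?c * sqrt e + \<beta> * (sqrt T * sqrt e)) + 8 * C * ?c ^ 5 * (sqrt T * sqrt e) / (\<eta> * sqrt \<eta>)) * e"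
    proof (intro add_mono mult_right_mono mult_left_mono mult_mono order_refl q)
      show "(\<beta> * e)\<^sup>2 \<le> \<beta>\<^sup>2 * (e * (sqrt T * sqrt e))"
        unfolding power_mult_distrib power2_eq_square[of e] using eT e by (intro mult_left_mono) auto
      show "8 * C * ?c ^ 5 * e / ((t - u) * sqrt (t - u)) \<le> 8 * C * ?c ^ 5 * (sqrt T * sqrt e) / (\<eta> * sqrt \<eta>)"
        using C t \<tau> eT e T by (intro frac_le mult_left_mono mult_mono) auto
    qed (use C t \<tau> e T eT \<beta>_nonneg in auto)
    also have "\<dots> = K * (e * sqrt e)" by (simp add: K_def algebra_simps add_divide_distrib)
    finally show "\<bar>g u - g s\<bar> \<le> K * ((u - s) * sqrt (u - s))" by (simp add: e_def)
  qed
  moreover have "(LINT r:{0..0}|lborel. flux t f r) = 0"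
    using flux_integrable(2)[OF f bd, of 0 0 t] t by simp
  ultimately show ?thesis using t by (simp add: g_def)
qed

end

lemma heat_near_identity:
  fixes f :: "'v \<Rightarrow> real"
  assumes L: "L-lipschitz_on UNIV f" and bd: "\<And>x. \<bar>f x\<bar> \<le> C" and \<eta>: "0 \<le> \<eta>"
  shows "\<bar>heat \<eta> f x - f x\<bar> \<le> L * (sqrt DIM('v) * sqrt \<eta>)"
proof -
  have [measurable]: "f \<in> borel_measurable borel" by (rule lipschitz_on_borel_measurable[OF L])
  have L0: "0 \<le> L" by (rule lipschitz_on_nonneg[OF L])
  have "heat \<eta> f x - f x = (LINT w|gauss \<eta>. f (x + w) - f x)"
    using heat_integrable[of f C \<eta> x] bd by (simp add: heat_def gauss.prob_space[of \<eta>, simplified])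
  also have "norm \<dots> \<le> (LINT w|gauss \<eta>. L * norm (w::'v))"
  proof (rule norm_integral_le_of_bound)
    show "integrable (gauss \<eta>) (\<lambda>w::'v. L * norm w)" using \<eta> by (intro integrable_mult_right integrable_gauss_norm)
    show "AE w in gauss \<eta>. norm (f (x + w) - f x) \<le> L * norm w"
      using lipschitz_on_normD[OF L] by (intro AE_I2) (metis UNIV_I add_diff_cancel_left')
  qed
  also have "\<dots> \<le> L * (sqrt DIM('v) * sqrt \<eta>)"
    using integral_gauss_norm_le[OF \<eta>, where 'a='v] L0 by (simp add: mult_left_mono)
  finally show ?thesis by simp
qed

text \<open>
  Duhamel's formula: the law of \<open>Y\<close> solves the mild form of the Fokker-Planck equation. The
  Lipschitz property of \<open>f\<close> serves to let \<open>\<eta>\<close> tend to \<open>0\<close>, where all terms converge at the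
  rate \<open>sqrt \<eta>\<close>.
\<close>

theorem duhamel:
  fixes f :: "'v \<Rightarrow> real"
  assumes L: "L-lipschitz_on UNIV f" and bd: "\<And>x. \<bar>f x\<bar> \<le> C" and t: "0 \<le> t" "t \<le> T"
  shows "(LINT \<omega>|M. f (Y t \<omega>)) = (LINT \<omega>|M. heat t f (Y 0 \<omega>)) + (LINT r:{0..t}|lborel. flux t f r)"
proof (cases "t = 0")
  case True
  have f: "f \<in> borel_measurable borel" by (rule lipschitz_on_borel_measurable[OF L])
  have "(LINT r:{0..0}|lborel. flux 0 f r) = 0" using flux_integrable(2)[OF f bd, of 0 0 0] by simp
  then show ?thesis using True f by (simp add: heat_nonpos)
next
  case False
  with t have t: "0 < t" "t \<le> T" by auto
  have f[measurable]: "f \<in> borel_measurable borel" by (rule lipschitz_on_borel_measurable[OF L])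
  let ?c = "sqrt (real DIM('v))"
  have L0: "0 \<le> L" by (rule lipschitz_on_nonneg[OF L])
  have C: "0 \<le> C" using bd[of 0] by linarith
  define x where "x = (LINT \<omega>|M. f (Y t \<omega>)) - (LINT \<omega>|M. heat t f (Y 0 \<omega>)) - (LINT r:{0..t}|lborel. flux t f r)"
  define K where "K = L * ?c + L * (?c + \<beta> * sqrt t) + 2 * C * ?c * \<beta> * 2"
  have bound: "\<bar>x\<bar> \<le> K * sqrt \<eta>" if \<eta>: "0 < \<eta>" "\<eta> \<le> t" for \<eta>
  proof -
    define s where "s = t - \<eta>"
    have s: "0 \<le> s" "s \<le> t" using \<eta> by (auto simp: s_def)
    have i: "integrable M (\<lambda>\<omega>. f (Y r \<omega>))" for r by (rule integrable_of_bound[where C=C]) (auto simp: bd)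
    have ih: "integrable M (\<lambda>\<omega>. heat \<eta> f (Y r \<omega>))" for r by (rule integrable_of_bound[where C=C]) (auto simp: abs_heat_le[OF f bd])
    have int: "(LINT \<omega>|M. heat \<eta> f (Y s \<omega>)) = (LINT \<omega>|M. heat t f (Y 0 \<omega>)) + (LINT r:{0..s}|lborel. flux t f r)"
      unfolding s_def using \<eta> t by (intro duhamel_interior[OF f bd]) auto
    have "\<bar>(LINT \<omega>|M. heat \<eta> f (Y s \<omega>)) - (LINT \<omega>|M. f (Y s \<omega>))\<bar> = \<bar>LINT \<omega>|M. heat \<eta> f (Y s \<omega>) - f (Y s \<omega>)\<bar>"
      using i ih by simp
    also have "\<dots> \<le> L * (?c * sqrt \<eta>)"
      using norm_integral_le_const[of "\<lambda>\<omega>. heat \<eta> f (Y s \<omega>) - f (Y s \<omega>)"] heat_near_identity[OF L bd, of \<eta>] \<eta> by simp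
    finally have 1: "\<bar>(LINT \<omega>|M. heat \<eta> f (Y s \<omega>)) - (LINT \<omega>|M. f (Y s \<omega>))\<bar> \<le> L * (?c * sqrt \<eta>)" .
    have "\<bar>(LINT \<omega>|M. f (Y t \<omega>)) - (LINT \<omega>|M. f (Y s \<omega>))\<bar> = \<bar>LINT \<omega>|M. f (Y t \<omega>) - f (Y s \<omega>)\<bar>" using i by simp
    also have "\<dots> \<le> (LINT \<omega>|M. L * (norm (W t \<omega> - W s \<omega>) + \<beta> * \<eta>))"
    proof (subst real_norm_def[symmetric], rule norm_integral_le_of_bound)
      show "integrable M (\<lambda>\<omega>. L * (norm (W t \<omega> - W s \<omega>) + \<beta> * \<eta>))"
        using expectation_increment_norm(1)[OF s] by simp
      show "AE \<omega> in M. norm (f (Y t \<omega>) - f (Y s \<omega>)) \<le> L * (norm (W t \<omega> - W s \<omega>) + \<beta> * \<eta>)"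
        using integral_equation
      proof eventually_elim
        fix \<omega> assume "\<forall>s t. 0 \<le> s \<longrightarrow> s \<le> t \<longrightarrow> t \<le> T \<longrightarrow>
            Y t \<omega> - Y s \<omega> = (W t \<omega> - W s \<omega>) + (LINT r:{s..t}|lborel. b r (Y r \<omega>))"
        then have "Y t \<omega> - Y s \<omega> = (W t \<omega> - W s \<omega>) + (LINT r:{s..t}|lborel. b r (Y r \<omega>))" using s t by auto
        then have "norm (Y t \<omega> - Y s \<omega>) \<le> norm (W t \<omega> - W s \<omega>) + \<beta> * \<eta>"
          using norm_triangle_ineq[of "W t \<omega> - W s \<omega>" "LINT r:{s..t}|lborel. b r (Y r \<omega>)"] drift_integral_le[OF s(2), of \<omega>] by (simp add: s_def)
        then show "norm (f (Y t \<omega>) - f (Y s \<omega>)) \<le> L * (norm (W t \<omega> - W s \<omega>) + \<beta> * \<eta>)"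
          using lipschitz_on_normD[OF L UNIV_I UNIV_I, of "Y t \<omega>" "Y s \<omega>"] L0 by (meson mult_left_mono order_trans)
      qed
    qed
    also have "\<dots> = L * ((LINT \<omega>|M. norm (W t \<omega> - W s \<omega>)) + \<beta> * \<eta>)"
      using expectation_increment_norm(1)[OF s] by (simp add: prob_space)
    also have "\<dots> \<le> L * (?c * sqrt \<eta> + \<beta> * (sqrt t * sqrt \<eta>))"
    proof -
      have "(LINT \<omega>|M. norm (W t \<omega> - W s \<omega>)) \<le> ?c * sqrt \<eta>" using expectation_increment_norm(2)[OF s] by (simp add: s_def)
      moreover have "\<eta> \<le> sqrt t * sqrt \<eta>" using \<eta> real_sqrt_le_mono[OF \<eta>(2)] mult_right_mono[of "sqrt \<eta>" "sqrt t" "sqrt \<eta>"] by simp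
      ultimately show ?thesis using L0 \<beta>_nonneg by (intro mult_left_mono add_mono) auto
    qed
    finally have 2: "\<bar>(LINT \<omega>|M. f (Y t \<omega>)) - (LINT \<omega>|M. f (Y s \<omega>))\<bar> \<le> L * (?c * sqrt \<eta> + \<beta> * (sqrt t * sqrt \<eta>))" .
    have "(LINT r:{0..t}|lborel. flux t f r) = (LINT r:{0..s}|lborel. flux t f r) + (LINT r:{s..t}|lborel. flux t f r)"
      using s t by (intro set_integral_Icc_split flux_integrable(1)[OF f bd]) auto
    moreover have "\<bar>LINT r:{s..t}|lborel. flux t f r\<bar> \<le> 2 * C * ?c * \<beta> * (2 * sqrt \<eta>)"
      using flux_integrable(2)[OF f bd, of s t t] s by (simp add: s_def)
    ultimately have "\<bar>x\<bar> \<le> L * (?c * sqrt \<eta>) + L * (?c * sqrt \<eta> + \<beta> * (sqrt t * sqrt \<eta>)) + 2 * C * ?c * \<beta> * (2 * sqrt \<eta>)"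
      using 1 2 int unfolding x_def by linarith
    also have "\<dots> = K * sqrt \<eta>" by (simp add: K_def algebra_simps)
    finally show ?thesis .
  qed
  have "(\<lambda>n. K * sqrt (t * inverse (real (Suc n)))) \<longlonglongrightarrow> K * sqrt (t * 0)"
    by (intro tendsto_intros LIMSEQ_inverse_real_of_nat)
  then have "\<bar>x\<bar> \<le> K * sqrt (t * 0)"
  proof (rule LIMSEQ_le_const)
    have "\<bar>x\<bar> \<le> K * sqrt (t * inverse (real (Suc n)))" for n
      using t by (intro bound) (auto simp: field_simps)
    then show "\<exists>N. \<forall>n\<ge>N. \<bar>x\<bar> \<le> K * sqrt (t * inverse (real (Suc n)))" by blast
  qed
  then show ?thesis by (simp add: x_def)
qed

end

section \<open>One step of the randomized scheme\<close>

lemma preimages_comp_subset: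
  assumes Y: "Y \<in> measurable M N" and g: "g \<in> measurable N L"
  shows "preimages M (\<lambda>\<omega>. g (Y \<omega>)) L \<subseteq> preimages M Y N"
proof
  fix c assume "c \<in> preimages M (\<lambda>\<omega>. g (Y \<omega>)) L"
  then obtain A where A: "A \<in> sets L" "c = (\<lambda>\<omega>. g (Y \<omega>)) -` A \<inter> space M" by (auto simp: preimages_def)
  have "c = Y -` (g -` A \<inter> space N) \<inter> space M" using A(2) measurable_space[OF Y] by auto
  then show "c \<in> preimages M Y N" using preimages_I[OF measurable_sets[OF g A(1)]] by simp
qed

text \<open>
  The scheme for a drift which is measurable and bounded on the whole of time and space, with a
  single step size.
\<close>

locale randomized_euler =
  fixes M :: "'a measure" and W :: "real \<Rightarrow> 'a \<Rightarrow> real ^ 'n" and X0 :: "'a \<Rightarrow> real ^ 'n"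
    and b :: "real \<Rightarrow> real ^ 'n \<Rightarrow> real ^ 'n" and \<delta> :: "nat \<Rightarrow> 'a \<Rightarrow> real" and \<beta> T h :: real
  assumes bm: "brownian_motion M W"
    and X0_indep: "independent_rvs M borel X0 path_space (process_path W)"
    and b_measurable: "(\<lambda>z. b (fst z) (snd z)) \<in> borel_measurable (borel \<Otimes>\<^sub>M borel)"
    and b_bounded: "\<And>t x. norm (b t x) \<le> \<beta>"
    and h_pos: "0 < h"
    and times: "randomized_times M T h X0 W \<delta>"
begin

definition N :: nat where "N = nat \<lfloor>T / h\<rfloor>"

abbreviation "S k \<equiv> euler_scheme b h X0 W \<delta> k"

sublocale prob_space M using bm by (simp add: brownian_motion_def)

text \<open>
  The events about the random times with indices in \<open>J\<close>.
\<close>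

definition time_events :: "nat set \<Rightarrow> 'a set set" where
  "time_events J = preimages M (\<lambda>\<omega>. \<lambda>i\<in>J. \<delta> i \<omega>) (\<Pi>\<^sub>M i\<in>J. borel)"

text \<open>
  A generator, stable under intersections, of what the scheme has used when \<open>X0\<close>, the noise up to
  time \<open>s\<close> and the random times with indices in \<open>J\<close> are known.
\<close>

definition history :: "real \<Rightarrow> nat set \<Rightarrow> 'a set set" where
  "history s J = {p \<inter> e | p e. p \<in> past_events M X0 W s \<and> e \<in> time_events J}"

lemma W_measurable: "0 \<le> t \<Longrightarrow> W t \<in> borel_measurable M"
  using bm by (simp add: brownian_motion_def)

lemma X0_measurable: "X0 \<in> borel_measurable M"
  using X0_indep by (simp add: independent_rvs_def)

lemma \<delta>_indep_vars: "indep_vars (\<lambda>_. borel) \<delta> {..<N}"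
  and \<delta>_distr: "k < N \<Longrightarrow> distr M borel (\<delta> k) = uniform_measure lborel {real k * h..real (k + 1) * h}"
  and \<delta>_indep_rvs: "independent_rvs M (\<Pi>\<^sub>M k\<in>{..<N}. borel) (\<lambda>\<omega>. \<lambda>k\<in>{..<N}. \<delta> k \<omega>)
         (borel \<Otimes>\<^sub>M path_space) (\<lambda>\<omega>. (X0 \<omega>, process_path W \<omega>))"
  using times by (auto simp: randomized_times_def N_def Let_def)

lemma \<delta>_measurable: "k < N \<Longrightarrow> \<delta> k \<in> borel_measurable M"
  using \<delta>_indep_vars by (auto simp: indep_vars_def)

lemma times_measurable: "J \<subseteq> {..<N} \<Longrightarrow> (\<lambda>\<omega>. \<lambda>i\<in>J. \<delta> i \<omega>) \<in> measurable M (\<Pi>\<^sub>M i\<in>J. borel)"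
  by (rule measurable_restrict) (auto intro: \<delta>_measurable)

lemma time_events_mono:
  assumes "J \<subseteq> K" "K \<subseteq> {..<N}"
  shows "time_events J \<subseteq> time_events K"
proof -
  have "(\<lambda>\<omega>. \<lambda>i\<in>J. \<delta> i \<omega>) = (\<lambda>\<omega>. restrict (\<lambda>i\<in>K. \<delta> i \<omega>) J)" using assms by (auto simp: restrict_def fun_eq_iff)
  then show ?thesis unfolding time_events_def
    using preimages_comp_subset[OF times_measurable[OF assms(2)] measurable_restrict_subset[OF assms(1), of "\<lambda>_. borel"]] by simp
qed

lemma single_time_events:
  assumes "i \<in> J" "J \<subseteq> {..<N}"
  shows "preimages M (\<delta> i) borel \<subseteq> time_events J"
proof -
  have "\<delta> i = (\<lambda>\<omega>. (\<lambda>i\<in>J. \<delta> i \<omega>) i)" using assms by auto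
  then show ?thesis unfolding time_events_def
    using preimages_comp_subset[OF times_measurable[OF assms(2)] measurable_component_singleton[OF assms(1), of "\<lambda>_. borel"]] by simp
qed

lemma time_events_indep:
  assumes "w \<in> preimages M (\<lambda>\<omega>. (X0 \<omega>, process_path W \<omega>)) (borel \<Otimes>\<^sub>M path_space)" "e \<in> time_events J" "J \<subseteq> {..<N}"
  shows "prob (w \<inter> e) = prob w * prob e"
proof -
  have "e \<in> time_events {..<N}" using time_events_mono[OF assms(3)] assms(2) by blast
  then have "prob (e \<inter> w) = prob e * prob w"
    using \<delta>_indep_rvs assms(1) unfolding independent_rvs_iff_preimages indep_sets2_eq time_events_def by blast
  then show ?thesis by (simp add: Int_commute mult.commute)
qed

lemma path_preimages_joint: "preimages M (process_path W) path_space \<subseteq> preimages M (\<lambda>\<omega>. (X0 \<omega>, process_path W \<omega>)) (borel \<Otimes>\<^sub>M path_space)"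
  by (rule preimages_snd_Pair) (auto simp: process_path_in_space)

lemma past_events_joint: "past_events M X0 W s \<subseteq> preimages M (\<lambda>\<omega>. (X0 \<omega>, process_path W \<omega>)) (borel \<Otimes>\<^sub>M path_space)"
proof -
  have "preimages M X0 borel \<subseteq> preimages M (\<lambda>\<omega>. (X0 \<omega>, process_path W \<omega>)) (borel \<Otimes>\<^sub>M path_space)"
    by (rule preimages_fst_Pair) (auto simp: process_path_in_space)
  then show ?thesis
    using path_preimages_joint past_cylinders_path_preimages[of M W s] Int_stableD[OF Int_stable_preimages]
    unfolding past_events_def by blast
qed

lemma time_events_subset: "J \<subseteq> {..<N} \<Longrightarrow> time_events J \<subseteq> events"
  unfolding time_events_def by (intro preimages_subset times_measurable)

lemma joint_preimages_subset: "preimages M (\<lambda>\<omega>. (X0 \<omega>, process_path W \<omega>)) (borel \<Otimes>\<^sub>M path_space) \<subseteq> events"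
  using \<delta>_indep_rvs by (intro preimages_subset) (simp add: independent_rvs_def)

lemma past_events_subset: "past_events M X0 W s \<subseteq> events"
  using past_events_joint joint_preimages_subset by blast

lemma Int_stable_history: "Int_stable (history s J)"
  unfolding history_def time_events_def by (intro Int_stable_pairwise_Int Int_stable_past_events Int_stable_preimages)

text \<open>
  The current random time \<open>\<delta> k\<close> may belong to the history: the random times are independent of the
  whole path.
\<close>

lemma history_indep_increment:
  assumes k: "k < N"
  shows "indep_set (history (real k * h) {..k}) (preimages M (\<lambda>\<omega>. W (real (k + 1) * h) \<omega> - W (real k * h) \<omega>) borel)"
  unfolding history_def
proof (rule indep_set_Int_third)
  have t: "0 \<le> real k * h" "real k * h \<le> real (k + 1) * h" using h_pos by auto
  show "indep_set (past_events M X0 W (real k * h)) (preimages M (\<lambda>\<omega>. W (real (k + 1) * h) \<omega> - W (real k * h) \<omega>) borel)"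
    by (rule past_events_indep_increment[OF bm X0_indep t])
  show "time_events {..k} \<subseteq> events" using k by (intro time_events_subset) auto
  show "space M \<in> preimages M (\<lambda>\<omega>. W (real (k + 1) * h) \<omega> - W (real k * h) \<omega>) borel"
    using t by (intro space_in_preimages borel_measurable_diff W_measurable) auto
  fix a c d assume a: "a \<in> past_events M X0 W (real k * h)"
    and c: "c \<in> preimages M (\<lambda>\<omega>. W (real (k + 1) * h) \<omega> - W (real k * h) \<omega>) borel" and d: "d \<in> time_events {..k}"
  have "c \<in> preimages M (process_path W) path_space"
    using increment_path_preimages[of "real k * h" "real (k + 1) * h" M W] c t by auto
  then have "a \<inter> c \<in> preimages M (\<lambda>\<omega>. (X0 \<omega>, process_path W \<omega>)) (borel \<Otimes>\<^sub>M path_space)"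
    using a past_events_joint path_preimages_joint by (intro Int_stableD[OF Int_stable_preimages]) auto
  then show "prob (a \<inter> c \<inter> d) = prob (a \<inter> c) * prob d"
    using d k by (intro time_events_indep) auto
qed

lemma history_indep_time:
  assumes k: "k < N"
  shows "indep_set (history s {..<k}) (preimages M (\<delta> k) borel)"
proof -
  have swap: "history s {..<k} = {e \<inter> p | e p. e \<in> time_events {..<k} \<and> p \<in> past_events M X0 W s}"
    unfolding history_def by (auto simp: Int_commute)
  show ?thesis unfolding swap
  proof (rule indep_set_Int_third)
    have iv: "indep_var (PiM {..<k} (\<lambda>_. borel)) (\<lambda>\<omega>. restrict (\<lambda>i. \<delta> i \<omega>) {..<k}) (PiM {k} (\<lambda>_. borel)) (\<lambda>\<omega>. restrict (\<lambda>i. \<delta> i \<omega>) {k})"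
      using k by (intro indep_var_restrict[OF \<delta>_indep_vars]) auto
    have "independent_rvs M (PiM {..<k} (\<lambda>_. borel)) (\<lambda>\<omega>. restrict (\<lambda>i. \<delta> i \<omega>) {..<k}) (PiM {k} (\<lambda>_. borel)) (\<lambda>\<omega>. restrict (\<lambda>i. \<delta> i \<omega>) {k})"
      using iv independent_rvs_same_type[OF prob_space_axioms] by blast
    then have "indep_set (time_events {..<k}) (time_events {k})"
      unfolding independent_rvs_iff_preimages time_events_def by simp
    moreover have "preimages M (\<delta> k) borel \<subseteq> time_events {k}" using k by (intro single_time_events) auto
    ultimately show "indep_set (time_events {..<k}) (preimages M (\<delta> k) borel)" unfolding indep_sets2_eq by blast
    show "past_events M X0 W s \<subseteq> events" by (rule past_events_subset)
    show "space M \<in> preimages M (\<delta> k) borel" using k by (intro space_in_preimages \<delta>_measurable)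
    fix a c d assume a: "a \<in> time_events {..<k}" and c: "c \<in> preimages M (\<delta> k) borel" and d: "d \<in> past_events M X0 W s"
    have kk: "{..<k} \<subseteq> {..k}" "{..k} \<subseteq> {..<N}" using k by auto
    have "a \<in> time_events {..k}" using a time_events_mono[OF kk] by blast
    moreover have "c \<in> time_events {..k}" using c single_time_events[OF _ kk(2), of k] by blast
    ultimately have "a \<inter> c \<in> time_events {..k}" unfolding time_events_def by (intro Int_stableD[OF Int_stable_preimages])
    then have "prob (d \<inter> (a \<inter> c)) = prob d * prob (a \<inter> c)"
      using d past_events_joint k by (intro time_events_indep) auto
    then show "prob (a \<inter> c \<inter> d) = prob (a \<inter> c) * prob d" by (simp add: Int_commute mult.commute)
  qed
qed

lemma history_generators:
  assumes J: "J \<subseteq> {..<N}"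
  shows "preimages M X0 borel \<subseteq> history s J"
    and "0 \<le> r \<Longrightarrow> r \<le> s \<Longrightarrow> preimages M (W r) borel \<subseteq> history s J"
    and "i \<in> J \<Longrightarrow> preimages M (\<delta> i) borel \<subseteq> history s J"
    and "history s J \<subseteq> events"
proof -
  have spJ: "space M \<in> time_events J" unfolding time_events_def using J by (intro space_in_preimages times_measurable)
  have spP: "space M \<in> past_events M X0 W s"
    using past_generators(1)[OF X0_measurable] space_in_preimages[OF X0_measurable] by blast
  have 1: "past_events M X0 W s \<subseteq> history s J"
  proof
    fix p assume p: "p \<in> past_events M X0 W s"
    then have "p = p \<inter> space M" using past_events_subset sets.sets_into_space by blast
    then show "p \<in> history s J" unfolding history_def using p spJ by blast
  qed
  have 2: "time_events J \<subseteq> history s J"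
  proof
    fix e assume e: "e \<in> time_events J"
    then have "e = space M \<inter> e" using time_events_subset[OF J] sets.sets_into_space by blast
    then show "e \<in> history s J" unfolding history_def using e spP by blast
  qed
  show "preimages M X0 borel \<subseteq> history s J" using past_generators(1)[OF X0_measurable] 1 by blast
  show "0 \<le> r \<Longrightarrow> r \<le> s \<Longrightarrow> preimages M (W r) borel \<subseteq> history s J" using past_generators(2)[OF X0_measurable] 1 by blast
  show "i \<in> J \<Longrightarrow> preimages M (\<delta> i) borel \<subseteq> history s J" using single_time_events[OF _ J] 2 by blast
  show "history s J \<subseteq> events" unfolding history_def using past_events_subset time_events_subset[OF J] by blast
qed

lemma history_Pow: "J \<subseteq> {..<N} \<Longrightarrow> history s J \<subseteq> Pow (space M)"
  using history_generators(4) sets.space_closed by blast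

lemma scheme_history_measurable:
  assumes "real k * h \<le> s" "{..<k} \<subseteq> J" "J \<subseteq> {..<N}"
  shows "S k \<in> borel_measurable (sigma (space M) (history s J))"
  using assms
proof (induction k)
  case 0
  then show ?case
    by (simp, intro measurable_sigma_preimages X0_measurable history_generators(1) history_Pow) auto
next
  case (Suc k)
  let ?G = "sigma (space M) (history s J)"
  have kh: "real k * h \<le> s" using Suc.prems(1) h_pos by (simp add: distrib_right)
  have G: "history s J \<subseteq> Pow (space M)" by (rule history_Pow[OF Suc.prems(3)])
  have [measurable]: "S k \<in> borel_measurable ?G"
  proof (rule Suc.IH[OF kh _ Suc.prems(3)])
    show "{..<k} \<subseteq> J" using Suc.prems(2) by auto
  qed
  have [measurable]: "W (real (k + 1) * h) \<in> borel_measurable ?G" "W (real k * h) \<in> borel_measurable ?G"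
    using Suc.prems kh h_pos by (intro measurable_sigma_preimages W_measurable history_generators(2) G; simp)+
  have [measurable]: "\<delta> k \<in> borel_measurable ?G"
    using Suc.prems by (intro measurable_sigma_preimages \<delta>_measurable history_generators(3) G) auto
  have [measurable]: "(\<lambda>\<omega>. b (\<delta> k \<omega>) (S k \<omega>)) \<in> borel_measurable ?G"
    using measurable_compose[OF measurable_Pair[of "\<delta> k" ?G borel "S k" borel] b_measurable] by simp
  have "(\<lambda>\<omega>. S k \<omega> + (W (real (k + 1) * h) \<omega> - W (real k * h) \<omega>) + h *\<^sub>R b (\<delta> k \<omega>) (S k \<omega>)) \<in> borel_measurable ?G"
    by measurable
  then show ?case by simp
qed

lemma scheme_measurable:
  assumes "k \<le> N" shows "S k \<in> borel_measurable M"
proof -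
  let ?H = "history (real k * h) {..<k}"
  have sub: "{..<k} \<subseteq> {..<N}" using assms by auto
  have m: "S k \<in> borel_measurable (sigma (space M) ?H)"
    using assms by (intro scheme_history_measurable) auto
  show ?thesis
  proof (rule measurableI)
    show "S k -` A \<inter> space M \<in> events" if "A \<in> sets borel" for A
      using measurable_sets[OF m that] history_generators(4)[OF sub] sets.sigma_sets_subset[OF history_generators(4)[OF sub]]
        history_Pow[OF sub, of "real k * h"]
      by (auto simp: space_measure_of_conv sets_measure_of)
  qed simp
qed

lemma integral_uniform_time:
  fixes g :: "real \<Rightarrow> real"
  assumes [measurable]: "g \<in> borel_measurable borel"
  shows "(LINT r|uniform_measure lborel {real k * h..real (k + 1) * h}. g r) = (LINT r:{real k * h..real (k + 1) * h}|lborel. g r) / h"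
proof -
  let ?A = "{real k * h..real (k + 1) * h}"
  have "emeasure lborel ?A = ennreal h" using h_pos by (simp add: algebra_simps)
  then have "uniform_measure lborel ?A = density lborel (\<lambda>r. ennreal (indicator ?A r / h))"
    unfolding uniform_measure_def using h_pos
    by (intro density_cong) (auto split: split_indicator simp: divide_ennreal simp flip: ennreal_1)
  then have "(LINT r|uniform_measure lborel ?A. g r) = (LINT r|lborel. (indicator ?A r / h) *\<^sub>R g r)"
    using h_pos by (simp add: integral_density)
  then show ?thesis by (simp add: set_lebesgue_integral_def)
qed

text \<open>
  Averaging over the Gaussian increment turns \<open>f\<close> into \<open>heat h f\<close>. Averaging over \<open>\<delta> k\<close>, which
  is independent of the current state, then replaces the drift at a random time by an average over
  the whole step. This is where the randomization of time acts: the drift enters in the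
  same way as in the Duhamel formula for the solution, without any regularity in time.
\<close>

lemma scheme_step:
  fixes f :: "real ^ 'n \<Rightarrow> real"
  assumes k: "k < N" and f[measurable]: "f \<in> borel_measurable borel" and bd: "\<And>x. \<bar>f x\<bar> \<le> C"
  shows "(LINT \<omega>|M. f (S (Suc k) \<omega>)) =
     (LINT r:{real k * h..real (k + 1) * h}|lborel. LINT \<omega>|M. heat h f (S k \<omega> + h *\<^sub>R b r (S k \<omega>))) / h"
proof -
  let ?s = "real k * h" and ?u = "real (k + 1) * h"
  let ?\<Delta> = "\<lambda>\<omega>. W ?u \<omega> - W ?s \<omega>"
  have su: "0 \<le> ?s" "?s < ?u" using h_pos by auto
  have \<Delta>: "?\<Delta> \<in> borel_measurable M" using su by (intro borel_measurable_diff W_measurable) auto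
  have \<Delta>': "?\<Delta> \<in> borel_measurable (sigma (space M) (preimages M ?\<Delta> borel))"
    using preimages_subset[OF \<Delta>] sets.space_closed[of M] by (intro measurable_sigma_preimages \<Delta>) auto
  have \<delta>k: "\<delta> k \<in> borel_measurable M" using k by (rule \<delta>_measurable)
  have "S k \<in> borel_measurable (sigma (space M) (history ?s {..k}))"
    using k by (intro scheme_history_measurable) auto
  moreover have "\<delta> k \<in> borel_measurable (sigma (space M) (history ?s {..k}))"
    using k by (intro measurable_sigma_preimages \<delta>k history_generators(3) history_Pow) auto
  ultimately have pair: "(\<lambda>\<omega>. (S k \<omega>, \<delta> k \<omega>)) \<in> measurable (sigma (space M) (history ?s {..k})) (borel \<Otimes>\<^sub>M borel)"
    by (rule measurable_Pair)
  have ind1: "independent_rvs M (borel \<Otimes>\<^sub>M borel) (\<lambda>\<omega>. (S k \<omega>, \<delta> k \<omega>)) borel ?\<Delta>"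
    by (rule independent_rvs_of_generators[OF history_indep_increment[OF k] Int_stable_history Int_stable_preimages pair \<Delta>'])
  have ind2: "independent_rvs M borel (S k) borel (\<delta> k)"
  proof (rule independent_rvs_of_generators[OF history_indep_time[OF k] Int_stable_history Int_stable_preimages])
    show "S k \<in> borel_measurable (sigma (space M) (history ?s {..<k}))"
      using k by (intro scheme_history_measurable) auto
    show "\<delta> k \<in> borel_measurable (sigma (space M) (preimages M (\<delta> k) borel))"
      using preimages_subset[OF \<delta>k] sets.space_closed[of M] by (intro measurable_sigma_preimages \<delta>k) auto
  qed
  have bmeas[measurable (raw)]: "(\<lambda>z. b (p z) (q z)) \<in> borel_measurable L" if "p \<in> borel_measurable L" "q \<in> borel_measurable L" for p q and L :: "'z measure"
    using measurable_compose[OF measurable_Pair[OF that] b_measurable] by simp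
  define F where "F z = (case z of ((x, r), w) \<Rightarrow> f (x + w + h *\<^sub>R b r x))" for z
  have F: "F \<in> borel_measurable ((borel \<Otimes>\<^sub>M borel) \<Otimes>\<^sub>M borel)"
    unfolding F_def[abs_def] split_beta by measurable
  define G where "G z = (case z of (x, r) \<Rightarrow> heat h f (x + h *\<^sub>R b r x))" for z
  have G: "G \<in> borel_measurable (borel \<Otimes>\<^sub>M borel)"
    unfolding G_def[abs_def] split_beta by measurable
  have "(LINT \<omega>|M. f (S (Suc k) \<omega>)) = (LINT \<omega>|M. F ((S k \<omega>, \<delta> k \<omega>), ?\<Delta> \<omega>))" by (simp add: F_def)
  also have "\<dots> = (LINT \<omega>|M. LINT w|distr M borel ?\<Delta>. F ((S k \<omega>, \<delta> k \<omega>), w))"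
    by (rule indep_integral(1)[OF ind1 F, where C=C]) (auto simp: F_def bd split: prod.split)
  also have "distr M borel ?\<Delta> = gauss h"
    using brownian_increment_distr[OF bm su] by (simp add: algebra_simps)
  also have "(LINT \<omega>|M. LINT w|gauss h. F ((S k \<omega>, \<delta> k \<omega>), w)) = (LINT \<omega>|M. G (S k \<omega>, \<delta> k \<omega>))"
    by (simp add: F_def G_def heat_def add_ac)
  also have "\<dots> = (LINT r|distr M borel (\<delta> k). LINT \<omega>|M. G (S k \<omega>, r))"
    by (rule indep_integral(2)[OF ind2 G, where C=C]) (auto simp: G_def abs_heat_le[OF f bd] split: prod.split)
  also have "\<dots> = (LINT r:{?s..?u}|lborel. LINT \<omega>|M. G (S k \<omega>, r)) / h"
  proof (subst \<delta>_distr[OF k], rule integral_uniform_time)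
    have [measurable]: "S k \<in> borel_measurable M" using k by (intro scheme_measurable) simp
    note [measurable] = G
    show "(\<lambda>r. LINT \<omega>|M. G (S k \<omega>, r)) \<in> borel_measurable borel" by measurable
  qed
  finally show ?thesis by (simp add: G_def)
qed

end

section \<open>Sums and a singular Gronwall inequality\<close>

text \<open>
  The sums of powers in this section are compared with telescoping sums.
\<close>

lemma sum_inverse_sqrt_le: "(\<Sum>i<K. 1 / sqrt (real (Suc i))) \<le> 2 * sqrt (real K)"
proof (induction K)
  case (Suc K)
  define a b where "a = sqrt (real (Suc K))" and "b = sqrt (real K)"
  have ab: "0 < a" "0 \<le> b" "b \<le> a" "a\<^sup>2 - b\<^sup>2 = 1" by (auto simp: a_def b_def)
  have "1 = (a - b) * (a + b)" using ab(4) by (simp add: algebra_simps power2_eq_square)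
  also have "\<dots> \<le> (a - b) * (2 * a)" using ab by (intro mult_left_mono) auto
  finally have "1 / a \<le> 2 * (a - b)" using ab(1) by (simp add: field_simps)
  with Suc show ?case by (simp add: a_def b_def del: of_nat_Suc)
qed simp

lemma sum_inverse_three_quarters_le:
  "(\<Sum>i<K. 1 / sqrt (sqrt (real (Suc i))) ^ 3) \<le> 4 * sqrt (sqrt (real K))"
proof (induction K)
  case (Suc K)
  define a b where "a = sqrt (sqrt (real (Suc K)))" and "b = sqrt (sqrt (real K))"
  have ab: "0 < a" "0 \<le> b" "b \<le> a" by (auto simp: a_def b_def)
  have "a ^ 4 = real (Suc K)" "b ^ 4 = real K"
    by (simp_all add: a_def b_def power4_eq_xxxx flip: mult.assoc) (simp_all add: mult.assoc)
  then have "1 = a ^ 4 - b ^ 4" by simp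
  also have "\<dots> = (a - b) * (a ^ 3 + a\<^sup>2 * b + a * b\<^sup>2 + b ^ 3)"
    by (simp add: algebra_simps power2_eq_square power3_eq_cube power4_eq_xxxx)
  also have "\<dots> \<le> (a - b) * (a ^ 3 + a\<^sup>2 * a + a * a\<^sup>2 + a ^ 3)"
    using ab by (intro mult_left_mono add_mono power_mono order_refl) auto
  also have "\<dots> = (a - b) * (4 * a ^ 3)" by (simp add: power2_eq_square power3_eq_cube)
  finally have "1 \<le> (4 * (a - b)) * a ^ 3" by (simp only: mult_ac)
  then have "1 / a ^ 3 \<le> 4 * (a - b)" using ab(1) by (simp only: pos_divide_le_eq zero_less_power)
  with Suc show ?case by (simp add: a_def b_def del: of_nat_Suc)
qed simp

lemma sum_inverse_three_halves_le: "(\<Sum>k\<in>{1..<K}. 1 / (real k * sqrt (real k))) \<le> 3"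
proof -
  have "(\<Sum>k\<in>{1..<Suc (Suc n)}. 1 / (real k * sqrt (real k))) \<le> 3 - 2 / sqrt (real (Suc n))" for n
  proof (induction n)
    case (Suc n)
    define a b where "a = sqrt (real (Suc (Suc n)))" and "b = sqrt (real (Suc n))"
    have ab: "0 < a" "0 < b" "b \<le> a" "a\<^sup>2 - b\<^sup>2 = 1" by (auto simp: a_def b_def)
    have e: "real (Suc (Suc n)) = a\<^sup>2" by (simp add: a_def)
    have "1 = (a - b) * (a + b)" using ab(4) by (simp add: algebra_simps power2_eq_square)
    also have "\<dots> \<le> (a - b) * (2 * a)" using ab by (intro mult_left_mono) auto
    finally have "b \<le> 2 * (a - b) * a * a"
      using mult_mono[of 1 "(a - b) * (2 * a)" b a] ab by (simp add: mult_ac)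
    then have "b / (a\<^sup>2 * a * b) \<le> 2 * (a - b) * a * a / (a\<^sup>2 * a * b)"
      using ab by (intro divide_right_mono) auto
    then have "1 / (a\<^sup>2 * a) \<le> 2 * (a - b) / (a * b)" using ab(1,2) by (simp add: power2_eq_square)
    also have "\<dots> = 2 / b - 2 / a" using ab(1,2) by (simp add: field_simps)
    finally have "1 / (real (Suc (Suc n)) * sqrt (real (Suc (Suc n)))) \<le> 2 / b - 2 / a" unfolding e using ab by simp
    moreover have "(\<Sum>k\<in>{1..<Suc (Suc (Suc n))}. 1 / (real k * sqrt (real k))) =
        (\<Sum>k\<in>{1..<Suc (Suc n)}. 1 / (real k * sqrt (real k))) + 1 / (real (Suc (Suc n)) * sqrt (real (Suc (Suc n))))"
      by (subst sum.atLeastLessThan_Suc) auto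
    ultimately show ?case using Suc unfolding a_def[symmetric] b_def[symmetric] by linarith
  qed simp
  note * = this
  show ?thesis
  proof (cases "K < 2")
    case True then have "{1..<K} = {}" by auto then show ?thesis by simp
  next
    case False
    then have "K = Suc (Suc (K - 2))" by simp
    then obtain n where n: "K = Suc (Suc n)" by blast
    have "0 \<le> 2 / sqrt (real (Suc n))" by simp
    then show ?thesis unfolding n using *[of n] by linarith
  qed
qed

text \<open>
  Each term is at most the power \<open>- 3 / 2\<close> of the smaller one of \<open>k\<close> and \<open>K - k\<close>, and these
  powers are summable.
\<close>

lemma sum_inverse_cross_le: "(\<Sum>k\<in>{1..<K}. 1 / (real k * sqrt (real (K - k)))) \<le> 6"
proof -
  have "(\<Sum>k\<in>{1..<K}. 1 / (real k * sqrt (real (K - k)))) \<le>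
     (\<Sum>k\<in>{1..<K}. 1 / (real k * sqrt (real k)) + 1 / (real (K - k) * sqrt (real (K - k))))"
  proof (rule sum_mono)
    fix k assume "k \<in> {1..<K}"
    then have k: "1 \<le> k" "1 \<le> K - k" by auto
    show "1 / (real k * sqrt (real (K - k))) \<le> 1 / (real k * sqrt (real k)) + 1 / (real (K - k) * sqrt (real (K - k)))"
    proof (cases "k \<le> K - k")
      case True
      have "1 / (real k * sqrt (real (K - k))) \<le> 1 / (real k * sqrt (real k))"
        using k True by (intro divide_left_mono mult_left_mono) auto
      moreover have "0 \<le> 1 / (real (K - k) * sqrt (real (K - k)))" by simp
      ultimately show ?thesis by (rule add_increasing2[rotated])
    next
      case False
      have "1 / (real k * sqrt (real (K - k))) \<le> 1 / (real (K - k) * sqrt (real (K - k)))"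
        using k False by (intro divide_left_mono mult_right_mono) auto
      moreover have "0 \<le> 1 / (real k * sqrt (real k))" by simp
      ultimately show ?thesis by (rule add_increasing[rotated])
    qed
  qed
  also have "\<dots> = (\<Sum>k\<in>{1..<K}. 1 / (real k * sqrt (real k))) + (\<Sum>k\<in>{1..<K}. 1 / (real (K - k) * sqrt (real (K - k))))"
    by (rule sum.distrib)
  also have "(\<Sum>k\<in>{1..<K}. 1 / (real (K - k) * sqrt (real (K - k)))) = (\<Sum>k\<in>{1..<K}. 1 / (real k * sqrt (real k)))"
    by (subst (2) sum.atLeastLessThan_rev) simp
  finally show ?thesis using sum_inverse_three_halves_le[of K] by linarith
qed

lemma sum_diff_reindex: "(\<Sum>k<K. F (K - k)) = (\<Sum>i<K. F (Suc i))" for F :: "nat \<Rightarrow> 'a::comm_monoid_add"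
proof -
  have "(\<Sum>k<K. F (K - k)) = (\<Sum>k<K. F (Suc (K - Suc k)))"
    by (intro sum.cong refl arg_cong[where f=F]) auto
  also have "\<dots> = (\<Sum>i<K. F (Suc i))" by (rule sum.nat_diff_reindex)
  finally show ?thesis .
qed

text \<open>
  The power \<open>1 / 4\<close> is a compromise: it leaves the kernel \<open>j powr (- 1 / 2)\<close> of the Gronwall
  inequality summable up to \<open>K\<close> at the rate \<open>K powr (1 / 4)\<close>, and it still provides a negative
  power of the exponential rate.
\<close>

lemma exp_minus_le_inverse_fourth_root: "0 < x \<Longrightarrow> exp (- x) \<le> 1 / sqrt (sqrt x)"
proof -
  assume x: "0 < x"
  have "x \<le> exp x" using exp_ge_add_one_self[of x] by linarith
  also have "\<dots> \<le> exp (4 * x)" using x by simp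
  also have "\<dots> = ((exp x)\<^sup>2)\<^sup>2" by (simp flip: exp_of_nat_mult power_mult)
  finally have "sqrt (sqrt x) \<le> exp x" using x by (intro real_le_lsqrt) auto
  then show ?thesis using x by (simp add: exp_minus field_simps)
qed

text \<open>
  Discrete Gronwall inequality with the weakly singular kernel \<open>1 / sqrt (K - k)\<close>. By induction
  \<open>e k \<le> 2 A exp (\<kappa> h k)\<close>: for a large rate \<open>\<kappa>\<close> the exponential weight brings the total mass
  of the kernel below one half, so that the sum is absorbed. The point is that the bound does not
  depend on \<open>h\<close>.
\<close>

lemma singular_gronwall:
  fixes e :: "nat \<Rightarrow> real"
  assumes h: "0 < h" and A: "0 \<le> A" and a: "0 \<le> a" and T: "real N * h \<le> T"
    and rec: "\<And>K. K \<le> N \<Longrightarrow> e K \<le> A + a * sqrt h * (\<Sum>k<K. e k / sqrt (real (K - k)))"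
    and K: "K \<le> N"
  shows "e K \<le> 2 * A * exp (T\<^sup>2 * (8 * a + 1) ^ 4)"
proof (cases "K = 0")
  case True
  have "e 0 \<le> A" using rec[of 0] by simp
  also have "A \<le> 2 * A * exp (T\<^sup>2 * (8 * a + 1) ^ 4)"
    using mult_left_mono[of 1 "2 * exp (T\<^sup>2 * (8 * a + 1) ^ 4)" A] A by (simp add: order_trans[of 1 "2::real"])
  finally show ?thesis using True by simp
next
  case False
  then have "N > 0" using K by simp
  then have "0 < T" using h T mult_pos_pos[of "real N" h] by linarith
  \<comment> \<open>with this rate the total mass of the weighted kernel is at most one half, see \<open>kernel\<close>\<close>
  define \<kappa> where "\<kappa> = T * (8 * a + 1) ^ 4"
  have \<kappa>: "\<kappa> > 0" using \<open>0 < T\<close> a by (simp add: \<kappa>_def add_nonneg_pos)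
  have kernel: "a * sqrt h * (\<Sum>i<K. exp (- (\<kappa> * h * real (Suc i))) / sqrt (real (Suc i))) \<le> 1 / 2" if "K \<le> N" for K
  proof -
    define r where "r = sqrt (sqrt (\<kappa> * h))"
    have r: "r > 0" using \<kappa> h by (simp add: r_def)
    have "(\<Sum>i<K. exp (- (\<kappa> * h * real (Suc i))) / sqrt (real (Suc i))) \<le> (\<Sum>i<K. (1 / r) * (1 / sqrt (sqrt (real (Suc i))) ^ 3))"
    proof (rule sum_mono)
      fix i :: nat
      define q where "q = sqrt (sqrt (real (Suc i)))"
      have q: "q > 0" "sqrt (real (Suc i)) = q\<^sup>2" by (auto simp: q_def)
      have "exp (- (\<kappa> * h * real (Suc i))) \<le> 1 / (r * q)"
        using exp_minus_le_inverse_fourth_root[of "\<kappa> * h * real (Suc i)"] \<kappa> h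
        by (simp add: r_def q_def real_sqrt_mult del: of_nat_Suc)
      then have "exp (- (\<kappa> * h * real (Suc i))) / sqrt (real (Suc i)) \<le> 1 / (r * q) / q\<^sup>2"
        unfolding q(2) by (intro divide_right_mono) auto
      also have "\<dots> = 1 / r * (1 / q ^ 3)" by (simp add: power2_eq_square power3_eq_cube)
      finally show "exp (- (\<kappa> * h * real (Suc i))) / sqrt (real (Suc i)) \<le> 1 / r * (1 / sqrt (sqrt (real (Suc i))) ^ 3)"
        by (simp only: q_def)
    qed
    also have "\<dots> \<le> 1 / r * (4 * sqrt (sqrt (real K)))"
      unfolding sum_distrib_left[symmetric] using r by (intro mult_left_mono sum_inverse_three_quarters_le) auto
    finally have "a * sqrt h * (\<Sum>i<K. exp (- (\<kappa> * h * real (Suc i))) / sqrt (real (Suc i))) \<le>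
        a * sqrt h * (1 / r * (4 * sqrt (sqrt (real K))))"
      using a h by (intro mult_left_mono) auto
    also have "\<dots> = 4 * a * sqrt (sqrt (real K * h / \<kappa>))"
    proof -
      define z where "z = sqrt (sqrt h)"
      have z: "z > 0" using h by (simp add: z_def)
      have zz: "sqrt h = z * z" using h by (simp add: z_def)
      have rz: "r = sqrt (sqrt \<kappa>) * z" by (simp add: r_def z_def real_sqrt_mult)
      have kz: "sqrt (sqrt (real K * h / \<kappa>)) = sqrt (sqrt (real K)) * z / sqrt (sqrt \<kappa>)"
        by (simp add: z_def real_sqrt_mult real_sqrt_divide)
      show ?thesis unfolding rz kz zz using z by simp
    qed
    also have "\<dots> \<le> 4 * a * sqrt (sqrt (1 / (8 * a + 1) ^ 4))"
    proof -
      have "real K * h \<le> real N * h" using that h by (intro mult_right_mono) auto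
      then have "real K * h / \<kappa> \<le> T / \<kappa>" using T \<kappa> by (intro divide_right_mono) auto
      also have "\<dots> = 1 / (8 * a + 1) ^ 4" using \<open>0 < T\<close> by (simp add: \<kappa>_def)
      finally show ?thesis using a by (intro mult_left_mono real_sqrt_le_mono) auto
    qed
    also have "sqrt (sqrt (1 / (8 * a + 1) ^ 4)) = 1 / (8 * a + 1)"
    proof -
      have "sqrt (1 / (8 * a + 1) ^ 4) = (1 / (8 * a + 1))\<^sup>2"
        by (rule real_sqrt_unique) (simp_all add: power_divide)
      moreover have "sqrt ((1 / (8 * a + 1))\<^sup>2) = 1 / (8 * a + 1)"
        by (rule real_sqrt_unique) (use a in auto)
      ultimately show ?thesis by (simp only:)
    qed
    also have "4 * a * (1 / (8 * a + 1)) \<le> 1 / 2" using a by (simp add: field_simps add_nonneg_pos)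
    finally show ?thesis .
  qed
  have "e K \<le> 2 * A * exp (\<kappa> * h * real K)" if "K \<le> N" for K
    using that
  proof (induction K rule: less_induct)
    case (less K)
    let ?E = "\<lambda>k. exp (\<kappa> * h * real k)"
    have "e K \<le> A + a * sqrt h * (\<Sum>k<K. e k / sqrt (real (K - k)))" using rec less by simp
    also have "\<dots> \<le> A + a * sqrt h * (\<Sum>k<K. 2 * A * ?E k / sqrt (real (K - k)))"
      using a h less by (intro add_mono mult_left_mono sum_mono divide_right_mono) auto
    also have "(\<Sum>k<K. 2 * A * ?E k / sqrt (real (K - k))) =
        (\<Sum>k<K. 2 * A * ?E K * (exp (- (\<kappa> * h * real (K - k))) / sqrt (real (K - k))))"
    proof (intro sum.cong refl)
      fix k assume "k \<in> {..<K}"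
      then have "?E k = ?E K * exp (- (\<kappa> * h * real (K - k)))"
        by (simp add: exp_add[symmetric] of_nat_diff algebra_simps)
      then show "2 * A * ?E k / sqrt (real (K - k)) = 2 * A * ?E K * (exp (- (\<kappa> * h * real (K - k))) / sqrt (real (K - k)))"
        by simp
    qed
    also have "\<dots> = 2 * A * ?E K * (\<Sum>i<K. exp (- (\<kappa> * h * real (Suc i))) / sqrt (real (Suc i)))"
      unfolding sum_distrib_left[symmetric]
      by (subst sum_diff_reindex[where F="\<lambda>j. exp (- (\<kappa> * h * real j)) / sqrt (real j)"]) (rule refl)
    also have "A + a * sqrt h * (2 * A * ?E K * (\<Sum>i<K. exp (- (\<kappa> * h * real (Suc i))) / sqrt (real (Suc i)))) =
       A + 2 * A * ?E K * (a * sqrt h * (\<Sum>i<K. exp (- (\<kappa> * h * real (Suc i))) / sqrt (real (Suc i))))"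
      by (simp only: mult_ac)
    also have "\<dots> \<le> A + 2 * A * ?E K * (1 / 2)"
      using kernel[OF less.prems] A by (intro add_left_mono mult_left_mono) auto
    also have "\<dots> \<le> A * ?E K + A * ?E K"
      using A \<kappa> h mult_left_mono[of 1 "?E K" A] by simp
    finally show ?case by simp
  qed
  from this[OF K] have "e K \<le> 2 * A * exp (\<kappa> * (h * real K))" by (simp add: mult.assoc)
  also have "\<dots> \<le> 2 * A * exp (\<kappa> * T)"
  proof -
    have "h * real K \<le> real N * h" using K h by (simp add: mult.commute)
    then show ?thesis using A \<kappa> T by (intro mult_left_mono) auto
  qed
  also have "\<kappa> * T = T\<^sup>2 * (8 * a + 1) ^ 4" by (simp add: \<kappa>_def power2_eq_square)
  finally show ?thesis .
qed

section \<open>Expansion of the scheme\<close>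

context prob_space
begin

context
  fixes U V :: "'a \<Rightarrow> 'v::euclidean_space"
  assumes U[measurable]: "U \<in> borel_measurable M" and V[measurable]: "V \<in> borel_measurable M"
begin

private abbreviation (input) "tv \<equiv> tv_norm_diff (distr M borel U) (distr M borel V)"

lemma expectation_diff_le_two:
  assumes \<phi>[measurable]: "\<phi> \<in> borel_measurable borel" and bd: "\<And>x. \<bar>\<phi> x\<bar> \<le> 1"
  shows "(LINT \<omega>|M. \<phi> (U \<omega>)) - (LINT \<omega>|M. \<phi> (V \<omega>)) \<le> (2::real)"
proof -
  have "\<bar>LINT \<omega>|M. \<phi> (U \<omega>)\<bar> \<le> 1" "\<bar>LINT \<omega>|M. \<phi> (V \<omega>)\<bar> \<le> 1"
    using norm_integral_le_const[of "\<lambda>\<omega>. \<phi> (U \<omega>)" 1] norm_integral_le_const[of "\<lambda>\<omega>. \<phi> (V \<omega>)" 1] bd by auto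
  then show ?thesis by linarith
qed

text \<open>
  The supremum in the definition is bounded, by \<open>2\<close>, so it is an upper bound.
\<close>

lemma tv_norm_diff_upper:
  assumes \<phi>: "\<phi> \<in> borel_measurable borel" and bd: "\<And>x. \<bar>\<phi> x\<bar> \<le> 1"
  shows "(LINT \<omega>|M. \<phi> (U \<omega>)) - (LINT \<omega>|M. \<phi> (V \<omega>)) \<le> tv"
proof -
  let ?A = "{\<phi> \<in> borel_measurable borel. \<forall>x. \<phi> x \<in> {-1..1::real}}"
  let ?F = "\<lambda>\<phi>. (LINT x|distr M borel U. \<phi> x) - (LINT x|distr M borel V. \<phi> x)"
  have F: "?F \<phi> = (LINT \<omega>|M. \<phi> (U \<omega>)) - (LINT \<omega>|M. \<phi> (V \<omega>))" if "\<phi> \<in> borel_measurable borel" for \<phi> :: "'v \<Rightarrow> real"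
    using that by (simp add: integral_distr)
  have "?F \<phi> \<le> tv" unfolding tv_norm_diff_def
  proof (rule cSUP_upper)
    show "\<phi> \<in> ?A" using \<phi> bd by (auto simp: abs_le_iff minus_le_iff)
    show "bdd_above (?F ` ?A)"
    proof (rule bdd_aboveI2)
      fix \<phi> :: "'v \<Rightarrow> real" assume "\<phi> \<in> ?A"
      then have "\<phi> \<in> borel_measurable borel" "\<And>x. \<bar>\<phi> x\<bar> \<le> 1" by (auto simp: abs_le_iff minus_le_iff)
      then show "?F \<phi> \<le> 2" using F expectation_diff_le_two by simp
    qed
  qed
  then show ?thesis using F[OF \<phi>] by simp
qed

lemma tv_norm_diff_least:
  assumes lip: "\<And>f L. L-lipschitz_on UNIV f \<Longrightarrow> (\<And>x. \<bar>f x\<bar> \<le> 1) \<Longrightarrow>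
     (LINT \<omega>|M. f (U \<omega>)) - (LINT \<omega>|M. f (V \<omega>)) \<le> (c::real)"
  shows "tv \<le> c"
  unfolding tv_norm_diff_def
proof (rule cSUP_least)
  show "{\<phi> \<in> borel_measurable borel. \<forall>x. \<phi> x \<in> {-1..1::real}} \<noteq> ({} :: ('v \<Rightarrow> real) set)"
    by (auto intro!: exI[of _ "\<lambda>_. 0"])
  fix \<phi> :: "'v \<Rightarrow> real" assume "\<phi> \<in> {\<phi> \<in> borel_measurable borel. \<forall>x. \<phi> x \<in> {-1..1::real}}"
  then have \<phi>: "\<phi> \<in> borel_measurable borel" "\<And>x. \<bar>\<phi> x\<bar> \<le> 1" by (auto simp: abs_le_iff minus_le_iff)
  interpret DU: prob_space "distr M borel U" by (rule prob_space_distr) fact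
  interpret DV: prob_space "distr M borel V" by (rule prob_space_distr) fact
  show "(LINT x|distr M borel U. \<phi> x) - (LINT x|distr M borel V. \<phi> x) \<le> c"
  proof (rule integral_diff_le_of_lipschitz[OF DU.prob_space_axioms DV.prob_space_axioms _ _ _ \<phi>])
    fix g :: "'v \<Rightarrow> real" and L assume g: "L-lipschitz_on UNIV g" "\<And>x. \<bar>g x\<bar> \<le> 1"
    then show "(LINT x|distr M borel U. g x) - (LINT x|distr M borel V. g x) \<le> c"
      using lip[OF g] lipschitz_on_borel_measurable[OF g(1)] by (simp add: integral_distr)
  qed auto
qed

lemma tv_norm_diff_le_two: "tv \<le> 2"
  by (rule tv_norm_diff_least) (intro expectation_diff_le_two lipschitz_on_borel_measurable)

lemma tv_norm_diff_scaled:
  fixes \<psi> :: "'v \<Rightarrow> real"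
  assumes \<psi>[measurable]: "\<psi> \<in> borel_measurable borel" and bd: "\<And>x. \<bar>\<psi> x\<bar> \<le> m"
  shows "\<bar>(LINT \<omega>|M. \<psi> (U \<omega>)) - (LINT \<omega>|M. \<psi> (V \<omega>))\<bar> \<le> m * tv"
proof (cases "m = 0")
  case True
  then have "\<psi> x = 0" for x using bd[of x] by simp
  then show ?thesis using True by simp
next
  case False
  have m: "0 < m" using bd[of 0] False by (smt (verit) abs_ge_zero)
  have b: "\<bar>\<psi> x / m\<bar> \<le> 1" "\<bar>- \<psi> x / m\<bar> \<le> 1" for x using bd[of x] m by (simp_all add: abs_divide)
  have "((LINT \<omega>|M. \<psi> (U \<omega>)) - (LINT \<omega>|M. \<psi> (V \<omega>))) / m \<le> tv"
    using tv_norm_diff_upper[of "\<lambda>x. \<psi> x / m"] b by (simp add: diff_divide_distrib)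
  moreover have "- ((LINT \<omega>|M. \<psi> (U \<omega>)) - (LINT \<omega>|M. \<psi> (V \<omega>))) / m \<le> tv"
    using tv_norm_diff_upper[of "\<lambda>x. - \<psi> x / m"] b by (simp add: diff_divide_distrib)
  ultimately show ?thesis using m by (simp only: pos_divide_le_eq abs_le_iff mult.commute)
qed

end

end

text \<open>
  A process with bounded drift and a Markov chain with the one-step law of the randomized scheme,
  started at the same point. The chain only enters through the means of functions of its states.
\<close>

locale euler_comparison = bounded_drift_process M Y W b \<beta> T
  for M :: "'a measure" and Y W :: "real \<Rightarrow> 'a \<Rightarrow> 'v::euclidean_space" and b :: "real \<Rightarrow> 'v \<Rightarrow> 'v" and \<beta> T :: real +
  fixes S :: "nat \<Rightarrow> 'a \<Rightarrow> 'v" and h :: real and N :: nat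
  assumes h_pos: "0 < h" and horizon: "real N * h \<le> T"
    and S_measurable: "\<And>k. k \<le> N \<Longrightarrow> S k \<in> borel_measurable M"
    and S_step: "\<And>k f C. k < N \<Longrightarrow> f \<in> borel_measurable borel \<Longrightarrow> (\<And>x. \<bar>f x\<bar> \<le> C) \<Longrightarrow>
       (LINT \<omega>|M. f (S (Suc k) \<omega>)) =
       (LINT r:{real k * h..real (k + 1) * h}|lborel. LINT \<omega>|M. heat h f (S k \<omega> + h *\<^sub>R b r (S k \<omega>))) / h"
    and S_start: "AE \<omega> in M. Y 0 \<omega> = S 0 \<omega>"
begin

lemma Y_at_measurable: "Y t \<in> borel_measurable M"
  by measurable

text \<open>
  The counterpart of \<open>flux (real K * h) f\<close> on the step with index \<open>k\<close>: gradient and state are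
  frozen at the beginning of the step, while time still varies in the drift.
\<close>

definition scheme_flux :: "nat \<Rightarrow> ('v \<Rightarrow> real) \<Rightarrow> nat \<Rightarrow> real \<Rightarrow> real" where
  "scheme_flux K f k r = (LINT \<omega>|M. heat_grad (real (K - k) * h) f (S k \<omega>) \<bullet> b r (S k \<omega>))"

lemma scheme_flux_measurable:
  assumes "k \<le> N" and [measurable]: "f \<in> borel_measurable borel"
  shows "scheme_flux K f k \<in> borel_measurable borel"
proof -
  have [measurable]: "S k \<in> borel_measurable M" by (rule S_measurable[OF assms(1)])
  show ?thesis unfolding scheme_flux_def[abs_def] by measurable
qed

context
  fixes f :: "'v \<Rightarrow> real" and C :: real
  assumes f[measurable]: "f \<in> borel_measurable borel" and bd: "\<And>x. \<bar>f x\<bar> \<le> C"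
begin

lemma scheme_flux_integrable:
  assumes "k < K" "K \<le> N"
  shows "set_integrable lborel {x..y} (scheme_flux K f k)"
proof (rule set_integrable_bounded_Icc)
  show "scheme_flux K f k \<in> borel_measurable borel" using assms by (intro scheme_flux_measurable) auto
  show "norm (scheme_flux K f k r) \<le> 2 * C * sqrt DIM('v) * \<beta> / sqrt (real (K - k) * h)" for r
    unfolding scheme_flux_def using assms h_pos by (intro norm_integral_le_const) (auto simp del: of_nat_diff intro!: gradient_drift_le[OF f bd])
qed

text \<open>
  Both terms on the left are averages of \<open>P = heat (real (K - k) * h) f\<close>, the first one at
  the state displaced by the drift over one step and the second one at the state itself. Thus the
  singular time never falls below \<open>h\<close>, and the expansion of \<open>P\<close> has a remainder of order
  \<open>h\<^sup>2 / (real (K - k) * h)\<close>.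
\<close>

lemma scheme_increment:
  assumes k: "k < K" and K: "K \<le> N"
  shows "\<bar>(LINT \<omega>|M. heat (real (K - Suc k) * h) f (S (Suc k) \<omega>)) - (LINT \<omega>|M. heat (real (K - k) * h) f (S k \<omega>))
      - (LINT r:{real k * h..real (k + 1) * h}|lborel. scheme_flux K f k r)\<bar> \<le> 2 * C * DIM('v) * \<beta>\<^sup>2 * h / real (K - k)"
proof -
  let ?s = "real k * h" and ?u = "real (k + 1) * h" and ?t = "real (K - k) * h"
  let ?P = "heat ?t f"
  have C: "0 \<le> C" using bd[of 0] by linarith
  have [measurable]: "S k \<in> borel_measurable M" using k K by (intro S_measurable) auto
  have t: "0 < ?t" using k h_pos by simp
  have len: "?u - ?s = h" by (simp add: algebra_simps)
  have su: "?s \<le> ?u" using h_pos by simp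
  have Pb: "\<bar>?P x\<bar> \<le> C" for x by (rule abs_heat_le[OF f bd])
  have "h + real (K - Suc k) * h = ?t"
  proof -
    have "real (K - k) = real (K - Suc k) + 1" using k by simp
    then show ?thesis by (simp only: distrib_right mult_1_left add.commute)
  qed
  then have semi: "heat h (heat (real (K - Suc k) * h) f) = ?P"
    using h_pos bd by (simp add: fun_eq_iff heat_semigroup[of f C])
  have "(LINT \<omega>|M. heat (real (K - Suc k) * h) f (S (Suc k) \<omega>)) =
      (LINT r:{?s..?u}|lborel. LINT \<omega>|M. ?P (S k \<omega> + h *\<^sub>R b r (S k \<omega>))) / h"
    using k K unfolding semi[symmetric] by (intro S_step[where C=C]) (auto simp: abs_heat_le[OF f bd])
  moreover have "(LINT \<omega>|M. ?P (S k \<omega>)) = (LINT r:{?s..?u}|lborel. LINT \<omega>|M. ?P (S k \<omega>)) / h"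
    using h_pos su len by (simp add: set_integral_const)
  moreover have "(LINT r:{?s..?u}|lborel. scheme_flux K f k r) = (LINT r:{?s..?u}|lborel. h * scheme_flux K f k r) / h"
    using h_pos by simp
  moreover define p where "p r = (LINT \<omega>|M. ?P (S k \<omega> + h *\<^sub>R b r (S k \<omega>)))" for r
  moreover define q where "q = (LINT \<omega>|M. ?P (S k \<omega>))"
  ultimately have eq: "(LINT \<omega>|M. heat (real (K - Suc k) * h) f (S (Suc k) \<omega>)) - (LINT \<omega>|M. ?P (S k \<omega>))
      - (LINT r:{?s..?u}|lborel. scheme_flux K f k r) =
    ((LINT r:{?s..?u}|lborel. p r) - (LINT r:{?s..?u}|lborel. q) - (LINT r:{?s..?u}|lborel. h * scheme_flux K f k r)) / h"
    by (simp only: diff_divide_distrib)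
  have pm: "p \<in> borel_measurable borel" unfolding p_def[abs_def] by measurable
  have pb: "norm (p r) \<le> C" for r unfolding p_def by (rule norm_integral_le_const) (simp add: Pb)
  have pi: "set_integrable lborel {?s..?u} p" by (rule set_integrable_bounded_Icc[OF pm pb])
  have qi: "set_integrable lborel {?s..?u} (\<lambda>_. q)" by (rule set_integrable_bounded_Icc[where K="norm q"]) auto
  have fi: "set_integrable lborel {?s..?u} (\<lambda>r. h * scheme_flux K f k r)"
    using scheme_flux_integrable[OF k K] by simp
  have diff: "(LINT r:{?s..?u}|lborel. p r) - (LINT r:{?s..?u}|lborel. q) - (LINT r:{?s..?u}|lborel. h * scheme_flux K f k r) =
      (LINT r:{?s..?u}|lborel. p r - q - h * scheme_flux K f k r)"
    using pi qi fi by (simp add: set_integral_diff)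
  have remainder: "norm (LINT r:{?s..?u}|lborel. p r - q - h * scheme_flux K f k r) \<le> (2 * C * DIM('v) / ?t * (h * \<beta>)\<^sup>2) * (?u - ?s)"
  proof (rule norm_set_integral_Icc_le[OF su])
    fix r
    let ?E = "\<lambda>\<omega>. ?P (S k \<omega> + h *\<^sub>R b r (S k \<omega>)) - ?P (S k \<omega>) - heat_grad ?t f (S k \<omega>) \<bullet> (h *\<^sub>R b r (S k \<omega>))"
    have "norm (LINT \<omega>|M. ?E \<omega>) \<le> 2 * C * DIM('v) / ?t * (h * \<beta>)\<^sup>2"
    proof (rule norm_integral_le_const)
      fix \<omega>
      have "\<bar>?E \<omega>\<bar> \<le> 2 * C * (sqrt DIM('v))\<^sup>2 / ?t * (norm (h *\<^sub>R b r (S k \<omega>)))\<^sup>2" by (rule heat_expansion[OF f bd t])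
      also have "\<dots> \<le> 2 * C * (sqrt DIM('v))\<^sup>2 / ?t * (h * \<beta>)\<^sup>2"
        using C t h_pos b_bounded by (intro mult_left_mono power_mono) auto
      finally show "norm (?E \<omega>) \<le> 2 * C * DIM('v) / ?t * (h * \<beta>)\<^sup>2" by simp
    qed
    moreover have "(LINT \<omega>|M. ?E \<omega>) = p r - q - h * scheme_flux K f k r"
    proof -
      have "integrable M (\<lambda>\<omega>. ?P (S k \<omega> + h *\<^sub>R b r (S k \<omega>)))" "integrable M (\<lambda>\<omega>. ?P (S k \<omega>))"
        by (rule integrable_of_bound[where C=C], measurable, simp add: Pb)+
      moreover have "integrable M (\<lambda>\<omega>. heat_grad ?t f (S k \<omega>) \<bullet> b r (S k \<omega>))"
        by (rule integrable_of_bound[where C="2 * C * sqrt DIM('v) * \<beta> / sqrt ?t"], measurable, simp only: real_norm_def gradient_drift_le[OF f bd t])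
      ultimately show ?thesis by (simp add: p_def q_def scheme_flux_def)
    qed
    ultimately show "norm (p r - q - h * scheme_flux K f k r) \<le> 2 * C * DIM('v) / ?t * (h * \<beta>)\<^sup>2" by simp
  qed
  have "\<bar>(LINT \<omega>|M. heat (real (K - Suc k) * h) f (S (Suc k) \<omega>)) - (LINT \<omega>|M. ?P (S k \<omega>))
      - (LINT r:{?s..?u}|lborel. scheme_flux K f k r)\<bar> = \<bar>LINT r:{?s..?u}|lborel. p r - q - h * scheme_flux K f k r\<bar> / h"
    unfolding eq diff abs_divide using h_pos by (simp only: abs_of_pos)
  also have "\<dots> \<le> (2 * C * DIM('v) / ?t * (h * \<beta>)\<^sup>2) * h / h"
    using remainder h_pos unfolding len real_norm_def by (rule divide_right_mono[OF _ less_imp_le])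
  also have "\<dots> = 2 * C * DIM('v) * \<beta>\<^sup>2 * h / real (K - k)"
    using h_pos by (simp add: power2_eq_square)
  finally show ?thesis .
qed

text \<open>
  The Duhamel formula for the scheme, as a telescoping sum of the increments over the steps.
\<close>

lemma scheme_expansion:
  assumes K: "K \<le> N"
  shows "\<bar>(LINT \<omega>|M. f (S K \<omega>)) - (LINT \<omega>|M. heat (real K * h) f (S 0 \<omega>))
      - (\<Sum>k<K. LINT r:{real k * h..real (k + 1) * h}|lborel. scheme_flux K f k r)\<bar>
    \<le> 2 * C * DIM('v) * \<beta>\<^sup>2 * h * (\<Sum>k<K. 1 / real (K - k))"
proof -
  define a where "a k = (LINT \<omega>|M. heat (real (K - k) * h) f (S k \<omega>))" for k
  let ?I = "\<lambda>k. LINT r:{real k * h..real (k + 1) * h}|lborel. scheme_flux K f k r"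
  have "(LINT \<omega>|M. f (S K \<omega>)) = a K" by (simp add: a_def heat_nonpos)
  moreover have "(LINT \<omega>|M. heat (real K * h) f (S 0 \<omega>)) = a 0" by (simp add: a_def)
  moreover have "a K - a 0 = (\<Sum>k<K. a (Suc k) - a k)" by (rule sum_lessThan_telescope[symmetric])
  ultimately have eq: "(LINT \<omega>|M. f (S K \<omega>)) - (LINT \<omega>|M. heat (real K * h) f (S 0 \<omega>)) - (\<Sum>k<K. ?I k) = (\<Sum>k<K. a (Suc k) - a k - ?I k)"
    by (simp only: sum_subtractf)
  have step: "\<bar>a (Suc k) - a k - ?I k\<bar> \<le> 2 * C * DIM('v) * \<beta>\<^sup>2 * h * (1 / real (K - k))" if "k < K" for k
    using scheme_increment[OF that K] unfolding a_def times_divide_eq_right mult_1_right .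
  have "\<bar>\<Sum>k<K. a (Suc k) - a k - ?I k\<bar> \<le> (\<Sum>k<K. \<bar>a (Suc k) - a k - ?I k\<bar>)" by (rule sum_abs)
  also have "\<dots> \<le> (\<Sum>k<K. 2 * C * DIM('v) * \<beta>\<^sup>2 * h * (1 / real (K - k)))"
    by (rule sum_mono) (rule step, simp)
  finally show ?thesis unfolding eq sum_distrib_left .
qed

end

end

section \<open>The error in total variation\<close>

lemma norm_set_integral_le_of_bound:
  fixes f :: "real \<Rightarrow> 'b::{banach, second_countable_topology}"
  assumes g: "set_integrable lborel A g" and le: "AE r in lborel. r \<in> A \<longrightarrow> norm (f r) \<le> g r"
  shows "norm (LINT r:A|lborel. f r) \<le> (LINT r:A|lborel. g r)"
  unfolding set_lebesgue_integral_def
proof (rule norm_integral_le_of_bound)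
  show "integrable lborel (\<lambda>r. indicator A r *\<^sub>R g r)" using g by (simp add: set_integrable_def)
  show "AE r in lborel. norm (indicator A r *\<^sub>R f r) \<le> indicator A r *\<^sub>R g r"
    using le by eventually_elim (simp split: split_indicator)
qed

context bounded_drift_process
begin

definition grad_modulus :: real where
  "grad_modulus = 32 * sqrt DIM('v) ^ 5 * \<beta>"

definition time_modulus :: real where
  "time_modulus = 4 * sqrt DIM('v) * \<beta> + 2 * grad_modulus"

definition error_const :: real where
  "error_const = 2 * grad_modulus + 2 * sqrt DIM('v) * \<beta> * (2 + 12 * (real DIM('v))\<^sup>2 + 2 * time_modulus * sqrt T) +
     4 * real DIM('v) * \<beta>\<^sup>2 * sqrt T"

lemma moduli_nonneg: "0 \<le> grad_modulus" "0 \<le> time_modulus"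
  using \<beta>_nonneg by (auto simp: grad_modulus_def time_modulus_def)

lemma inverse_sqrt_gap_integral:
  assumes "x \<le> y" "y \<le> t" "t \<le> t'"
  shows "set_integrable lborel {x..y} (\<lambda>r. m * (1 / sqrt (t - r) - 1 / sqrt (t' - r)))"
    and "(LINT r:{x..y}|lborel. m * (1 / sqrt (t - r) - 1 / sqrt (t' - r))) =
      m * ((2 * sqrt (t - x) - 2 * sqrt (t - y)) - (2 * sqrt (t' - x) - 2 * sqrt (t' - y)))"
proof -
  have i: "set_integrable lborel {x..y} (\<lambda>r. 1 / sqrt (t - r))" "set_integrable lborel {x..y} (\<lambda>r. 1 / sqrt (t' - r))"
    using assms by (auto intro!: inverse_sqrt_integral(1))
  show "set_integrable lborel {x..y} (\<lambda>r. m * (1 / sqrt (t - r) - 1 / sqrt (t' - r)))"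
    by (intro set_integrable_mult_right set_integral_diff(1) i)
  have "(LINT r:{x..y}|lborel. 1 / sqrt (t - r) - 1 / sqrt (t' - r)) =
      (2 * sqrt (t - x) - 2 * sqrt (t - y)) - (2 * sqrt (t' - x) - 2 * sqrt (t' - y))"
    using assms by (subst set_integral_diff(2)[OF i]) (simp add: inverse_sqrt_integral(2))
  then show "(LINT r:{x..y}|lborel. m * (1 / sqrt (t - r) - 1 / sqrt (t' - r))) =
      m * ((2 * sqrt (t - x) - 2 * sqrt (t - y)) - (2 * sqrt (t' - x) - 2 * sqrt (t' - y)))"
    by (simp only: set_integral_mult_right)
qed

context
  fixes f :: "'v \<Rightarrow> real"
  assumes f[measurable]: "f \<in> borel_measurable borel" and bd: "\<And>x. \<bar>f x\<bar> \<le> 1"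
begin

lemma gradient_drift_measurable: "(\<lambda>x. heat_grad s f x \<bullet> b r x) \<in> borel_measurable borel"
  by measurable

lemma expectation_gradient_time_regularity:
  assumes s: "0 < s" "s \<le> s'"
  shows "\<bar>(LINT \<omega>|M. heat_grad s' f (Y r \<omega>) \<bullet> b r (Y r \<omega>)) - (LINT \<omega>|M. heat_grad s f (Y r \<omega>) \<bullet> b r (Y r \<omega>))\<bar>
     \<le> grad_modulus * (1 / sqrt s - 1 / sqrt s')"
proof -
  have i: "integrable M (\<lambda>\<omega>. heat_grad p f (Y r \<omega>) \<bullet> b r (Y r \<omega>))" if "0 < p" for p
    by (rule integrable_of_bound[where C="2 * sqrt DIM('v) * \<beta> / sqrt p"], measurable, use gradient_drift_le[OF f bd that] in simp)
  have "norm (LINT \<omega>|M. heat_grad s' f (Y r \<omega>) \<bullet> b r (Y r \<omega>) - heat_grad s f (Y r \<omega>) \<bullet> b r (Y r \<omega>)) \<le> grad_modulus * (1 / sqrt s - 1 / sqrt s')"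
  proof (rule norm_integral_le_const)
    fix \<omega>
    have "\<bar>(heat_grad s' f (Y r \<omega>) - heat_grad s f (Y r \<omega>)) \<bullet> b r (Y r \<omega>)\<bar> \<le> (32 * 1 * sqrt DIM('v) ^ 5 * (1 / sqrt s - 1 / sqrt s')) * \<beta>"
      by (intro order_trans[OF inner_drift_le] mult_right_mono heat_grad_time_regularity[OF f bd s] \<beta>_nonneg)
    then show "norm (heat_grad s' f (Y r \<omega>) \<bullet> b r (Y r \<omega>) - heat_grad s f (Y r \<omega>) \<bullet> b r (Y r \<omega>)) \<le> grad_modulus * (1 / sqrt s - 1 / sqrt s')"
      unfolding inner_diff_left grad_modulus_def real_norm_def by (simp only: mult_ac mult_1_right mult_1_left)
  qed
  moreover have "0 < s'" using s by simp
  ultimately show ?thesis using i[OF s(1)] i[of s'] by simp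
qed

end

text \<open>
  The laws of the solution are regular in time although the drift is not: subtract the
  Duhamel formulas at times \<open>r\<close> and \<open>a\<close>. The free parts differ by \<open>(r - a) / a\<close> owing to
  the smoothing of the initial law, the drift after time \<open>a\<close> contributes \<open>sqrt (r - a)\<close>, and so
  does the change of the gradients before time \<open>a\<close>, since its bound telescopes.
\<close>

lemma tv_time_regularity:
  assumes a: "0 < a" "a \<le> r" "r \<le> T"
  shows "tv_norm_diff (distr M borel (Y r)) (distr M borel (Y a)) \<le> 2 * (real DIM('v))\<^sup>2 * (r - a) / a + time_modulus * sqrt (r - a)"
proof (rule tv_norm_diff_least)
  show "Y r \<in> borel_measurable M" "Y a \<in> borel_measurable M" by measurable
  fix f :: "'v \<Rightarrow> real" and L assume L: "L-lipschitz_on UNIV f" and bd: "\<And>x. \<bar>f x\<bar> \<le> 1"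
  have f[measurable]: "f \<in> borel_measurable borel" by (rule lipschitz_on_borel_measurable[OF L])
  let ?H = "\<lambda>t. LINT \<omega>|M. heat t f (Y 0 \<omega>)" and ?F = "\<lambda>x y t. LINT s:{x..y}|lborel. flux t f s"
  have "?H r - ?H a \<le> 2 * (real DIM('v))\<^sup>2 * (r - a) / a"
  proof -
    have i: "integrable M (\<lambda>\<omega>. heat t f (Y 0 \<omega>))" for t
      by (rule integrable_of_bound[where C=1]) (auto simp: abs_heat_le[OF f bd])
    have "norm (LINT \<omega>|M. heat r f (Y 0 \<omega>) - heat a f (Y 0 \<omega>)) \<le> 2 * (real DIM('v))\<^sup>2 * (r - a) / a"
    proof (rule norm_integral_le_const)
      show "norm (heat r f (Y 0 \<omega>) - heat a f (Y 0 \<omega>)) \<le> 2 * (real DIM('v))\<^sup>2 * (r - a) / a" for \<omega>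
        using heat_time_increment[OF f bd, of "r - a" a "Y 0 \<omega>"] a by simp
    qed
    then show ?thesis using i by simp
  qed
  moreover have "?F a r r \<le> 4 * sqrt DIM('v) * \<beta> * sqrt (r - a)"
    using flux_integrable(2)[OF f bd a(2) order_refl[of r]] by simp
  moreover have "?F 0 a r - ?F 0 a a \<le> 2 * grad_modulus * sqrt (r - a)"
  proof -
    have e1: "?F 0 a r - ?F 0 a a = (LINT s:{0..a}|lborel. flux r f s - flux a f s)"
      using a by (intro set_integral_diff(2)[symmetric] flux_integrable(1)[OF f bd]) auto
    have e2: "norm (LINT s:{0..a}|lborel. flux r f s - flux a f s) \<le> (LINT s:{0..a}|lborel. grad_modulus * (1 / sqrt (a - s) - 1 / sqrt (r - s)))"
    proof (rule norm_set_integral_le_of_bound)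
      show "set_integrable lborel {0..a} (\<lambda>s. grad_modulus * (1 / sqrt (a - s) - 1 / sqrt (r - s)))"
        using a by (intro inverse_sqrt_gap_integral(1)) auto
      show "AE s in lborel. s \<in> {0..a} \<longrightarrow> norm (flux r f s - flux a f s) \<le> grad_modulus * (1 / sqrt (a - s) - 1 / sqrt (r - s))"
        using AE_lborel_singleton[of a]
      proof eventually_elim
        fix s assume "s \<noteq> a"
        then show "s \<in> {0..a} \<longrightarrow> norm (flux r f s - flux a f s) \<le> grad_modulus * (1 / sqrt (a - s) - 1 / sqrt (r - s))"
          using expectation_gradient_time_regularity[OF f bd, of "a - s" "r - s" s] a by (auto simp: flux_def)
      qed
    qed
    have e3: "(LINT s:{0..a}|lborel. grad_modulus * (1 / sqrt (a - s) - 1 / sqrt (r - s))) =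
       grad_modulus * ((2 * sqrt (a - 0) - 2 * sqrt (a - a)) - (2 * sqrt (r - 0) - 2 * sqrt (r - a)))"
      using a by (intro inverse_sqrt_gap_integral(2)) auto
    have e4: "grad_modulus * ((2 * sqrt (a - 0) - 2 * sqrt (a - a)) - (2 * sqrt (r - 0) - 2 * sqrt (r - a))) \<le> grad_modulus * (2 * sqrt (r - a))"
      using a moduli_nonneg by (intro mult_left_mono) auto
    have "\<bar>LINT s:{0..a}|lborel. flux r f s - flux a f s\<bar> \<le> grad_modulus * (2 * sqrt (r - a))"
      by (rule order_trans[OF e2[unfolded e3 real_norm_def] e4])
    then show ?thesis unfolding e1 by linarith
  qed
  moreover have "?F 0 r r = ?F 0 a r + ?F a r r"
    using a by (intro set_integral_Icc_split flux_integrable(1)[OF f bd]) auto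
  moreover have "(LINT \<omega>|M. f (Y r \<omega>)) = ?H r + ?F 0 r r" "(LINT \<omega>|M. f (Y a \<omega>)) = ?H a + ?F 0 a a"
    using a by (intro duhamel[OF L bd]; simp)+
  moreover have "time_modulus * sqrt (r - a) = 4 * sqrt DIM('v) * \<beta> * sqrt (r - a) + 2 * grad_modulus * sqrt (r - a)"
    by (simp only: time_modulus_def distrib_right)
  ultimately show "(LINT \<omega>|M. f (Y r \<omega>)) - (LINT \<omega>|M. f (Y a \<omega>)) \<le> 2 * (real DIM('v))\<^sup>2 * (r - a) / a + time_modulus * sqrt (r - a)"
    by linarith
qed

end

context euler_comparison
begin

definition tv_error :: "nat \<Rightarrow> real" where
  "tv_error k = tv_norm_diff (distr M borel (Y (real k * h))) (distr M borel (S k))"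

text \<open>
  How far the law of the solution can move within the step with index \<open>k\<close>. The first step
  only has the trivial bound, as nothing is known about the initial law.
\<close>

definition local_variation :: "nat \<Rightarrow> real" where
  "local_variation k = (if k = 0 then 2 else 2 * (real DIM('v))\<^sup>2 / real k + time_modulus * sqrt h)"

lemma grid_le: "k \<le> N \<Longrightarrow> real k * h \<le> T"
  by (rule order_trans[OF mult_right_mono horizon]) (use h_pos in auto)

lemma tv_local_variation:
  assumes "k < N" "real k * h \<le> r" "r \<le> real (k + 1) * h"
  shows "tv_norm_diff (distr M borel (Y r)) (distr M borel (Y (real k * h))) \<le> local_variation k"
proof (cases "k = 0")
  case True
  then show ?thesis using tv_norm_diff_le_two[OF Y_at_measurable Y_at_measurable] by (simp add: local_variation_def)
next
  case False
  then have a: "0 < real k * h" using h_pos by simp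
  have rT: "r \<le> T" using assms grid_le[of "k + 1"] by simp
  have d: "r - real k * h \<le> h" using assms(3) by (simp add: algebra_simps)
  have "tv_norm_diff (distr M borel (Y r)) (distr M borel (Y (real k * h))) \<le>
      2 * (real DIM('v))\<^sup>2 * (r - real k * h) / (real k * h) + time_modulus * sqrt (r - real k * h)"
    by (rule tv_time_regularity[OF a assms(2) rT])
  also have "\<dots> \<le> 2 * (real DIM('v))\<^sup>2 * h / (real k * h) + time_modulus * sqrt h"
    using a d moduli_nonneg by (intro add_mono divide_right_mono mult_left_mono) auto
  finally show ?thesis using False h_pos by (simp add: local_variation_def)
qed

text \<open>
  Compares the fluxes on one step in three moves: freeze the time in the gradient (the telescoping
  term \<open>G\<close>), freeze the state of the solution at the beginning of the step (its local variation),
  and pass from the solution to the scheme (the error \<open>tv_error k\<close>). The last two are applied to the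
  bounded measurable function \<open>\<psi>\<close> that pairs the gradient with the drift, so that total variation
  is exactly the distance that is needed; no regularity of the drift enters.
\<close>

lemma flux_difference:
  fixes f :: "'v \<Rightarrow> real"
  assumes k: "k < K" and K: "K \<le> N" and f[measurable]: "f \<in> borel_measurable borel" and bd: "\<And>x. \<bar>f x\<bar> \<le> 1"
  defines "t \<equiv> real K * h"
  defines "G \<equiv> \<lambda>k. 2 * sqrt (t + h - real k * h) - 2 * sqrt (t - real k * h)"
  shows "\<bar>(LINT r:{real k * h..real (k + 1) * h}|lborel. flux t f r) - (LINT r:{real k * h..real (k + 1) * h}|lborel. scheme_flux K f k r)\<bar>
    \<le> grad_modulus * (G (Suc k) - G k) + 2 * sqrt DIM('v) * \<beta> * sqrt h * ((local_variation k + tv_error k) / sqrt (real (K - k)))"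
proof -
  let ?s = "real k * h" and ?u = "real (k + 1) * h" and ?c = "sqrt (real DIM('v))"
  define m where "m = 2 * ?c * \<beta> / sqrt (real (K - k) * h)"
  define D where "D = local_variation k + tv_error k"
  have su: "?s \<le> ?u" using h_pos by simp
  have ut: "?u \<le> t" unfolding t_def using k h_pos by (intro mult_right_mono) auto
  have p: "0 < real (K - k) * h" using k h_pos by simp
  have pt: "real (K - k) * h = t - ?s" using k by (simp add: t_def of_nat_diff left_diff_distrib)
  have m: "0 \<le> m" unfolding m_def
    by (intro divide_nonneg_nonneg mult_nonneg_nonneg real_sqrt_ge_zero less_imp_le[OF p] \<beta>_nonneg) auto
  have Sm: "S k \<in> borel_measurable M" using k K by (intro S_measurable) simp
  let ?g = "\<lambda>r. grad_modulus * (1 / sqrt (t - r) - 1 / sqrt (t + h - r))"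
  have gi: "set_integrable lborel {?s..?u} ?g" using su ut h_pos by (intro inverse_sqrt_gap_integral(1)) auto
  have ci: "set_integrable lborel {?s..?u} (\<lambda>_. m * D)" by (rule set_integrable_bounded_Icc[where K="norm (m * D)"]) auto
  have "norm (LINT r:{?s..?u}|lborel. flux t f r - scheme_flux K f k r) \<le> (LINT r:{?s..?u}|lborel. ?g r + m * D)"
  proof (rule norm_set_integral_le_of_bound)
    show "set_integrable lborel {?s..?u} (\<lambda>r. ?g r + m * D)" by (rule set_integral_add(1)[OF gi ci])
    show "AE r in lborel. r \<in> {?s..?u} \<longrightarrow> norm (flux t f r - scheme_flux K f k r) \<le> ?g r + m * D"
      using AE_lborel_singleton[of t]
    proof (eventually_elim, intro impI)
      fix r assume "r \<noteq> t" and r: "r \<in> {?s..?u}"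
      then have rt: "0 < t - r" using ut by auto
      let ?\<psi> = "\<lambda>x. heat_grad (real (K - k) * h) f x \<bullet> b r x"
      have \<psi>: "?\<psi> \<in> borel_measurable borel" by (rule gradient_drift_measurable[OF f bd])
      have \<psi>b: "\<bar>?\<psi> x\<bar> \<le> m" for x using gradient_drift_le[OF f bd p] by (simp only: m_def mult_1_right)
      have "\<bar>flux t f r - (LINT \<omega>|M. ?\<psi> (Y r \<omega>))\<bar> \<le> grad_modulus * (1 / sqrt (t - r) - 1 / sqrt (real (K - k) * h))"
        using expectation_gradient_time_regularity[OF f bd rt, of "real (K - k) * h" r] r
        unfolding flux_def pt by (simp only: abs_minus_commute) simp
      also have "\<dots> \<le> ?g r"
      proof (intro mult_left_mono diff_left_mono moduli_nonneg frac_le real_sqrt_le_mono)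
        show "0 < sqrt (real (K - k) * h)" using p by (rule real_sqrt_gt_zero)
        have "r - ?s \<le> h" using r by (simp add: algebra_simps)
        then show "real (K - k) * h \<le> t + h - r" unfolding pt by linarith
      qed simp_all
      finally have 1: "\<bar>flux t f r - (LINT \<omega>|M. ?\<psi> (Y r \<omega>))\<bar> \<le> ?g r" .
      have "\<bar>(LINT \<omega>|M. ?\<psi> (Y r \<omega>)) - (LINT \<omega>|M. ?\<psi> (Y ?s \<omega>))\<bar> \<le> m * tv_norm_diff (distr M borel (Y r)) (distr M borel (Y ?s))"
        by (rule tv_norm_diff_scaled[OF Y_at_measurable Y_at_measurable \<psi> \<psi>b])
      also have "\<dots> \<le> m * local_variation k"
        using k K r by (intro mult_left_mono tv_local_variation m) auto
      finally have 2: "\<bar>(LINT \<omega>|M. ?\<psi> (Y r \<omega>)) - (LINT \<omega>|M. ?\<psi> (Y ?s \<omega>))\<bar> \<le> m * local_variation k" .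
      have 3: "\<bar>(LINT \<omega>|M. ?\<psi> (Y ?s \<omega>)) - (LINT \<omega>|M. ?\<psi> (S k \<omega>))\<bar> \<le> m * tv_error k"
        unfolding tv_error_def by (rule tv_norm_diff_scaled[OF Y_at_measurable Sm \<psi> \<psi>b])
      have chain: "\<bar>x - y\<bar> \<le> p1 \<Longrightarrow> \<bar>y - z\<bar> \<le> p2 \<Longrightarrow> \<bar>z - w\<bar> \<le> p3 \<Longrightarrow> \<bar>x - w\<bar> \<le> p1 + (p2 + p3)" for x y z w p1 p2 p3 :: real
        by linarith
      show "norm (flux t f r - scheme_flux K f k r) \<le> ?g r + m * D"
        using chain[OF 1 2 3] unfolding D_def distrib_left scheme_flux_def real_norm_def .
    qed
  qed
  moreover have "(LINT r:{?s..?u}|lborel. flux t f r - scheme_flux K f k r) =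
      (LINT r:{?s..?u}|lborel. flux t f r) - (LINT r:{?s..?u}|lborel. scheme_flux K f k r)"
    by (intro set_integral_diff(2) flux_integrable(1)[OF f bd su ut] scheme_flux_integrable[OF f bd k K])
  moreover have "(LINT r:{?s..?u}|lborel. ?g r + m * D) = grad_modulus * (G (Suc k) - G k) + m * D * h"
  proof -
    have "(LINT r:{?s..?u}|lborel. ?g r) =
       grad_modulus * ((2 * sqrt (t - ?s) - 2 * sqrt (t - ?u)) - (2 * sqrt (t + h - ?s) - 2 * sqrt (t + h - ?u)))"
      using su ut h_pos by (intro inverse_sqrt_gap_integral(2)) auto
    also have "\<dots> = grad_modulus * (G (Suc k) - G k)" by (simp add: G_def)
    finally have 1: "(LINT r:{?s..?u}|lborel. ?g r) = grad_modulus * (G (Suc k) - G k)" .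
    have "?u - ?s = h" by (simp add: algebra_simps)
    then have 2: "(LINT r:{?s..?u}|lborel. m * D) = m * D * h" using su by (simp add: set_integral_const)
    show ?thesis unfolding set_integral_add(2)[OF gi ci] 1 2 ..
  qed
  moreover have "m * D * h = 2 * ?c * \<beta> * sqrt h * (D / sqrt (real (K - k)))"
  proof -
    have "h = sqrt h * sqrt h" using h_pos by simp
    then have "m * D * h = 2 * ?c * \<beta> / (sqrt (real (K - k)) * sqrt h) * D * (sqrt h * sqrt h)" by (simp only: m_def real_sqrt_mult)
    also have "\<dots> = 2 * ?c * \<beta> * sqrt h * (D / sqrt (real (K - k)))"
    proof -
      have cancel: "x / (y * z) * D * (z * z) = x * z * (D / y)" if "0 < z" for x y z :: real using that by simp
      show ?thesis by (rule cancel) (use h_pos in simp)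
    qed
    finally show ?thesis .
  qed
  ultimately show ?thesis unfolding D_def real_norm_def by (simp only:)
qed

text \<open>
  The terms \<open>1 / (k sqrt (K - k))\<close> are summable uniformly in \<open>K\<close>, because the singularities at
  both ends are separated.
\<close>

lemma sum_local_variation_le:
  assumes K: "K \<le> N"
  shows "(\<Sum>k<K. local_variation k / sqrt (real (K - k))) \<le> 2 + 12 * (real DIM('v))\<^sup>2 + 2 * time_modulus * sqrt T"
proof (cases "K = 0")
  case True
  have "0 \<le> T" using horizon h_pos by (meson less_imp_le mult_nonneg_nonneg of_nat_0_le_iff order_trans)
  then show ?thesis using True moduli_nonneg by simp
next
  case False
  have split: "{..<K} = insert 0 {1..<K}" using False by auto
  have "(\<Sum>k<K. local_variation k / sqrt (real (K - k))) \<le>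
     2 + (\<Sum>k\<in>{1..<K}. 2 * (real DIM('v))\<^sup>2 * (1 / (real k * sqrt (real (K - k)))) + time_modulus * sqrt h * (1 / sqrt (real (K - k))))"
  proof -
    have "local_variation 0 / sqrt (real (K - 0)) \<le> 2 / 1"
      unfolding local_variation_def using False by (intro divide_left_mono[THEN order_trans[of _ "2 / sqrt (real (K - 0))"]] frac_le) auto
    moreover have "(\<Sum>k\<in>{1..<K}. local_variation k / sqrt (real (K - k))) =
       (\<Sum>k\<in>{1..<K}. 2 * (real DIM('v))\<^sup>2 * (1 / (real k * sqrt (real (K - k)))) + time_modulus * sqrt h * (1 / sqrt (real (K - k))))"
      by (intro sum.cong) (auto simp: local_variation_def add_divide_distrib)
    ultimately show ?thesis unfolding split by (subst sum.insert) auto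
  qed
  also have "\<dots> = 2 + (2 * (real DIM('v))\<^sup>2 * (\<Sum>k\<in>{1..<K}. 1 / (real k * sqrt (real (K - k)))) + time_modulus * sqrt h * (\<Sum>k\<in>{1..<K}. 1 / sqrt (real (K - k))))"
    by (simp only: sum.distrib sum_distrib_left)
  also have "\<dots> \<le> 2 + (2 * (real DIM('v))\<^sup>2 * 6 + time_modulus * sqrt h * (2 * sqrt (real K)))"
  proof (intro add_left_mono add_mono mult_left_mono sum_inverse_cross_le)
    have "(\<Sum>k\<in>{1..<K}. 1 / sqrt (real (K - k))) \<le> (\<Sum>k<K. 1 / sqrt (real (K - k)))"
      by (intro sum_mono2) auto
    also have "\<dots> = (\<Sum>i<K. 1 / sqrt (real (Suc i)))" by (rule sum_diff_reindex[where F="\<lambda>j. 1 / sqrt (real j)"])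
    also have "\<dots> \<le> 2 * sqrt (real K)" by (rule sum_inverse_sqrt_le)
    finally show "(\<Sum>k\<in>{1..<K}. 1 / sqrt (real (K - k))) \<le> 2 * sqrt (real K)" .
  qed (use moduli_nonneg h_pos in auto)
  also have "\<dots> = 2 + 12 * (real DIM('v))\<^sup>2 + 2 * time_modulus * sqrt (real K * h)"
    by (simp add: real_sqrt_mult)
  also have "\<dots> \<le> 2 + 12 * (real DIM('v))\<^sup>2 + 2 * time_modulus * sqrt T"
    using grid_le[OF K] moduli_nonneg by (intro add_left_mono mult_left_mono) auto
  finally show ?thesis .
qed

text \<open>
  Subtract the expansions of the solution and of the scheme. The gradients contribute a telescoping sum
  of order \<open>sqrt h\<close>, the Taylor remainders \<open>h\<close> times a harmonic sum, which is at most of order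
  \<open>sqrt h\<close>, and the local variations another term of that order.
\<close>

lemma tv_error_recursion:
  assumes K: "K \<le> N"
  shows "tv_error K \<le> error_const * sqrt h + 2 * sqrt DIM('v) * \<beta> * sqrt h * (\<Sum>k<K. tv_error k / sqrt (real (K - k)))"
  unfolding tv_error_def[of K]
proof (rule tv_norm_diff_least[OF Y_at_measurable S_measurable[OF K]])
  fix f :: "'v \<Rightarrow> real" and L assume L: "L-lipschitz_on UNIV f" and bd: "\<And>x. \<bar>f x\<bar> \<le> 1"
  have f[measurable]: "f \<in> borel_measurable borel" by (rule lipschitz_on_borel_measurable[OF L])
  have T: "0 \<le> T" using horizon h_pos by (meson less_imp_le mult_nonneg_nonneg of_nat_0_le_iff order_trans)
  define t where "t = real K * h"
  define q where "q = 2 * sqrt DIM('v) * \<beta> * sqrt h"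
  have q: "0 \<le> q" using \<beta>_nonneg h_pos by (simp add: q_def)
  have t: "0 \<le> t" "t \<le> T" using grid_le[OF K] h_pos by (auto simp: t_def)
  \<comment> \<open>a primitive of the bound for the change of the gradients, at the grid points; it is \<open>2 * sqrt h\<close> at \<open>K\<close> and nonnegative at \<open>0\<close>\<close>
  define G where "G k = 2 * sqrt (t + h - real k * h) - 2 * sqrt (t - real k * h)" for k
  let ?F = "\<lambda>k. LINT r:{real k * h..real (k + 1) * h}|lborel. flux t f r"
  let ?S = "\<lambda>k. LINT r:{real k * h..real (k + 1) * h}|lborel. scheme_flux K f k r"
  have "(LINT r:{0..real j * h}|lborel. flux t f r) = (\<Sum>k<j. ?F k)" if "j \<le> K" for j
    using that
  proof (induction j)
    case 0
    show ?case using flux_integrable(2)[OF f bd, of 0 0 t] t by simp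
  next
    case (Suc j)
    have "real (Suc j) * h \<le> t" unfolding t_def using Suc.prems h_pos by (intro mult_right_mono) auto
    then have "(LINT r:{0..real (Suc j) * h}|lborel. flux t f r) = (LINT r:{0..real j * h}|lborel. flux t f r) + (LINT r:{real j * h..real (Suc j) * h}|lborel. flux t f r)"
      using h_pos by (intro set_integral_Icc_split flux_integrable(1)[OF f bd]) auto
    then show ?case using Suc by simp
  qed
  from this[of K] have "(LINT r:{0..t}|lborel. flux t f r) = (\<Sum>k<K. ?F k)" by (simp add: t_def)
  then have Y: "(LINT \<omega>|M. f (Y t \<omega>)) = (LINT \<omega>|M. heat t f (Y 0 \<omega>)) + (\<Sum>k<K. ?F k)"
    using duhamel[OF L bd t] by simp
  have S0: "S 0 \<in> borel_measurable M" by (rule S_measurable) simp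
  have start: "(LINT \<omega>|M. heat t f (Y 0 \<omega>)) = (LINT \<omega>|M. heat t f (S 0 \<omega>))"
    using S_start Y_at_measurable[of 0] S0 by (intro integral_cong_AE) auto
  have "(LINT \<omega>|M. f (Y t \<omega>)) - (LINT \<omega>|M. f (S K \<omega>)) \<le> (\<Sum>k<K. ?F k - ?S k) + 2 * 1 * DIM('v) * \<beta>\<^sup>2 * h * (\<Sum>k<K. 1 / real (K - k))"
    using scheme_expansion[OF f bd K] unfolding Y start t_def[symmetric] sum_subtractf by linarith
  also have "(\<Sum>k<K. ?F k - ?S k) \<le> (\<Sum>k<K. grad_modulus * (G (Suc k) - G k) + q * ((local_variation k + tv_error k) / sqrt (real (K - k))))"
  proof (rule sum_mono)
    fix k assume "k \<in> {..<K}"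
    then have "k < K" by simp
    from flux_difference[OF this K f bd]
    show "?F k - ?S k \<le> grad_modulus * (G (Suc k) - G k) + q * ((local_variation k + tv_error k) / sqrt (real (K - k)))"
      unfolding t_def[symmetric] G_def q_def by (rule order_trans[OF abs_ge_self])
  qed
  also have "\<dots> = grad_modulus * (G K - G 0) + (q * (\<Sum>k<K. local_variation k / sqrt (real (K - k))) + q * (\<Sum>k<K. tv_error k / sqrt (real (K - k))))"
    by (simp only: sum.distrib sum_distrib_left[symmetric] sum_lessThan_telescope add_divide_distrib distrib_left)
  also have "grad_modulus * (G K - G 0) \<le> grad_modulus * (2 * sqrt h)"
    using moduli_nonneg t h_pos by (intro mult_left_mono) (auto simp: G_def t_def[symmetric])
  also have "q * (\<Sum>k<K. local_variation k / sqrt (real (K - k))) \<le> q * (2 + 12 * (real DIM('v))\<^sup>2 + 2 * time_modulus * sqrt T)"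
    by (intro mult_left_mono sum_local_variation_le K q)
  also have "2 * 1 * DIM('v) * \<beta>\<^sup>2 * h * (\<Sum>k<K. 1 / real (K - k)) \<le> 2 * 1 * DIM('v) * \<beta>\<^sup>2 * (2 * sqrt T * sqrt h)"
  proof -
    have "(\<Sum>k<K. 1 / real (K - k)) = (\<Sum>i<K. 1 / real (Suc i))" by (rule sum_diff_reindex[where F="\<lambda>j. 1 / real j"])
    also have "\<dots> \<le> (\<Sum>i<K. 1 / sqrt (real (Suc i)))"
    proof (rule sum_mono)
      fix i :: nat
      have "sqrt (real (Suc i)) \<le> real (Suc i)" by (rule real_le_lsqrt[THEN order_trans[OF _ order_refl]]) (auto simp: power2_eq_square)
      then show "1 / real (Suc i) \<le> 1 / sqrt (real (Suc i))" by (intro divide_left_mono) auto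
    qed
    also have "\<dots> \<le> 2 * sqrt (real K)" by (rule sum_inverse_sqrt_le)
    finally have "h * (\<Sum>k<K. 1 / real (K - k)) \<le> h * (2 * sqrt (real K))" using h_pos by (intro mult_left_mono) auto
    also have "\<dots> = 2 * (sqrt h * sqrt h) * sqrt (real K)" using h_pos by simp
    also have "\<dots> = 2 * sqrt (real K * h) * sqrt h" by (simp only: real_sqrt_mult mult_ac)
    also have "\<dots> \<le> 2 * sqrt T * sqrt h" using grid_le[OF K] h_pos by (intro mult_right_mono mult_left_mono) auto
    finally show ?thesis unfolding mult.assoc[of _ h] by (intro mult_left_mono) auto
  qed
  finally have "(LINT \<omega>|M. f (Y t \<omega>)) - (LINT \<omega>|M. f (S K \<omega>)) \<le>
     grad_modulus * (2 * sqrt h) + (q * (2 + 12 * (real DIM('v))\<^sup>2 + 2 * time_modulus * sqrt T) + q * (\<Sum>k<K. tv_error k / sqrt (real (K - k)))) +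
     2 * 1 * DIM('v) * \<beta>\<^sup>2 * (2 * sqrt T * sqrt h)" by simp
  also have "\<dots> = error_const * sqrt h + q * (\<Sum>k<K. tv_error k / sqrt (real (K - k)))"
    unfolding error_const_def q_def by (simp add: algebra_simps)
  finally show "(LINT \<omega>|M. f (Y (real K * h) \<omega>)) - (LINT \<omega>|M. f (S K \<omega>)) \<le>
     error_const * sqrt h + 2 * sqrt DIM('v) * \<beta> * sqrt h * (\<Sum>k<K. tv_error k / sqrt (real (K - k)))"
    unfolding t_def q_def .
qed

theorem tv_error_le:
  assumes "k \<le> N"
  shows "tv_error k \<le> 2 * error_const * exp (T\<^sup>2 * (16 * sqrt DIM('v) * \<beta> + 1) ^ 4) * sqrt h"
proof -
  have T: "0 \<le> T" using horizon h_pos by (meson less_imp_le mult_nonneg_nonneg of_nat_0_le_iff order_trans)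
  have "0 \<le> error_const" unfolding error_const_def using moduli_nonneg \<beta>_nonneg T
    by (intro add_nonneg_nonneg mult_nonneg_nonneg) auto
  then have "tv_error k \<le> 2 * (error_const * sqrt h) * exp (T\<^sup>2 * (8 * (2 * sqrt DIM('v) * \<beta>) + 1) ^ 4)"
    using h_pos \<beta>_nonneg by (intro singular_gronwall[OF h_pos _ _ horizon tv_error_recursion assms]) auto
  then show ?thesis by (simp add: mult_ac)
qed

end

section \<open>The rate of convergence\<close>

text \<open>
  The drift is set to zero outside of \<open>[0, T]\<close>. This changes neither the solution on \<open>[0, T]\<close> nor
  the scheme, whose random times lie in that interval, and it makes the drift measurable and bounded
  everywhere. The constant is the one of \<open>tv_error_le\<close>; it depends on \<open>B\<close>, \<open>T\<close> and the dimension only.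
\<close>

theorem theorem2p1:
  fixes M :: "'a measure"
    and m :: "(real ^ 'n::finite) measure"
    and T B :: real
    and b :: "real \<Rightarrow> real ^ 'n \<Rightarrow> real ^ 'n"
    and X0 :: "'a \<Rightarrow> real ^ 'n"
    and W X :: "real \<Rightarrow> 'a \<Rightarrow> real ^ 'n"
    and \<delta> :: "real \<Rightarrow> nat \<Rightarrow> 'a \<Rightarrow> real"
  assumes "prob_space M"
    and "0 < T"
    and "brownian_motion M W"
    and "X0 \<in> borel_measurable M"
    and "distr M borel X0 = m"
    and "independent_rvs M borel X0 (\<Pi>\<^sub>M t\<in>{0..}. borel) (process_path W)"
    and "(\<lambda>(t, x). b t x) \<in> borel_measurable (restrict_space borel ({0..T} \<times> UNIV))"
    and "\<forall>i. \<forall>t\<in>{0..T}. \<forall>x. \<bar>b t x $ i\<bar> \<le> B"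
    and "sde_solution M T b X0 W X"
    and "\<forall>h\<in>{0<..T}. randomized_times M T h X0 W (\<delta> h)"
  shows "\<exists>C::real. \<forall>h\<in>{0<..T}. \<forall>k::nat. k \<le> nat \<lfloor>T / h\<rfloor> \<longrightarrow>
           tv_norm_diff (distr M borel (X (real k * h)))
                        (distr M borel (euler_scheme b h X0 W (\<delta> h) k))
             \<le> C * sqrt h"
proof -
  interpret prob_space M by fact
  note bm = \<open>brownian_motion M W\<close> and ind = \<open>independent_rvs M borel X0 (\<Pi>\<^sub>M t\<in>{0..}. borel) (process_path W)\<close>
  define b' where "b' t x = (if t \<in> {0..T} then b t x else 0)" for t x
  define \<beta> where "\<beta> = real CARD('n) * \<bar>B\<bar>"
  have \<beta>: "0 \<le> \<beta>" by (simp add: \<beta>_def)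
  have b'_measurable: "(\<lambda>z. b' (fst z) (snd z)) \<in> borel_measurable (borel \<Otimes>\<^sub>M borel)"
  proof -
    have "{0..T} \<times> (UNIV :: (real ^ 'n) set) \<in> sets borel" by (intro borel_closed closed_Times) auto
    then have "(\<lambda>z. indicator ({0..T} \<times> UNIV) z *\<^sub>R (case z of (t, x) \<Rightarrow> b t x)) \<in> borel_measurable borel"
      using assms(7) by (subst (asm) borel_measurable_restrict_space_iff) auto
    also have "(\<lambda>z. indicator ({0..T} \<times> UNIV) z *\<^sub>R (case z of (t, x) \<Rightarrow> b t x)) = (\<lambda>z. b' (fst z) (snd z))"
      by (auto simp: fun_eq_iff b'_def split: split_indicator)
    finally show ?thesis by (simp add: borel_prod)
  qed
  have b'_bounded: "norm (b' t x) \<le> \<beta>" for t x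
  proof (cases "t \<in> {0..T}")
    case True
    have "norm (b' t x) \<le> (\<Sum>i\<in>UNIV. \<bar>b' t x $ i\<bar>)" by (rule norm_le_l1_cart)
    also have "\<dots> \<le> (\<Sum>i\<in>(UNIV :: 'n set). \<bar>B\<bar>)"
      using assms(8) True by (intro sum_mono) (auto simp: b'_def intro: order_trans[OF _ abs_ge_self])
    finally show ?thesis by (simp add: \<beta>_def)
  next
    case False
    then have "b' t x = 0" unfolding b'_def by (rule if_not_P)
    then show ?thesis using \<beta> by simp
  qed
  have sde: "sde_solution M T b' X0 W X"
  proof -
    have cut: "b' s (X s \<omega>) = b s (X s \<omega>)" if "s \<in> {0..T}" for s \<omega> using that by (simp add: b'_def)
    have int: "set_integrable lborel {0..T} (\<lambda>s. b' s (X s \<omega>)) \<longleftrightarrow> set_integrable lborel {0..T} (\<lambda>s. b s (X s \<omega>))" for \<omega>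
      by (rule set_integrable_cong) (auto simp: cut)
    have eq: "(LINT s:{0..t}|lborel. b' s (X s \<omega>)) = (LINT s:{0..t}|lborel. b s (X s \<omega>))" if "t \<in> {0..T}" for t \<omega>
      using that by (intro set_lebesgue_integral_cong) (auto simp: cut)
    have solution: "(\<forall>t\<in>{0..T}. X t \<omega> = X0 \<omega> + W t \<omega> + (LINT s:{0..t}|lborel. b' s (X s \<omega>))) \<longleftrightarrow>
        (\<forall>t\<in>{0..T}. X t \<omega> = X0 \<omega> + W t \<omega> + (LINT s:{0..t}|lborel. b s (X s \<omega>)))" for \<omega>
      by (intro ball_cong refl) (simp only: eq)
    show ?thesis using assms(9) unfolding sde_solution_def int solution .
  qed
  obtain Y where Y: "(\<lambda>z. Y (fst z) (snd z)) \<in> borel_measurable (borel \<Otimes>\<^sub>M M)"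
    "\<And>t. t \<in> {0..T} \<Longrightarrow> AE \<omega> in M. Y t \<omega> = X t \<omega>"
    "\<And>t. t \<in> {0..T} \<Longrightarrow> Y t \<in> borel_measurable (augmented_filtration M X0 W t)"
    "AE \<omega> in M. \<forall>s t. 0 \<le> s \<longrightarrow> s \<le> t \<longrightarrow> t \<le> T \<longrightarrow>
            Y t \<omega> - Y s \<omega> = (W t \<omega> - W s \<omega>) + (LINT r:{s..t}|lborel. b' r (Y r \<omega>))"
    "AE \<omega> in M. Y 0 \<omega> = X0 \<omega>"
    "\<And>t. t \<in> {0..T} \<Longrightarrow> X t \<in> borel_measurable M"
    using sde_regular_version[OF bm sde assms(2,4) b'_bounded] by blast
  interpret drift: bounded_drift_process M Y W b' \<beta> T
  proof
    show "W t \<in> borel_measurable M" if "0 \<le> t" for t using bm that by (simp add: brownian_motion_def)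
    show "independent_rvs M borel (Y s) borel (\<lambda>\<omega>. W u \<omega> - W s \<omega>)" if "0 \<le> s" "s \<le> u" "u \<le> T" for s u
      using that by (intro adapted_indep_increment[OF bm ind] Y(3)) auto
  qed (use Y b'_measurable b'_bounded brownian_increment_distr[OF bm] in auto)
  define C where "C = 2 * drift.error_const * exp (T\<^sup>2 * (16 * sqrt DIM(real ^ 'n) * \<beta> + 1) ^ 4)"
  have "tv_norm_diff (distr M borel (X (real k * h))) (distr M borel (euler_scheme b h X0 W (\<delta> h) k)) \<le> C * sqrt h"
    if h: "h \<in> {0<..T}" and k: "k \<le> nat \<lfloor>T / h\<rfloor>" for h k
  proof -
    interpret scheme: randomized_euler M W X0 b' "\<delta> h" \<beta> T h
      using bm ind b'_measurable b'_bounded h assms(10) by unfold_locales auto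
    have N: "scheme.N = nat \<lfloor>T / h\<rfloor>" by (rule scheme.N_def)
    have horizon: "real scheme.N * h \<le> T"
    proof -
      have "real scheme.N \<le> T / h" unfolding N using h by (simp add: of_nat_floor)
      then show ?thesis using h by (simp add: pos_le_divide_eq)
    qed
    interpret comparison: euler_comparison M Y W b' \<beta> T "euler_scheme b' h X0 W (\<delta> h)" h scheme.N
    proof
      show "AE \<omega> in M. Y 0 \<omega> = euler_scheme b' h X0 W (\<delta> h) 0 \<omega>" using Y(5) by simp
    qed (use h in simp, rule horizon, rule scheme.scheme_measurable, assumption, rule scheme.scheme_step, assumption+)
    have same: "euler_scheme b' h X0 W (\<delta> h) j \<omega> = euler_scheme b h X0 W (\<delta> h) j \<omega>" if "j \<le> scheme.N" "\<omega> \<in> space M" for j \<omega>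
      using that(1)
    proof (induction j)
      case (Suc j)
      have "\<delta> h j \<omega> \<in> {real j * h..real (j + 1) * h}"
        using assms(10) h Suc.prems that(2) unfolding randomized_times_def Let_def N by auto
      moreover have "real (j + 1) * h \<le> real scheme.N * h" using Suc.prems h by (intro mult_right_mono) auto
      moreover have "0 \<le> real j * h" using h by simp
      ultimately have "\<delta> h j \<omega> \<in> {0..T}" using horizon by auto
      then show ?case using Suc by (simp add: b'_def)
    qed simp
    have kN: "k \<le> scheme.N" using k N by simp
    have kT: "real k * h \<in> {0..T}" using comparison.grid_le[OF kN] h by simp
    have "distr M borel (X (real k * h)) = distr M borel (Y (real k * h))"
    proof (rule distr_cong_AE)
      show "X (real k * h) \<in> borel_measurable M" by (rule Y(6)[OF kT])
    qed (use Y(2)[OF kT] drift.Y_comp_measurable in auto)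
    moreover have "distr M borel (euler_scheme b h X0 W (\<delta> h) k) = distr M borel (euler_scheme b' h X0 W (\<delta> h) k)"
      using same[OF kN] by (intro distr_cong) auto
    ultimately show ?thesis
      using comparison.tv_error_le[OF kN] unfolding comparison.tv_error_def C_def by (simp only:)
  qed
  then show ?thesis by blast
qed

end
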